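(* Let $S=\{S_t\}_{t\in\mathbb{R}_+}$ be the aggregate process induced by a $P$-risk process $(N,X)$ on a probability space $(\Omega,\Sigma,P)$, let $W$ be the interarrival process of $N$, and let $\Theta$ be a real-valued random variable on $\Omega$ with $P_\Theta((0,\infty))=1$, where $\Sigma=\mathcal{F}_\infty$. Let $\{P_\theta\}_{\theta\in(0,\infty)}$ be a regular conditional probability of $P$ over $P_\Theta$ consistent with $\Theta$. Assume that: (a1) the processes $W$ and $X$ are $P$-conditionally mutually independent given $\Theta$; (a2) the random variable $\Theta$ and the sequence $X$ are $P$-independent; and that the random variables $X_1$ and $\Theta$ are $P$-integrable. Then the following statements are equivalent: (i) the aggregate process $S$ is a $P$-compound mixed Poisson process with parameters $\Theta$ and $P_{X_1}$ (i.e. $N$ is a $P$-mixed Poisson process with parameter $\Theta$); (ii) the process $\{S_t-t\,\Theta\,\mathbb{E}_P[X_1]\}_{t\in\mathbb{R}_+}$ is an $\mathcal{F}$-martingale in $\mathcal{L}^1(P)$; (iii) for $P_\Theta$-almost all $\theta\in(0,\infty)$ the process $\{S_t-t\,\theta\,\mathbb{E}_{P_\theta}[X_1]\}_{t\in\mathbb{R}_+}$ is an $\mathcal{F}$-martingale in $\mathcal{L}^1(P_\theta)$; (iv) the process $\{N_t-t\Theta\}_{t\in\mathbb{R}_+}$ is an $\mathcal{F}^{N,\Theta}$-martingale in $\mathcal{L}^1(P)$; (v) for $P_\Theta$-almost all $\theta\in(0,\infty)$ the process $\{N_t-t\theta\}_{t\in\mathbb{R}_+}$ is an $\mathcal{F}^{N,\Theta}$-martingale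 in $\mathcal{L}^1(P_\theta)$.
   Context: Counting process: $N=\{N_t\}_{t\in\mathbb{R}_+}$ is a family of random variables such that, for every $\omega\in\Omega$ (the exceptional null set is assumed empty): $N_0(\omega)=0$; $N_t(\omega)\in\mathbb{N}_0$ for all $t$ (explosion $\{\sup_n T_n<\infty\}$ is assumed empty); $N_t(\omega)=\inf_{s>t}N_s(\omega)$ for all $t\ge 0$; $\sup_{s<t}N_s(\omega)\le N_t(\omega)\le \sup_{s<t}N_s(\omega)+1$ for all $t>0$; and $\sup_{t}N_t(\omega)=\infty$. The arrival process is $T_n:=\inf\{t\in\mathbb{R}_+:N_t=n\}$, $n\in\mathbb{N}_0$, and the interarrival process is $W=\{W_n\}_{n\in\mathbb{N}}$, $W_n:=T_n-T_{n-1}$. Size process: $X=\{X_n\}_{n\in\mathbb{N}}$ is a sequence of positive random variables. The aggregate process induced by $N$ and $X$ is $S_t:=\sum_{k=1}^{N_t}X_k$. The pair $(N,X)$ is a $P$-risk process if $N$ is a counting process, $X$ is $P$-i.i.d., and $N$ and $X$ are $P$-independent. Image measures: $P_\Theta$, $P_{X_1}$ denote the laws of $\Theta$, $X_1$ under $P$; $P_{\,\cdot\mid\Theta}$ denotes conditional distributions given $\sigma(\Theta)$. Mixed Poisson process: $N$ is a $P$-mixed Poisson process with parameter $\Theta$ if it has $P$-conditionally independent increments given $\Theta$ (for all $0=t_0<t_1<\dots<t_m$ the increments $N_{t_j}-N_{t_{j-1}}$, $1\le j\le m$, are conditionally independent given $\sigma(\Theta)$), $P$-conditionally stationary increments given $\Theta$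 (for all $0=t_0<\dots<t_m$ and $h\ge0$ the conditional joint law given $\Theta$ of $(N_{t_j+h}-N_{t_{j-1}+h})_{1\le j\le m}$ equals that of $(N_{t_j}-N_{t_{j-1}})_{1\le j\le m}$ almost surely), and for each $t>0$ the conditional law of $N_t$ given $\Theta$ is, $P\restriction\sigma(\Theta)$-a.s., the Poisson law with parameter $t\Theta$. The aggregate process $S$ is a $P$-compound mixed Poisson process with parameters $\Theta$ and $P_{X_1}$ if it is induced by a $P$-risk process $(N,X)$ with $N$ a $P$-mixed Poisson process with parameter $\Theta$. Regular conditional probability: a family $\{P_\theta\}_{\theta\in(0,\infty)}$ of probability measures on $\Sigma$ such that for each $D\in\Sigma$ the function $\theta\mapsto P_\theta(D)$ is Borel measurable and $\int P_\theta(D)\,P_\Theta(d\theta)=P(D)$. It is consistent with $\Theta$ if for each Borel $B\subseteq(0,\infty)$, $P_\theta(\Theta^{-1}(B))=1$ for $P_\Theta$-almost all $\theta\in B$. Existence of such a family is a standing assumption. Filtrations: $\mathcal{F}^S_t:=\sigma(S_s:s\le t)$, $\mathcal{F}_t:=\sigma(\mathcal{F}^S_t\cup\sigma(\Theta))$, $\mathcal{F}:=\{\mathcal{F}_t\}_{t\in\mathbb{R}_+}$, $\mathcal{F}_\infty:=\sigma\bigl(\bigcup_t\mathcal{F}^S_t\cup\sigma(\Theta)\bigr)$; $\mathcal{F}^N_t:=\sigma(N_s:s\le t)$, $\mathcal{F}^{N,\Theta}_t:=\sigma(\mathcal{F}^N_t\cup\sigma(\Theta))$, $\mathcal{F}^{N,\Theta}:=\{\mathcal{F}^{N,\Theta}_t\}_{t\in\mathbb{R}_+}$.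 Martingale: for a probability measure $R$ on $\Sigma$ and a filtration $\{\mathcal{Z}_t\}$, a process $\{Z_t\}$ is a $\{\mathcal{Z}_t\}$-martingale in $\mathcal{L}^1(R)$ if each $Z_t$ is $\mathcal{Z}_t$-measurable and $R$-integrable and $\int_E Z_s\,dR=\int_E Z_t\,dR$ for all $s\le t$ and $E\in\mathcal{Z}_s$. *)

theory Defs
  imports "HOL-Probability.Probability" "HOL-Library.Extended_Nat"
begin

text \<open>
  Time is \<open>real\<close>, and every condition is guarded by \<open>0 \<le> t\<close>.  Sequences indexed by the positive
  integers (\<open>X\<close>, \<open>W\<close>) are functions on \<open>nat\<close> of which only the values on \<open>{1..}\<close> are used.
\<close>

section \<open>Generated \<open>\<sigma>\<close>-algebras\<close>

text \<open>Only \<^const>\<open>space\<close> and \<^const>\<open>sets\<close> of the measures below are meaningful.\<close>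

definition generated_sigma :: "'a set \<Rightarrow> 'b measure \<Rightarrow> ('i \<Rightarrow> 'a \<Rightarrow> 'b) \<Rightarrow> 'i set \<Rightarrow> 'a measure" where
  "generated_sigma \<Omega> B Y I = sigma \<Omega> (\<Union>i\<in>I. {Y i -` A \<inter> \<Omega> | A. A \<in> sets B})"

definition enlarged_filtration ::
  "'a set \<Rightarrow> 'b measure \<Rightarrow> (real \<Rightarrow> 'a \<Rightarrow> 'b) \<Rightarrow> ('a \<Rightarrow> real) \<Rightarrow> real \<Rightarrow> 'a measure" where
  "enlarged_filtration \<Omega> B Y \<Theta> t =
     sigma \<Omega> (sets (generated_sigma \<Omega> B Y {0..t}) \<union> sets (vimage_algebra \<Omega> \<Theta> borel))"

definition enlarged_filtration_inf ::
  "'a set \<Rightarrow> 'b measure \<Rightarrow> (real \<Rightarrow> 'a \<Rightarrow> 'b) \<Rightarrow> ('a \<Rightarrow> real) \<Rightarrow> 'a measure" where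
  "enlarged_filtration_inf \<Omega> B Y \<Theta> =
     sigma \<Omega> ((\<Union>t\<in>{0..}. sets (generated_sigma \<Omega> B Y {0..t})) \<union> sets (vimage_algebra \<Omega> \<Theta> borel))"

section \<open>Conditional independence\<close>

definition cond_prob_given :: "'a measure \<Rightarrow> 'a measure \<Rightarrow> 'a set \<Rightarrow> 'a \<Rightarrow> real" where
  "cond_prob_given M Z A = real_cond_exp M Z (indicator A)"

definition cond_indep_sets ::
  "'a measure \<Rightarrow> 'a measure \<Rightarrow> ('i \<Rightarrow> 'a set set) \<Rightarrow> 'i set \<Rightarrow> bool" where
  "cond_indep_sets M Z F I \<longleftrightarrow> (\<forall>i\<in>I. F i \<subseteq> sets M) \<and>
     (\<forall>J\<subseteq>I. J \<noteq> {} \<longrightarrow> finite J \<longrightarrow> (\<forall>A\<in>Pi J F.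
        AE \<omega> in M. cond_prob_given M Z (\<Inter>j\<in>J. A j) \<omega> = (\<Prod>j\<in>J. cond_prob_given M Z (A j) \<omega>)))"

section \<open>Counting, arrival, interarrival and aggregate processes\<close>

text \<open>Infima and suprema are taken in \<^typ>\<open>enat\<close>, since \<^const>\<open>Sup\<close> on \<^typ>\<open>nat\<close> is junk
  for unbounded sets.\<close>

definition counting_process :: "'a measure \<Rightarrow> (real \<Rightarrow> 'a \<Rightarrow> nat) \<Rightarrow> bool" where
  "counting_process M N \<longleftrightarrow>
     (\<forall>t\<ge>0. N t \<in> M \<rightarrow>\<^sub>M count_space UNIV) \<and>
     (\<forall>\<omega>\<in>space M.
        N 0 \<omega> = 0 \<and>
        (\<forall>t\<ge>0. enat (N t \<omega>) = (INF s\<in>{t<..}. enat (N s \<omega>))) \<and>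
        (\<forall>t>0. (SUP s\<in>{0..<t}. enat (N s \<omega>)) \<le> enat (N t \<omega>) \<and>
               enat (N t \<omega>) \<le> (SUP s\<in>{0..<t}. enat (N s \<omega>)) + 1) \<and>
        (SUP t\<in>{0..}. enat (N t \<omega>)) = \<infinity>)"

definition arrival :: "(real \<Rightarrow> 'a \<Rightarrow> nat) \<Rightarrow> nat \<Rightarrow> 'a \<Rightarrow> real" where
  "arrival N n \<omega> = Inf {t. 0 \<le> t \<and> N t \<omega> = n}"

definition interarrival :: "(real \<Rightarrow> 'a \<Rightarrow> nat) \<Rightarrow> nat \<Rightarrow> 'a \<Rightarrow> real" where
  "interarrival N n \<omega> = arrival N n \<omega> - arrival N (n - 1) \<omega>"

definition size_process :: "'a measure \<Rightarrow> (nat \<Rightarrow> 'a \<Rightarrow> real) \<Rightarrow> bool" where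
  "size_process M X \<longleftrightarrow> (\<forall>n\<ge>1. X n \<in> borel_measurable M \<and> (\<forall>\<omega>\<in>space M. 0 < X n \<omega>))"

definition aggregate :: "(real \<Rightarrow> 'a \<Rightarrow> nat) \<Rightarrow> (nat \<Rightarrow> 'a \<Rightarrow> real) \<Rightarrow> real \<Rightarrow> 'a \<Rightarrow> real" where
  "aggregate N X t \<omega> = (\<Sum>k=1..N t \<omega>. X k \<omega>)"

definition risk_process :: "'a measure \<Rightarrow> (real \<Rightarrow> 'a \<Rightarrow> nat) \<Rightarrow> (nat \<Rightarrow> 'a \<Rightarrow> real) \<Rightarrow> bool" where
  "risk_process M N X \<longleftrightarrow>
     counting_process M N \<and> size_process M X \<and>
     prob_space.indep_vars M (\<lambda>_. borel) X {1..} \<and>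
     (\<forall>n\<ge>1. distr M borel (X n) = distr M borel (X 1)) \<and>
     prob_space.indep_set M
       (sets (generated_sigma (space M) (count_space UNIV) N {0..}))
       (sets (generated_sigma (space M) borel X {1..}))"

section \<open>Mixed Poisson and compound mixed Poisson processes\<close>

definition increment :: "(real \<Rightarrow> 'a \<Rightarrow> nat) \<Rightarrow> real \<Rightarrow> real \<Rightarrow> 'a \<Rightarrow> real" where
  "increment N s t \<omega> = real (N t \<omega>) - real (N s \<omega>)"

definition cond_indep_increments ::
  "'a measure \<Rightarrow> (real \<Rightarrow> 'a \<Rightarrow> nat) \<Rightarrow> ('a \<Rightarrow> real) \<Rightarrow> bool" where
  "cond_indep_increments M N \<Theta> \<longleftrightarrow>
     (\<forall>(m::nat) (t::nat \<Rightarrow> real). t 0 = 0 \<and> strict_mono_on {0..m} t \<longrightarrow>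
        cond_indep_sets M (vimage_algebra (space M) \<Theta> borel)
          (\<lambda>j. sets (vimage_algebra (space M) (increment N (t (j - 1)) (t j)) borel)) {1..m})"

text \<open>Equality of conditional laws is almost sure equality of the conditional probabilities of each
  measurable set.  The quantifier over sets stands outside the almost sure statement because
  \<^const>\<open>real_cond_exp\<close> fixes an arbitrary version for each set separately.\<close>

definition cond_stationary_increments ::
  "'a measure \<Rightarrow> (real \<Rightarrow> 'a \<Rightarrow> nat) \<Rightarrow> ('a \<Rightarrow> real) \<Rightarrow> bool" where
  "cond_stationary_increments M N \<Theta> \<longleftrightarrow>
     (\<forall>(m::nat) (t::nat \<Rightarrow> real). \<forall>h\<ge>0. t 0 = 0 \<and> strict_mono_on {0..m} t \<longrightarrow>
        (\<forall>B\<in>sets (PiM {1..m} (\<lambda>_. borel)). AE \<omega> in M.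
           cond_prob_given M (vimage_algebra (space M) \<Theta> borel)
             {\<omega>\<in>space M. (\<lambda>j\<in>{1..m}. increment N (t (j - 1) + h) (t j + h) \<omega>) \<in> B} \<omega> =
           cond_prob_given M (vimage_algebra (space M) \<Theta> borel)
             {\<omega>\<in>space M. (\<lambda>j\<in>{1..m}. increment N (t (j - 1)) (t j) \<omega>) \<in> B} \<omega>))"

text \<open>\<^const>\<open>poisson_pmf\<close> is only meaningful for a positive rate; below it is used for \<open>\<Theta>\<close> that are
  almost surely positive.\<close>

definition mixed_poisson_process ::
  "'a measure \<Rightarrow> (real \<Rightarrow> 'a \<Rightarrow> nat) \<Rightarrow> ('a \<Rightarrow> real) \<Rightarrow> bool" where
  "mixed_poisson_process M N \<Theta> \<longleftrightarrow>
     counting_process M N \<and>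
     cond_indep_increments M N \<Theta> \<and>
     cond_stationary_increments M N \<Theta> \<and>
     (\<forall>t>0. \<forall>B. AE \<omega> in restr_to_subalg M (vimage_algebra (space M) \<Theta> borel).
        cond_prob_given M (vimage_algebra (space M) \<Theta> borel) {\<omega>\<in>space M. N t \<omega> \<in> B} \<omega> =
        measure (measure_pmf (poisson_pmf (t * \<Theta> \<omega>))) B)"

text \<open>\<open>S\<close> is a compound mixed Poisson process with parameters \<open>\<Theta>\<close> and \<open>Q\<close>, relative to the pair
  \<open>(N, X)\<close> that induces it.\<close>

definition compound_mixed_poisson_process ::
  "'a measure \<Rightarrow> (real \<Rightarrow> 'a \<Rightarrow> nat) \<Rightarrow> (nat \<Rightarrow> 'a \<Rightarrow> real) \<Rightarrow> (real \<Rightarrow> 'a \<Rightarrow> real) \<Rightarrow>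
   ('a \<Rightarrow> real) \<Rightarrow> real measure \<Rightarrow> bool" where
  "compound_mixed_poisson_process M N X S \<Theta> Q \<longleftrightarrow>
     risk_process M N X \<and>
     (\<forall>t\<ge>0. \<forall>\<omega>\<in>space M. S t \<omega> = aggregate N X t \<omega>) \<and>
     Q = distr M borel (X 1) \<and>
     mixed_poisson_process M N \<Theta>"

section \<open>Regular conditional probabilities\<close>

definition regular_cond_prob ::
  "'a measure \<Rightarrow> ('a \<Rightarrow> real) \<Rightarrow> (real \<Rightarrow> 'a measure) \<Rightarrow> bool" where
  "regular_cond_prob M \<Theta> P \<longleftrightarrow>
     (\<forall>\<theta>>0. prob_space (P \<theta>) \<and> sets (P \<theta>) = sets M) \<and>
     (\<forall>D\<in>sets M.
        (\<lambda>\<theta>. measure (P \<theta>) D) \<in> borel_measurable (restrict_space borel {0<..}) \<and>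
        set_lebesgue_integral (distr M borel \<Theta>) {0<..} (\<lambda>\<theta>. measure (P \<theta>) D) = measure M D)"

definition consistent_with ::
  "'a measure \<Rightarrow> ('a \<Rightarrow> real) \<Rightarrow> (real \<Rightarrow> 'a measure) \<Rightarrow> bool" where
  "consistent_with M \<Theta> P \<longleftrightarrow>
     (\<forall>B\<in>sets borel. B \<subseteq> {0<..} \<longrightarrow>
        (AE \<theta> in distr M borel \<Theta>. \<theta> \<in> B \<longrightarrow> measure (P \<theta>) (\<Theta> -` B \<inter> space M) = 1))"

section \<open>Martingales\<close>

definition martingale_L1 ::
  "'a measure \<Rightarrow> (real \<Rightarrow> 'a measure) \<Rightarrow> (real \<Rightarrow> 'a \<Rightarrow> real) \<Rightarrow> bool" where
  "martingale_L1 R Z Y \<longleftrightarrow>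
     (\<forall>t\<ge>0. Y t \<in> borel_measurable (Z t) \<and> integrable R (Y t)) \<and>
     (\<forall>s t. 0 \<le> s \<and> s \<le> t \<longrightarrow>
        (\<forall>E\<in>sets (Z s). set_lebesgue_integral R E (Y s) = set_lebesgue_integral R E (Y t)))"

end

(* A process A with A 0 = 0 is compensated by c * Theta if the integral of A t - A s over every event of
   the past at time s equals that of (t - s) * c * Theta; all five statements are compared with the statement that N
   is compensated by Theta.

   Disintegration, (ii) <-> (iii) and (iv) <-> (v): by consistency Theta = theta holds P_theta-almost surely, so the
   compensation identity for M, tested on events intersected with preimages under Theta, gives it for almost every
   P_theta on each single event. Right-continuity makes the past at a rational time countably generated, which
   allows one null set to serve all events and rational times, and then extends the identity to real times.

   Claim sizes, (ii) <-> (iv): (a1) and (a2) make X independent of (N, Theta). Before the k-th claim the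
   past of S only involves N, Theta and the first k - 1 claims, so increments of S and of N have integrals
   proportional with ratio E[X 1]. Since claims are positive, N is adapted to the filtration of S.

   Poisson law, (i) <-> (iv): both are equivalent to N t - N s having, on every event of the past, the Poisson law
   with parameter (t - s) * Theta. This follows from (iv) by computing the generating function of the increment
   along finer and finer partitions. *)

theory Submission
  imports Defs
begin

section \<open>Paths of a counting process\<close>

text \<open>Compensation is an identity between two measures on the past, so each extension to
  larger families of events is uniqueness of finite measures on an intersection-stable generator.
  The finiteness comes from the identity itself at time 0, where the process vanishes. Conditional
  probabilities are fixed only up to null sets, separately for each event. Hence the arguments run
  on integrals over events, and conditional probabilities appear only where the definition of a
  mixed Poisson process is entered or left. In (iii) the mean is taken under
  \<open>P \<theta>\<close>; (a2) makes it equal to the mean under \<open>M\<close> for almost every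
  \<theta>. In the partition argument the second-order error is uniform only for bounded \<Theta>,
  so events are first cut to bounded \<Theta>. The other error vanishes path by path, because jump
  times keep a positive distance on a bounded interval, and a multiple of \<open>N t\<close>
  dominates it. The definition in (i) speaks of finitely many increments starting at time 0, so (i)
  first reaches only pasts at finitely many times; their union generates the past.\<close>

locale counting_path =
  fixes n :: "real \<Rightarrow> nat"
  assumes start: "n 0 = 0"
    and right: "\<And>t. 0 \<le> t \<Longrightarrow> enat (n t) = (INF s\<in>{t<..}. enat (n s))"
    and jump: "\<And>t. 0 < t \<Longrightarrow> enat (n t) \<le> (SUP s\<in>{0..<t}. enat (n s)) + 1"
    and unbounded: "(SUP t\<in>{0..}. enat (n t)) = \<infinity>"
begin

text \<open>The value at \<open>s\<close> is an infimum over all later times, hence below each later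
  value: the condition that encodes right-continuity also carries monotonicity.\<close>

lemma path_mono: "0 \<le> s \<Longrightarrow> s \<le> t \<Longrightarrow> n s \<le> n t"
proof (cases "s = t")
  case False
  assume *: "0 \<le> s" "s \<le> t"
  have "(INF u\<in>{s<..}. enat (n u)) \<le> enat (n t)"
    using * False by (intro INF_lower) auto
  then have "enat (n s) \<le> enat (n t)" by (simp only: right[OF *(1), symmetric])
  then show ?thesis by simp
qed auto

text \<open>An infimum of natural numbers is attained, here at some \<open>u > t\<close>; by
  monotonicity the path cannot move between \<open>t\<close> and \<open>u\<close>.\<close>

lemma path_right_const:
  assumes "0 \<le> t" obtains u where "t < u" "\<And>s. t \<le> s \<Longrightarrow> s \<le> u \<Longrightarrow> n s = n t"
proof -
  let ?A = "(\<lambda>s. enat (n s)) ` {t<..}"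
  have "Inf ?A \<in> ?A"
    by (rule wellorder_InfI[of "enat (n (t + 1))"]) auto
  then obtain u where u: "t < u" "enat (n u) = Inf ?A" by auto
  then have "enat (n u) = enat (n t)" by (simp only: right[OF assms, symmetric])
  then have eq: "n u = n t" by simp
  show ?thesis
  proof (rule that[OF u(1)])
    fix s assume "t \<le> s" "s \<le> u"
    then show "n s = n t" using path_mono[of t s] path_mono[of s u] eq assms by auto
  qed
qed

text \<open>If every earlier value were at most \<open>n t - 2\<close>, the left supremum plus one
  would still stay below \<open>n t\<close>, against \<open>jump\<close>.\<close>

lemma path_left_jump:
  assumes "0 < t" shows "\<exists>u. 0 \<le> u \<and> u < t \<and> n t \<le> n u + 1"
proof (rule ccontr)
  assume "\<not> ?thesis"
  then have neg: "\<not> n t \<le> n u + 1" if "0 \<le> u" "u < t" for u using that by blast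
  have less: "n u + 1 < n t" if "0 \<le> u" "u < t" for u
    using neg[OF that] by simp
  have pos: "1 < n t" using less[of 0] assms by auto
  have "(SUP s\<in>{0..<t}. enat (n s)) \<le> enat (n t - 2)"
    using less by (intro SUP_least) (force simp: less_eq_Suc_le)
  then have "(SUP s\<in>{0..<t}. enat (n s)) + 1 \<le> enat (n t - 2) + 1"
    by (rule add_right_mono)
  also have "\<dots> < enat (n t)" using pos by (simp add: one_enat_def)
  finally show False using jump[OF assms] by simp
qed

lemma path_unbounded: "\<exists>t. 0 \<le> t \<and> k \<le> n t"
proof (rule ccontr)
  assume "\<not> ?thesis"
  then have "n t \<le> k" if "0 \<le> t" for t using that by (meson nat_le_linear)
  then have "(SUP t\<in>{0..}. enat (n t)) \<le> enat k" by (intro SUP_least) auto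
  then show False using unbounded by simp
qed

text \<open>The level set in the arrival time might a priori be empty. The set \<open>A\<close> of
  times with \<open>k \<le> n t\<close> is nonempty by unboundedness, right-constancy puts its
  infimum \<open>r\<close> into \<open>A\<close>, and jumps of at most one keep the path from
  skipping the level \<open>k\<close> at \<open>r\<close>. So \<open>r\<close> is the arrival
  time.\<close>

lemma path_arrival:
  fixes T :: "nat \<Rightarrow> real"
  defines "T \<equiv> \<lambda>k. Inf {t. 0 \<le> t \<and> n t = k}"
  shows path_arrival_nonneg: "0 \<le> T k"
    and path_arrival_eq: "n (T k) = k"
    and path_arrival_le_iff: "0 \<le> t \<Longrightarrow> k \<le> n t \<longleftrightarrow> T k \<le> t"
proof -
  define A where "A = {t. 0 \<le> t \<and> k \<le> n t}"
  define r where "r = Inf A"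
  have ne: "A \<noteq> {}" using path_unbounded[of k] by (auto simp: A_def)
  have bdd: "bdd_below A" by (auto simp: A_def)
  have r0: "0 \<le> r" unfolding r_def using ne by (intro cInf_greatest) (auto simp: A_def)
  obtain u where u: "r < u" "\<And>s. r \<le> s \<Longrightarrow> s \<le> u \<Longrightarrow> n s = n r"
    using path_right_const[OF r0] by blast
  obtain s where s: "s \<in> A" "s < u" using u(1) cInf_less_iff[OF ne bdd] unfolding r_def by auto
  have "r \<le> s" unfolding r_def using s bdd by (intro cInf_lower)
  then have ge: "k \<le> n r" using u(2)[of s] s by (auto simp: A_def)
  have le: "n r \<le> k"
  proof (cases "r = 0")
    case True then show ?thesis using start by simp
  next
    case False
    then obtain v where v: "0 \<le> v" "v < r" "n r \<le> n v + 1" using path_left_jump[of r] r0 by auto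
    have "v \<notin> A" using v(2) cInf_lower[OF _ bdd, of v] unfolding r_def by auto
    then show ?thesis using v by (auto simp: A_def)
  qed
  have eq: "n r = k" using ge le by simp
  have "Inf {t. 0 \<le> t \<and> n t = k} = r"
  proof (rule cInf_eq_minimum)
    show "r \<in> {t. 0 \<le> t \<and> n t = k}" using eq r0 by simp
    show "r \<le> t" if "t \<in> {t. 0 \<le> t \<and> n t = k}" for t
      unfolding r_def using that by (intro cInf_lower[OF _ bdd]) (auto simp: A_def)
  qed
  then have T: "T k = r" by (simp add: T_def)
  show "0 \<le> T k" "n (T k) = k" using T r0 eq by auto
  show "k \<le> n t \<longleftrightarrow> T k \<le> t" if "0 \<le> t"
  proof
    assume "k \<le> n t" then show "T k \<le> t"
      unfolding T r_def using that by (intro cInf_lower[OF _ bdd]) (auto simp: A_def)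
  next
    assume "T k \<le> t" then show "k \<le> n t"
      using path_mono[of r t] r0 eq T by auto
  qed
qed

text \<open>Every level passed before \<open>s\<close> is held on an interval of positive length,
  which contains a rational time. This lets events of \<open>N\<close> be written as countable
  unions when \<open>N\<close> is recovered from the aggregate process.\<close>

lemma path_value_before:
  assumes "0 \<le> s" "k < n s" obtains q where "q \<in> \<rat>" "0 \<le> q" "q < s" "n q = k"
proof -
  let ?T = "\<lambda>k. Inf {t. 0 \<le> t \<and> n t = k}"
  obtain u where u: "?T k < u" "\<And>v. ?T k \<le> v \<Longrightarrow> v \<le> u \<Longrightarrow> n v = n (?T k)"
    using path_right_const[OF path_arrival_nonneg[of k]] by blast
  have "?T k \<le> s" using path_arrival_le_iff[OF assms(1), of k] assms by auto
  moreover have "?T k \<noteq> s" using path_arrival_eq[of k] assms by auto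
  ultimately have "?T k < min u s" using u by auto
  then obtain q where q: "q \<in> \<rat>" "?T k < q" "q < min u s" using Rats_dense_in_real by blast
  show ?thesis using q u(2)[of q] path_arrival_eq[of k] path_arrival_nonneg[of k]
    by (intro that[of q]) auto
qed

text \<open>Consecutive arrival times are distinct, and only finitely many gaps matter up to time
  \<open>b\<close>; their minimum is the required mesh.\<close>

lemma path_no_double_jump:
  assumes "0 \<le> b"
  obtains \<delta> where "0 < \<delta>" "\<And>u v. 0 \<le> u \<Longrightarrow> u \<le> v \<Longrightarrow> v \<le> b \<Longrightarrow> v - u < \<delta> \<Longrightarrow> n v \<le> n u + 1"
proof -
  let ?T = "\<lambda>k. Inf {t. 0 \<le> t \<and> n t = k}"
  have T_less: "?T k < ?T (Suc k)" for k
  proof -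
    have "?T k \<le> ?T (Suc k)"
      using path_arrival_le_iff[OF path_arrival_nonneg[of "Suc k"], of k] path_arrival_eq[of "Suc k"]
      by auto
    moreover have "?T k \<noteq> ?T (Suc k)"
      using path_arrival_eq[of k] path_arrival_eq[of "Suc k"] by (metis n_not_Suc_n)
    ultimately show ?thesis by simp
  qed
  define \<delta> where "\<delta> = Min ((\<lambda>k. ?T (Suc k) - ?T k) ` {..n b})"
  have "0 < \<delta>" unfolding \<delta>_def using T_less by (subst Min_gr_iff) auto
  moreover have "n v \<le> n u + 1" if *: "0 \<le> u" "u \<le> v" "v \<le> b" "v - u < \<delta>" for u v
  proof (rule ccontr)
    assume "\<not> ?thesis"
    then have "Suc (Suc (n u)) \<le> n v" by simp
    \<comment> \<open>The arrivals at levels \<open>n u + 1\<close> and \<open>n u + 2\<close> both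
      fall between \<open>u\<close> and \<open>v\<close>, so their gap is below
      \<open>v - u\<close>.\<close>
    then have 1: "?T (Suc (Suc (n u))) \<le> v" using path_arrival_le_iff[of v] * by auto
    have 2: "u < ?T (Suc (n u))" using path_arrival_le_iff[of u "Suc (n u)"] * by auto
    have "Suc (n u) \<le> n b" using \<open>Suc (Suc (n u)) \<le> n v\<close> path_mono[of v b] * by auto
    then have "\<delta> \<le> ?T (Suc (Suc (n u))) - ?T (Suc (n u))"
      unfolding \<delta>_def by (intro Min_le) auto
    then show False using 1 2 * by linarith
  qed
  ultimately show ?thesis by (rule that)
qed

end

section \<open>Transfer of the path facts to counting processes and their arrival times\<close>

lemma counting_process_path:
  assumes "counting_process M N" "\<omega> \<in> space M"
  shows "counting_path (\<lambda>t. N t \<omega>)"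
  using assms unfolding counting_process_def by unfold_locales blast+

context
  fixes M :: "'a measure" and N :: "real \<Rightarrow> 'a \<Rightarrow> nat" and \<omega> :: 'a
  assumes counting: "counting_process M N" and \<omega>: "\<omega> \<in> space M"
begin

lemmas counting_mono = counting_path.path_mono[OF counting_process_path[OF counting \<omega>]]
lemmas counting_right_const =
  counting_path.path_right_const[OF counting_process_path[OF counting \<omega>]]
lemmas counting_value_before =
  counting_path.path_value_before[OF counting_process_path[OF counting \<omega>]]
lemmas counting_no_double_jump =
  counting_path.path_no_double_jump[OF counting_process_path[OF counting \<omega>]]

lemma counting_arrival_le_iff: "0 \<le> t \<Longrightarrow> k \<le> N t \<omega> \<longleftrightarrow> arrival N k \<omega> \<le> t"
  unfolding arrival_def
  by (rule counting_path.path_arrival_le_iff[OF counting_process_path[OF counting \<omega>]])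

text \<open>Telescoping from arrival time 0. It expresses \<open>N\<close> through the interarrival
  times, the process of which (a1) speaks.\<close>

lemma arrival_eq_sum_interarrival: "arrival N k \<omega> = (\<Sum>j=1..k. interarrival N j \<omega>)"
proof (induction k)
  case 0
  have "arrival N 0 \<omega> \<le> 0" using counting_arrival_le_iff[of 0 0] by simp
  moreover have "0 \<le> arrival N 0 \<omega>" unfolding arrival_def
    by (rule counting_path.path_arrival_nonneg[OF counting_process_path[OF counting \<omega>]])
  ultimately show ?case by simp
qed (simp add: interarrival_def)

text \<open>A sequence approaching from the right ends up inside an interval of constancy. Equality
  rather than convergence is recorded because it passes at once to the aggregate process, a function
  of the current value of \<open>N\<close>.\<close>

lemma counting_eventually_eq:
  assumes "0 \<le> t" "r \<longlonglongrightarrow> t" "\<And>n. t \<le> r n"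
  shows "\<forall>\<^sub>F n in sequentially. N (r n) \<omega> = N t \<omega>"
proof -
  obtain u where u: "t < u" "\<And>s. t \<le> s \<Longrightarrow> s \<le> u \<Longrightarrow> N s \<omega> = N t \<omega>"
    using counting_right_const[OF assms(1)] by blast
  have "\<forall>\<^sub>F n in sequentially. r n < u" using assms(2) u(1) by (rule order_tendstoD)
  then show ?thesis by eventually_elim (use u(2) assms(3) in \<open>simp only: less_imp_le\<close>)
qed

end

section \<open>Joins of \<open>\<sigma>\<close>-algebras\<close>

lemma space_generated_sigma [simp]: "space (generated_sigma \<Omega> B Y I) = \<Omega>"
  by (auto simp: generated_sigma_def intro!: space_measure_of)

lemma sets_generated_sigma:
  "sets (generated_sigma \<Omega> B Y I) = sigma_sets \<Omega> (\<Union>i\<in>I. {Y i -` A \<inter> \<Omega> | A. A \<in> sets B})"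
  unfolding generated_sigma_def by (rule sets_measure_of) auto

lemma measurable_generated_sigma:
  assumes "i \<in> I" "\<And>x. x \<in> \<Omega> \<Longrightarrow> Y i x \<in> space B"
  shows "Y i \<in> measurable (generated_sigma \<Omega> B Y I) B"
proof (rule measurableI)
  show "Y i -` A \<inter> space (generated_sigma \<Omega> B Y I) \<in> sets (generated_sigma \<Omega> B Y I)"
    if "A \<in> sets B" for A
    unfolding sets_generated_sigma space_generated_sigma using that assms
    by (intro sigma_sets.Basic) auto
qed (use assms in auto)

lemma generated_sigma_subset:
  assumes "space H = \<Omega>" "\<And>i. i \<in> I \<Longrightarrow> Y i \<in> measurable H B"
  shows "sets (generated_sigma \<Omega> B Y I) \<subseteq> sets H"
  unfolding sets_generated_sigma using measurable_sets[OF assms(2)] assms(1)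
  by (intro sets.sigma_sets_subset'[of _ H \<Omega>]) auto

lemma generated_sigma_mono:
  "I \<subseteq> J \<Longrightarrow> sets (generated_sigma \<Omega> B Y I) \<subseteq> sets (generated_sigma \<Omega> B Y J)"
  unfolding sets_generated_sigma by (intro sigma_sets_mono') auto

lemma vimage_algebra_subset:
  "f \<in> measurable H B \<Longrightarrow> space H = \<Omega> \<Longrightarrow> sets (vimage_algebra \<Omega> f B) \<subseteq> sets H"
  using sets_image_in_sets by blast

definition join_sigma :: "'a measure \<Rightarrow> 'a measure \<Rightarrow> 'a measure" where
  "join_sigma A B = sigma (space A) (sets A \<union> sets B)"

lemma enlarged_filtration_eq_join:
  "enlarged_filtration \<Omega> B Y \<Theta> t =
     join_sigma (generated_sigma \<Omega> B Y {0..t}) (vimage_algebra \<Omega> \<Theta> borel)"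
  by (simp add: enlarged_filtration_def join_sigma_def)

context
  fixes A B :: "'a measure"
  assumes space_eq: "space B = space A"
begin

lemma space_join_sigma: "space (join_sigma A B) = space A"
  unfolding join_sigma_def using sets.space_closed[of A] sets.space_closed[of B] space_eq
  by (intro space_measure_of) auto

lemma sets_join_sigma: "sets (join_sigma A B) = sigma_sets (space A) (sets A \<union> sets B)"
  unfolding join_sigma_def using sets.space_closed[of A] sets.space_closed[of B] space_eq
  by (intro sets_measure_of) auto

lemma join_sigma_left: "sets A \<subseteq> sets (join_sigma A B)"
  and join_sigma_right: "sets B \<subseteq> sets (join_sigma A B)"
  unfolding sets_join_sigma by (auto intro: sigma_sets.Basic)

lemma join_sigma_least:
  "space H = space A \<Longrightarrow> sets A \<subseteq> sets H \<Longrightarrow> sets B \<subseteq> sets H \<Longrightarrow> sets (join_sigma A B) \<subseteq> sets H"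
  unfolding sets_join_sigma by (intro sets.sigma_sets_subset'[of _ H "space A"]) auto

lemma measurable_join_left: "f \<in> measurable A K \<Longrightarrow> f \<in> measurable (join_sigma A B) K"
  using join_sigma_left by (auto simp: measurable_def space_join_sigma)

lemma measurable_join_right: "f \<in> measurable B K \<Longrightarrow> f \<in> measurable (join_sigma A B) K"
  using join_sigma_right by (auto simp: measurable_def space_eq space_join_sigma)

text \<open>The union of two \<sigma>-algebras is not stable under intersections, but the sets
  \<open>a \<inter> b\<close> are; this is the generator for all uniqueness arguments on
  joins.\<close>

lemma sets_join_sigma_Int:
  "sets (join_sigma A B) = sigma_sets (space A) {a \<inter> b | a b. a \<in> sets A \<and> b \<in> sets B}"
proof
  have "sets A \<union> sets B \<subseteq> {a \<inter> b | a b. a \<in> sets A \<and> b \<in> sets B}"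
  proof safe
    fix a assume a: "a \<in> sets A"
    then have "a = a \<inter> space B" using sets.sets_into_space space_eq by auto
    then show "\<exists>x y. a = x \<inter> y \<and> x \<in> sets A \<and> y \<in> sets B" using a by blast
  next
    fix b assume b: "b \<in> sets B"
    then have "b = space A \<inter> b" using sets.sets_into_space space_eq by auto
    then show "\<exists>x y. b = x \<inter> y \<and> x \<in> sets A \<and> y \<in> sets B" using b by blast
  qed
  then show "sets (join_sigma A B) \<subseteq> sigma_sets (space A) {a \<inter> b | a b. a \<in> sets A \<and> b \<in> sets B}"
    unfolding sets_join_sigma by (rule sigma_sets_mono')
next
  have "{a \<inter> b | a b. a \<in> sets A \<and> b \<in> sets B} \<subseteq> sets (join_sigma A B)"
    using join_sigma_left join_sigma_right by (auto intro!: sets.Int)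
  then show "sigma_sets (space A) {a \<inter> b | a b. a \<in> sets A \<and> b \<in> sets B} \<subseteq> sets (join_sigma A B)"
    using sets.sigma_sets_subset[of _ "join_sigma A B"] unfolding space_join_sigma by blast
qed

end

lemma Int_stable_Int:
  "Int_stable {a \<inter> b | a b. a \<in> sets A \<and> b \<in> sets B}"
proof (rule Int_stableI)
  fix x y assume "x \<in> {a \<inter> b | a b. a \<in> sets A \<and> b \<in> sets B}" "y \<in> {a \<inter> b | a b. a \<in> sets A \<and> b \<in> sets B}"
  then obtain a b a' b' where "x = a \<inter> b" "y = a' \<inter> b'" "a \<in> sets A" "b \<in> sets B" "a' \<in> sets A" "b' \<in> sets B"
    by blast
  then show "x \<inter> y \<in> {a \<inter> b | a b. a \<in> sets A \<and> b \<in> sets B}"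
    by (intro CollectI exI[of _ "a \<inter> a'"] exI[of _ "b \<inter> b'"]) auto
qed

lemma space_enlarged_filtration [simp]: "space (enlarged_filtration \<Omega> B Y \<Theta> t) = \<Omega>"
  unfolding enlarged_filtration_eq_join by (subst space_join_sigma) simp_all

lemma enlarged_filtration_least:
  assumes "space H = \<Omega>" "\<And>s. 0 \<le> s \<Longrightarrow> s \<le> t \<Longrightarrow> Y s \<in> measurable H B" "\<Theta> \<in> borel_measurable H"
  shows "sets (enlarged_filtration \<Omega> B Y \<Theta> t) \<subseteq> sets H"
  unfolding enlarged_filtration_eq_join using assms
  by (intro join_sigma_least generated_sigma_subset vimage_algebra_subset) auto

lemma measurable_enlarged_process:
  assumes "0 \<le> s" "s \<le> t" "\<And>x. x \<in> \<Omega> \<Longrightarrow> Y s x \<in> space B"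
  shows "Y s \<in> measurable (enlarged_filtration \<Omega> B Y \<Theta> t) B"
  unfolding enlarged_filtration_eq_join using assms
  by (intro measurable_join_left measurable_generated_sigma) auto

lemma measurable_enlarged_parameter:
  "\<Theta> \<in> borel_measurable (enlarged_filtration \<Omega> B Y \<Theta> t)"
  unfolding enlarged_filtration_eq_join
  by (intro measurable_join_right measurable_vimage_algebra1) auto

lemma enlarged_filtration_mono:
  assumes "s \<le> t"
  shows "sets (enlarged_filtration \<Omega> B Y \<Theta> s) \<subseteq> sets (enlarged_filtration \<Omega> B Y \<Theta> t)"
  unfolding enlarged_filtration_eq_join
proof (rule join_sigma_least)
  let ?G = "generated_sigma \<Omega> B Y {0..t}" and ?V = "vimage_algebra \<Omega> \<Theta> borel"
  have "sets (generated_sigma \<Omega> B Y {0..s}) \<subseteq> sets ?G"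
    using assms by (intro generated_sigma_mono) auto
  also have "\<dots> \<subseteq> sets (join_sigma ?G ?V)" by (rule join_sigma_left) simp
  finally show "sets (generated_sigma \<Omega> B Y {0..s}) \<subseteq> sets (join_sigma ?G ?V)" .
  show "sets ?V \<subseteq> sets (join_sigma ?G ?V)" by (rule join_sigma_right) simp
qed (simp_all only: space_join_sigma space_generated_sigma space_vimage_algebra)

lemma enlarged_filtration_subalgebra:
  assumes "\<And>s. 0 \<le> s \<Longrightarrow> Y s \<in> measurable M B" "\<Theta> \<in> borel_measurable M"
  shows "subalgebra M (enlarged_filtration (space M) B Y \<Theta> t)"
  unfolding subalgebra_def
proof
  show "sets (enlarged_filtration (space M) B Y \<Theta> t) \<subseteq> sets M"
    by (rule enlarged_filtration_least) (use assms in auto)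
qed simp

section \<open>Integrals over sub-\<open>\<sigma>\<close>-algebras\<close>

text \<open>\<open>f\<close> and \<open>g\<close> are densities of two measures which agree on an
  intersection-stable class and have finite total mass. Since \<open>G\<close> generates only a
  sub-\<sigma>-algebra, the measures are first restricted to it.\<close>

lemma nn_integral_eq_on_sigma:
  assumes [measurable]: "f \<in> borel_measurable M" "g \<in> borel_measurable M"
    and fin: "(\<integral>\<^sup>+x. f x \<partial>M) < \<infinity>"
    and G: "G \<subseteq> sets M" "Int_stable G" "space M \<in> G"
    and eq: "\<And>E. E \<in> G \<Longrightarrow> (\<integral>\<^sup>+x\<in>E. f x \<partial>M) = (\<integral>\<^sup>+x\<in>E. g x \<partial>M)"
    and E: "E \<in> sigma_sets (space M) G"
  shows "(\<integral>\<^sup>+x\<in>E. f x \<partial>M) = (\<integral>\<^sup>+x\<in>E. g x \<partial>M)"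
proof -
  have Gs: "sigma_sets (space M) G \<subseteq> sets M" using G(1) by (rule sets.sigma_sets_subset)
  have GP: "G \<subseteq> Pow (space M)" using G(1) sets.space_closed by blast
  define H where "H = sigma (space M) G"
  have H: "space H = space M" "sets H = sigma_sets (space M) G" using GP by (auto simp: H_def)
  have sub: "subalgebra (density M h) H" for h :: "'a \<Rightarrow> ennreal" using Gs by (auto simp: subalgebra_def H)
  have em: "emeasure (restr_to_subalg (density M h) H) E = (\<integral>\<^sup>+x\<in>E. h x \<partial>M)"
    if "E \<in> sets H" "h \<in> borel_measurable M" for E and h :: "'a \<Rightarrow> ennreal"
    using that Gs H by (subst emeasure_restr_to_subalg[OF sub]) (auto intro!: emeasure_density)
  have GH: "X \<in> sets H" if "X \<in> G" for X using that H by auto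
  have "restr_to_subalg (density M f) H = restr_to_subalg (density M g) H"
  proof (rule measure_eqI_generator_eq[OF G(2) GP, where A="\<lambda>_. space M"])
    show "emeasure (restr_to_subalg (density M f) H) X = emeasure (restr_to_subalg (density M g) H) X"
      if "X \<in> G" for X using em[OF GH[OF that]] eq[OF that] by simp
    show "emeasure (restr_to_subalg (density M f) H) (space M) \<noteq> \<infinity>"
      using em[OF GH[OF G(3)], of f] fin by (simp cong: nn_integral_cong)
  qed (use G H in \<open>auto simp: sets_restr_to_subalg[OF sub]\<close>)
  then show ?thesis using em[of E f] em[of E g] E H by simp
qed

text \<open>The hypothesis says that the measures with densities \<open>f\<close> and
  \<open>g\<close> have the same restriction to \<open>Z\<close>, and a \<open>Z\<close>-measurable
  integrand sees nothing but this restriction.\<close>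

lemma nn_integral_test_function:
  assumes sub: "subalgebra M Z"
    and [measurable]: "f \<in> borel_measurable M" "g \<in> borel_measurable M"
    and eq: "\<And>E. E \<in> sets Z \<Longrightarrow> (\<integral>\<^sup>+x\<in>E. f x \<partial>M) = (\<integral>\<^sup>+x\<in>E. g x \<partial>M)"
    and u: "u \<in> borel_measurable Z"
  shows "(\<integral>\<^sup>+x. u x * f x \<partial>M) = (\<integral>\<^sup>+x. u x * g x \<partial>M)"
proof -
  have sub': "subalgebra (density M h) Z" for h using sub by (auto simp: subalgebra_def)
  have [measurable]: "u \<in> borel_measurable M" using measurable_from_subalg[OF sub u] .
  have "restr_to_subalg (density M f) Z = restr_to_subalg (density M g) Z"
  proof (rule measure_eqI)
    fix E assume "E \<in> sets (restr_to_subalg (density M f) Z)"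
    then have E: "E \<in> sets Z" "E \<in> sets M" using sub
      by (auto simp: sets_restr_to_subalg[OF sub'] subalgebra_def)
    then show "emeasure (restr_to_subalg (density M f) Z) E = emeasure (restr_to_subalg (density M g) Z) E"
      by (simp add: emeasure_restr_to_subalg[OF sub'] emeasure_density eq)
  qed (simp add: sets_restr_to_subalg[OF sub'])
  then have "(\<integral>\<^sup>+x. u x \<partial>density M f) = (\<integral>\<^sup>+x. u x \<partial>density M g)"
    using nn_integral_subalgebra2[OF sub' u] by metis
  then show ?thesis by (simp add: nn_integral_density mult.commute)
qed

section \<open>Martingales rewritten as compensation identities in \<open>ennreal\<close>\<close>

lemma set_nn_integral_eq_set_integral:
  assumes h: "integrable R h" "AE x in R. 0 \<le> h x" and E: "E \<in> sets R"
  shows "(\<integral>\<^sup>+x\<in>E. ennreal (h x) \<partial>R) = ennreal (set_lebesgue_integral R E h)"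
    and "0 \<le> set_lebesgue_integral R E h"
proof -
  have int: "integrable R (\<lambda>x. indicator E x *\<^sub>R h x)" using integrable_mult_indicator[OF E h(1)] .
  have nn: "AE x in R. 0 \<le> indicator E x *\<^sub>R h x" using h(2) by eventually_elim auto
  have "(\<integral>\<^sup>+x\<in>E. ennreal (h x) \<partial>R) = (\<integral>\<^sup>+x. ennreal (indicator E x *\<^sub>R h x) \<partial>R)"
    by (intro nn_integral_cong) (auto simp: indicator_def)
  also have "\<dots> = ennreal (\<integral>x. indicator E x *\<^sub>R h x \<partial>R)" by (rule nn_integral_eq_integral[OF int nn])
  finally show "(\<integral>\<^sup>+x\<in>E. ennreal (h x) \<partial>R) = ennreal (set_lebesgue_integral R E h)"
    by (simp add: set_lebesgue_integral_def)
  show "0 \<le> set_lebesgue_integral R E h"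
    unfolding set_lebesgue_integral_def using nn by (rule integral_nonneg_AE)
qed

text \<open>Stated with integrals in \<^typ>\<open>ennreal\<close> and without subtraction, so that no integrability has to be assumed;
  a negative \<open>\<Theta>\<close> is cut off at \<open>0\<close>.\<close>

definition compensated_by ::
  "'a measure \<Rightarrow> (real \<Rightarrow> 'a measure) \<Rightarrow> (real \<Rightarrow> 'a \<Rightarrow> real) \<Rightarrow> ('a \<Rightarrow> real) \<Rightarrow> real \<Rightarrow> bool" where
  "compensated_by R Z A \<Theta> c \<longleftrightarrow> (\<forall>s t. 0 \<le> s \<and> s \<le> t \<longrightarrow> (\<forall>E\<in>sets (Z s).
     (\<integral>\<^sup>+\<omega>\<in>E. A t \<omega> \<partial>R) = (\<integral>\<^sup>+\<omega>\<in>E. A s \<omega> \<partial>R) + ennreal ((t - s) * c) * (\<integral>\<^sup>+\<omega>\<in>E. \<Theta> \<omega> \<partial>R)))"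

text \<open>Both sides are the same identity with terms moved across the equation. The difference is
  integrability: it is part of the martingale property, but has to be extracted from
  compensation.\<close>

lemma martingale_L1_iff_compensated:
  assumes sub: "\<And>t. 0 \<le> t \<Longrightarrow> subalgebra R (Z t)"
    and A: "\<And>t. 0 \<le> t \<Longrightarrow> A t \<in> borel_measurable (Z t)"
    and \<Theta>: "\<And>t. 0 \<le> t \<Longrightarrow> \<Theta> \<in> borel_measurable (Z t)"
    and A_nonneg: "\<And>t \<omega>. 0 \<le> t \<Longrightarrow> \<omega> \<in> space R \<Longrightarrow> 0 \<le> A t \<omega>"
    and A0: "\<And>\<omega>. \<omega> \<in> space R \<Longrightarrow> A 0 \<omega> = 0"
    and \<Theta>_nonneg: "AE \<omega> in R. 0 \<le> \<Theta> \<omega>" and int_\<Theta>: "integrable R \<Theta>" and c: "0 \<le> c"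
  shows "martingale_L1 R Z (\<lambda>t \<omega>. A t \<omega> - t * \<Theta> \<omega> * c) \<longleftrightarrow> compensated_by R Z A \<Theta> c"
proof -
  have A_AE: "AE \<omega> in R. 0 \<le> A t \<omega>" if "0 \<le> t" for t using A_nonneg[OF that] by (rule AE_I2)
  have sets_R: "E \<in> sets R" if "0 \<le> t" "E \<in> sets (Z t)" for t E
    using sub[OF that(1)] that by (auto simp: subalgebra_def)
  have set_int: "set_integrable R E h" if "integrable R h" "E \<in> sets R" for h :: "'a \<Rightarrow> real" and E
    unfolding set_integrable_def using integrable_mult_indicator[OF that(2,1)] .
  \<comment> \<open>Integrability is a premise here because the two directions obtain it in
    different ways.\<close>
  have key: "((\<integral>\<^sup>+\<omega>\<in>E. A t \<omega> \<partial>R) = (\<integral>\<^sup>+\<omega>\<in>E. A s \<omega> \<partial>R) + ennreal ((t - s) * c) * (\<integral>\<^sup>+\<omega>\<in>E. \<Theta> \<omega> \<partial>R)) \<longleftrightarrow>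
      set_lebesgue_integral R E (\<lambda>\<omega>. A s \<omega> - s * \<Theta> \<omega> * c) = set_lebesgue_integral R E (\<lambda>\<omega>. A t \<omega> - t * \<Theta> \<omega> * c)"
    if st: "0 \<le> s" "s \<le> t" and E: "E \<in> sets (Z s)" and int: "integrable R (A s)" "integrable R (A t)" for s t E
  proof -
    have ER: "E \<in> sets R" using sets_R st E by blast
    have t: "0 \<le> t" using st by simp
    have lin: "set_lebesgue_integral R E (\<lambda>\<omega>. A u \<omega> - u * \<Theta> \<omega> * c) =
        set_lebesgue_integral R E (A u) - u * set_lebesgue_integral R E \<Theta> * c" if "integrable R (A u)" for u
    proof -
      have "set_lebesgue_integral R E (\<lambda>\<omega>. A u \<omega> - u * \<Theta> \<omega> * c) =
          set_lebesgue_integral R E (A u) - set_lebesgue_integral R E (\<lambda>\<omega>. (u * c) * \<Theta> \<omega>)"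
        using set_int[OF that ER] set_int[OF _ ER, of "\<lambda>\<omega>. (u * c) * \<Theta> \<omega>"] int_\<Theta>
        by (subst set_integral_diff(2)[symmetric]) (auto simp: mult_ac)
      also have "\<dots> = set_lebesgue_integral R E (A u) - u * set_lebesgue_integral R E \<Theta> * c"
        unfolding set_lebesgue_integral_def by (simp add: mult_ac)
      finally show ?thesis .
    qed
    note conv = set_nn_integral_eq_set_integral[OF int(2) A_AE[OF t] ER]
      set_nn_integral_eq_set_integral[OF int(1) A_AE[OF st(1)] ER]
      set_nn_integral_eq_set_integral[OF int_\<Theta> \<Theta>_nonneg ER]
    have nn: "0 \<le> (t - s) * c" using st c by simp
    have "ennreal (set_lebesgue_integral R E (A s)) + ennreal ((t - s) * c) * ennreal (set_lebesgue_integral R E \<Theta>) =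
        ennreal (set_lebesgue_integral R E (A s) + (t - s) * c * set_lebesgue_integral R E \<Theta>)"
      using nn conv(4,6) by (subst ennreal_mult[symmetric], simp_all add: ennreal_plus)
    then show ?thesis
      unfolding conv lin[OF int(1)] lin[OF int(2)]
      using conv(2,4,6) mult_nonneg_nonneg[OF nn conv(6)] by (auto simp: algebra_simps)
  qed
  show ?thesis
  proof
    assume mart: "martingale_L1 R Z (\<lambda>t \<omega>. A t \<omega> - t * \<Theta> \<omega> * c)"
    have int: "integrable R (A t)" if "0 \<le> t" for t
    proof -
      have "integrable R (\<lambda>\<omega>. A t \<omega> - t * \<Theta> \<omega> * c + t * \<Theta> \<omega> * c)"
        using mart that int_\<Theta> unfolding martingale_L1_def
        by (intro Bochner_Integration.integrable_add) auto
      then show ?thesis by simp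
    qed
    show "compensated_by R Z A \<Theta> c"
      unfolding compensated_by_def
    proof (intro allI impI ballI)
      fix s t E assume st: "0 \<le> s \<and> s \<le> t" and E: "E \<in> sets (Z s)"
      then have "set_lebesgue_integral R E (\<lambda>\<omega>. A s \<omega> - s * \<Theta> \<omega> * c) =
          set_lebesgue_integral R E (\<lambda>\<omega>. A t \<omega> - t * \<Theta> \<omega> * c)"
        using mart unfolding martingale_L1_def by blast
      then show "(\<integral>\<^sup>+\<omega>\<in>E. A t \<omega> \<partial>R) = (\<integral>\<^sup>+\<omega>\<in>E. A s \<omega> \<partial>R) + ennreal ((t - s) * c) * (\<integral>\<^sup>+\<omega>\<in>E. \<Theta> \<omega> \<partial>R)"
        using key[OF _ _ E int int] st by auto
    qed
  next
    assume comp: "compensated_by R Z A \<Theta> c"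
    have int: "integrable R (A t)" if t: "0 \<le> t" for t
    proof (rule integrableI_nonneg)
      \<comment> \<open>Started at time 0, where \<open>A\<close> vanishes, and taken over the whole
        space, the identity gives the mean of \<open>A t\<close> as a finite multiple of that of
        \<Theta>.\<close>
      have "space R \<in> sets (Z 0)" using sub[of 0] sets.top[of "Z 0"] by (simp add: subalgebra_def)
      then have "(\<integral>\<^sup>+\<omega>\<in>space R. A t \<omega> \<partial>R) =
          (\<integral>\<^sup>+\<omega>\<in>space R. A 0 \<omega> \<partial>R) + ennreal ((t - 0) * c) * (\<integral>\<^sup>+\<omega>\<in>space R. \<Theta> \<omega> \<partial>R)"
        using comp t unfolding compensated_by_def by blast
      also have "(\<integral>\<^sup>+\<omega>\<in>space R. A 0 \<omega> \<partial>R) = (\<integral>\<^sup>+\<omega>. 0 \<partial>R)"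
        using A0 by (intro nn_integral_cong) simp
      finally have "(\<integral>\<^sup>+\<omega>. A t \<omega> \<partial>R) = ennreal (t * c) * (\<integral>\<^sup>+\<omega>\<in>space R. \<Theta> \<omega> \<partial>R)"
        by (simp cong: nn_integral_cong)
      also have "\<dots> < \<infinity>"
        using set_nn_integral_eq_set_integral[OF int_\<Theta> \<Theta>_nonneg, of "space R"]
        by (simp add: ennreal_mult_less_top)
      finally show "(\<integral>\<^sup>+\<omega>. A t \<omega> \<partial>R) < \<infinity>" .
    qed (use measurable_from_subalg[OF sub A] A_AE t in auto)
    show "martingale_L1 R Z (\<lambda>t \<omega>. A t \<omega> - t * \<Theta> \<omega> * c)"
      unfolding martingale_L1_def
    proof (intro conjI allI impI ballI)
      fix t :: real assume t: "0 \<le> t"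
      show "(\<lambda>\<omega>. A t \<omega> - t * \<Theta> \<omega> * c) \<in> borel_measurable (Z t)"
        using A[OF t] \<Theta>[OF t] by measurable
      show "integrable R (\<lambda>\<omega>. A t \<omega> - t * \<Theta> \<omega> * c)" using int[OF t] int_\<Theta> by auto
    next
      fix s t E assume st: "0 \<le> s \<and> s \<le> t" and E: "E \<in> sets (Z s)"
      then show "set_lebesgue_integral R E (\<lambda>\<omega>. A s \<omega> - s * \<Theta> \<omega> * c) =
          set_lebesgue_integral R E (\<lambda>\<omega>. A t \<omega> - t * \<Theta> \<omega> * c)"
        using key[OF _ _ E int int] comp unfolding compensated_by_def by auto
    qed
  qed
qed

section \<open>Disintegration\<close>

locale disintegration = prob_space M for M :: "'a measure" +
  fixes \<Theta> :: "'a \<Rightarrow> real" and P :: "real \<Rightarrow> 'a measure"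
  assumes \<Theta>_meas [measurable]: "\<Theta> \<in> borel_measurable M"
    and \<Theta>_pos: "measure (distr M borel \<Theta>) {0<..} = 1"
    and regular: "regular_cond_prob M \<Theta> P"
    and consistent: "consistent_with M \<Theta> P"
begin

abbreviation law :: "real measure" where "law \<equiv> distr M borel \<Theta>"

text \<open>\<open>P\<close> is unconstrained outside \<open>{0<..}\<close>; any probability measure on \<open>M\<close> may be used there.\<close>

definition kernel :: "real \<Rightarrow> 'a measure" where
  "kernel \<theta> = (if 0 < \<theta> then P \<theta> else M)"

sublocale law: prob_space law by (rule prob_space_distr) simp

lemma AE_law_pos: "AE \<theta> in law. 0 < \<theta>"
  using law.AE_prob_1[of "{0<..}"] \<Theta>_pos by simp

lemma AE_\<Theta>_pos: "AE \<omega> in M. 0 < \<Theta> \<omega>"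
  using AE_law_pos by (subst (asm) AE_distr_iff) auto

lemma kernel_prob: "prob_space (kernel \<theta>)" and sets_kernel [measurable_cong]: "sets (kernel \<theta>) = sets M"
  using regular prob_space_axioms by (auto simp: kernel_def regular_cond_prob_def)

lemma space_kernel [simp]: "space (kernel \<theta>) = space M"
  using sets_kernel by (rule sets_eq_imp_space_eq)

lemma kernel_pos: "0 < \<theta> \<Longrightarrow> kernel \<theta> = P \<theta>" by (simp add: kernel_def)

lemma measurable_kernel [measurable]: "kernel \<in> measurable borel (subprob_algebra M)"
proof (rule measurable_subprob_algebra)
  show "subprob_space (kernel \<theta>)" for \<theta>
    using kernel_prob by (rule prob_space_imp_subprob_space)
  show "sets (kernel \<theta>) = sets M" for \<theta> by (rule sets_kernel)
  fix D assume D: "D \<in> sets M"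
  have "(\<lambda>\<theta>. if 0 < \<theta> then measure (P \<theta>) D else measure M D) \<in> borel_measurable borel"
    using regular D unfolding regular_cond_prob_def
    by (subst measurable_If_restrict_space_iff) (auto simp: greaterThan_def)
  moreover have "emeasure (kernel \<theta>) D = ennreal (if 0 < \<theta> then measure (P \<theta>) D else measure M D)" for \<theta>
  proof -
    interpret K: prob_space "kernel \<theta>" by (rule kernel_prob)
    show ?thesis by (simp add: K.emeasure_eq_measure) (simp add: kernel_def)
  qed
  ultimately show "(\<lambda>\<theta>. emeasure (kernel \<theta>) D) \<in> borel_measurable borel"
    by (simp add: measurable_compose[OF _ measurable_ennreal])
qed

lemma measurable_kernel_law: "kernel \<in> measurable law (subprob_algebra M)"
  by simp

text \<open>The defining integral of a regular conditional probability runs over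
  \<open>{0<..}\<close>, and the filling by \<open>M\<close> elsewhere lives on a null set of
  \<open>law\<close>. With this, disintegration becomes ordinary calculus of kernels.\<close>

lemma bind_kernel: "law \<bind> kernel = M"
proof (rule measure_eqI)
  show "sets (law \<bind> kernel) = sets M" by (rule sets_bind) (auto simp: sets_kernel)
  fix D assume "D \<in> sets (law \<bind> kernel)"
  then have D: "D \<in> sets M" using sets_bind[of law kernel M] by (simp add: sets_kernel)
  have meas: "(\<lambda>\<theta>. measure (P \<theta>) D) \<in> borel_measurable (restrict_space borel {0<..})"
    and int: "set_lebesgue_integral law {0<..} (\<lambda>\<theta>. measure (P \<theta>) D) = measure M D"
    using regular D unfolding regular_cond_prob_def by auto
  have [measurable]: "(\<lambda>\<theta>. indicator {0<..} \<theta> * measure (P \<theta>) D) \<in> borel_measurable borel"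
    using meas by (subst (asm) borel_measurable_restrict_space_iff) auto
  have bounded: "\<bar>indicator {0<..} \<theta> * measure (P \<theta>) D\<bar> \<le> 1" for \<theta> :: real
    using regular prob_space.prob_le_1[of "P \<theta>" D] unfolding regular_cond_prob_def by (auto simp: indicator_def)
  have intb: "integrable law (\<lambda>\<theta>. indicator {0<..} \<theta> * measure (P \<theta>) D)"
    by (rule law.integrable_const_bound[where B=1]) (use bounded in auto)
  have "emeasure (law \<bind> kernel) D = (\<integral>\<^sup>+\<theta>. emeasure (kernel \<theta>) D \<partial>law)"
    by (rule emeasure_bind[OF _ measurable_kernel_law D]) simp
  also have "\<dots> = (\<integral>\<^sup>+\<theta>. ennreal (indicator {0<..} \<theta> * measure (P \<theta>) D) \<partial>law)"
  proof (rule nn_integral_cong_AE)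
    show "AE \<theta> in law. emeasure (kernel \<theta>) D = ennreal (indicator {0<..} \<theta> * measure (P \<theta>) D)"
      using AE_law_pos
    proof eventually_elim
      fix \<theta> :: real assume pos: "0 < \<theta>"
      interpret K: prob_space "kernel \<theta>" by (rule kernel_prob)
      show "emeasure (kernel \<theta>) D = ennreal (indicator {0<..} \<theta> * measure (P \<theta>) D)"
        using pos by (simp add: K.emeasure_eq_measure) (simp add: kernel_def)
    qed
  qed
  also have "\<dots> = ennreal (\<integral>\<theta>. indicator {0<..} \<theta> * measure (P \<theta>) D \<partial>law)"
    by (rule nn_integral_eq_integral[OF intb]) auto
  also have "\<dots> = emeasure M D"
    using int by (simp add: set_lebesgue_integral_def emeasure_eq_measure)
  finally show "emeasure (law \<bind> kernel) D = emeasure M D" .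
qed

lemma measurable_nn_integral_kernel [measurable]:
  assumes "f \<in> borel_measurable M"
  shows "(\<lambda>\<theta>. \<integral>\<^sup>+\<omega>. f \<omega> \<partial>kernel \<theta>) \<in> borel_measurable borel"
  using measurable_compose[OF measurable_kernel nn_integral_measurable_subprob_algebra[OF assms]] .

lemma nn_integral_kernel:
  assumes "f \<in> borel_measurable M"
  shows "(\<integral>\<^sup>+\<omega>. f \<omega> \<partial>M) = (\<integral>\<^sup>+\<theta>. \<integral>\<^sup>+\<omega>. f \<omega> \<partial>kernel \<theta> \<partial>law)"
  using nn_integral_bind[OF assms measurable_kernel_law] by (simp add: bind_kernel)

text \<open>Consistency yields one null set per Borel set, and singletons are too many. Countably
  many rational half-lines suffice: they force \<Theta> above each rational below \<theta> and below
  each rational above \<theta>.\<close>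

lemma AE_kernel_parameter: "AE \<theta> in law. AE \<omega> in kernel \<theta>. \<Theta> \<omega> = \<theta>"
proof -
  have conc: "AE \<theta> in law. \<theta> \<in> B \<longrightarrow> (AE \<omega> in kernel \<theta>. \<Theta> \<omega> \<in> B)" if B: "B \<in> sets borel" "B \<subseteq> {0<..}" for B
  proof -
    have "AE \<theta> in law. \<theta> \<in> B \<longrightarrow> measure (P \<theta>) (\<Theta> -` B \<inter> space M) = 1"
      using consistent B unfolding consistent_with_def by blast
    then show ?thesis
    proof eventually_elim
      fix \<theta> assume *: "\<theta> \<in> B \<longrightarrow> measure (P \<theta>) (\<Theta> -` B \<inter> space M) = 1"
      interpret K: prob_space "kernel \<theta>" by (rule kernel_prob)
      show "\<theta> \<in> B \<longrightarrow> (AE \<omega> in kernel \<theta>. \<Theta> \<omega> \<in> B)"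
      proof
        assume "\<theta> \<in> B"
        then have "measure (kernel \<theta>) (\<Theta> -` B \<inter> space M) = 1" using * B kernel_pos by auto
        from K.AE_prob_1[OF this] show "AE \<omega> in kernel \<theta>. \<Theta> \<omega> \<in> B" by eventually_elim auto
      qed
    qed
  qed
  \<comment> \<open>The half-lines are cut with \<open>{0<..}\<close> because consistency speaks of
    sets of positive parameters only.\<close>
  have "AE \<theta> in law. \<forall>q\<in>\<rat>. \<theta> \<in> {0<..} \<inter> {q<..} \<longrightarrow> (AE \<omega> in kernel \<theta>. \<Theta> \<omega> \<in> {0<..} \<inter> {q<..})"
    by (intro AE_ball_countable[THEN iffD2] countable_rat ballI conc) auto
  moreover have "AE \<theta> in law. \<forall>q\<in>\<rat>. \<theta> \<in> {0<..} \<inter> {..<q} \<longrightarrow> (AE \<omega> in kernel \<theta>. \<Theta> \<omega> \<in> {0<..} \<inter> {..<q})"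
    by (intro AE_ball_countable[THEN iffD2] countable_rat ballI conc) auto
  ultimately show ?thesis using AE_law_pos
  proof eventually_elim
    fix \<theta> :: real assume l: "\<forall>q\<in>\<rat>. \<theta> \<in> {0<..} \<inter> {q<..} \<longrightarrow> (AE \<omega> in kernel \<theta>. \<Theta> \<omega> \<in> {0<..} \<inter> {q<..})"
      and u: "\<forall>q\<in>\<rat>. \<theta> \<in> {0<..} \<inter> {..<q} \<longrightarrow> (AE \<omega> in kernel \<theta>. \<Theta> \<omega> \<in> {0<..} \<inter> {..<q})"
      and pos: "0 < \<theta>"
    have "AE \<omega> in kernel \<theta>. \<forall>q\<in>\<rat>. q < \<theta> \<longrightarrow> q < \<Theta> \<omega>"
      using l pos by (intro AE_ball_countable[THEN iffD2] countable_rat ballI) auto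
    moreover have "AE \<omega> in kernel \<theta>. \<forall>q\<in>\<rat>. \<theta> < q \<longrightarrow> \<Theta> \<omega> < q"
      using u pos by (intro AE_ball_countable[THEN iffD2] countable_rat ballI) auto
    ultimately show "AE \<omega> in kernel \<theta>. \<Theta> \<omega> = \<theta>"
    proof eventually_elim
      fix \<omega> assume a: "\<forall>q\<in>\<rat>. q < \<theta> \<longrightarrow> q < \<Theta> \<omega>" and b: "\<forall>q\<in>\<rat>. \<theta> < q \<longrightarrow> \<Theta> \<omega> < q"
      show "\<Theta> \<omega> = \<theta>"
      proof (rule ccontr)
        assume "\<Theta> \<omega> \<noteq> \<theta>"
        then consider "\<Theta> \<omega> < \<theta>" | "\<theta> < \<Theta> \<omega>" by linarith
        then show False
        proof cases
          case 1
          then obtain q where "q \<in> \<rat>" "\<Theta> \<omega> < q" "q < \<theta>" using Rats_dense_in_real by blast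
          then show False using a by auto
        next
          case 2
          then obtain q where "q \<in> \<rat>" "\<theta> < q" "q < \<Theta> \<omega>" using Rats_dense_in_real by blast
          then show False using b by auto
        qed
      qed
    qed
  qed
qed

text \<open>Under almost every kernel \<Theta> is the constant \<theta>, so an indicator of \<Theta>
  leaves the inner integral and localises the outer one.\<close>

lemma nn_integral_kernel_on:
  assumes [measurable]: "f \<in> borel_measurable M" "B \<in> sets borel"
  shows "(\<integral>\<^sup>+\<omega>. f \<omega> * indicator B (\<Theta> \<omega>) \<partial>M) = (\<integral>\<^sup>+\<theta>\<in>B. (\<integral>\<^sup>+\<omega>. f \<omega> \<partial>kernel \<theta>) \<partial>law)"
proof -
  have "(\<integral>\<^sup>+\<omega>. f \<omega> * indicator B (\<Theta> \<omega>) \<partial>M) = (\<integral>\<^sup>+\<theta>. \<integral>\<^sup>+\<omega>. f \<omega> * indicator B (\<Theta> \<omega>) \<partial>kernel \<theta> \<partial>law)"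
    by (rule nn_integral_kernel) measurable
  also have "\<dots> = (\<integral>\<^sup>+\<theta>\<in>B. (\<integral>\<^sup>+\<omega>. f \<omega> \<partial>kernel \<theta>) \<partial>law)"
  proof (rule nn_integral_cong_AE)
    show "AE \<theta> in law. (\<integral>\<^sup>+\<omega>. f \<omega> * indicator B (\<Theta> \<omega>) \<partial>kernel \<theta>) = (\<integral>\<^sup>+\<omega>. f \<omega> \<partial>kernel \<theta>) * indicator B \<theta>"
      using AE_kernel_parameter
    proof eventually_elim
      fix \<theta> assume "AE \<omega> in kernel \<theta>. \<Theta> \<omega> = \<theta>"
      then have "(\<integral>\<^sup>+\<omega>. f \<omega> * indicator B (\<Theta> \<omega>) \<partial>kernel \<theta>) = (\<integral>\<^sup>+\<omega>. f \<omega> * indicator B \<theta> \<partial>kernel \<theta>)"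
        by (intro nn_integral_cong_AE) auto
      then show "(\<integral>\<^sup>+\<omega>. f \<omega> * indicator B (\<Theta> \<omega>) \<partial>kernel \<theta>) = (\<integral>\<^sup>+\<omega>. f \<omega> \<partial>kernel \<theta>) * indicator B \<theta>"
        by (simp add: nn_integral_multc)
    qed
  qed
  finally show ?thesis .
qed

text \<open>By localisation both families of fibre integrals are densities of one measure with
  respect to \<open>law\<close>, and densities are unique almost everywhere. No finiteness of the
  integrals is required. This is the way from identities under \<open>M\<close> down to the
  fibres.\<close>

lemma AE_kernel_eqI:
  assumes [measurable]: "f \<in> borel_measurable M" "g \<in> borel_measurable M"
    and eq: "\<And>B. B \<in> sets borel \<Longrightarrow>
      (\<integral>\<^sup>+\<omega>. f \<omega> * indicator B (\<Theta> \<omega>) \<partial>M) = (\<integral>\<^sup>+\<omega>. g \<omega> * indicator B (\<Theta> \<omega>) \<partial>M)"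
  shows "AE \<theta> in law. (\<integral>\<^sup>+\<omega>. f \<omega> \<partial>kernel \<theta>) = (\<integral>\<^sup>+\<omega>. g \<omega> \<partial>kernel \<theta>)"
  by (rule law.density_unique_finite_measure)
    (use eq in \<open>auto simp: nn_integral_kernel_on[symmetric]\<close>)

end

section \<open>Countable generation of the filtration of a right-continuous process\<close>

text \<open>The features shared by \<open>N\<close> and the aggregate process, so that
  disintegration is carried out once for both. Right-continuity is stated for sequences, the form
  that dominated convergence consumes.\<close>

locale increasing_process = disintegration +
  fixes A :: "real \<Rightarrow> 'a \<Rightarrow> real"
  assumes A_meas: "\<And>t. 0 \<le> t \<Longrightarrow> A t \<in> borel_measurable M"
    and A_mono: "\<And>\<omega> s t. \<omega> \<in> space M \<Longrightarrow> 0 \<le> s \<Longrightarrow> s \<le> t \<Longrightarrow> A s \<omega> \<le> A t \<omega>"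
    and A_zero: "\<And>\<omega>. \<omega> \<in> space M \<Longrightarrow> A 0 \<omega> = 0"
    and A_right: "\<And>\<omega> t r. \<omega> \<in> space M \<Longrightarrow> 0 \<le> t \<Longrightarrow> r \<longlonglongrightarrow> t \<Longrightarrow> (\<And>n. t \<le> r n) \<Longrightarrow>
      (\<lambda>n. A (r n) \<omega>) \<longlonglongrightarrow> A t \<omega>"
    and \<Theta>_int: "integrable M \<Theta>"
begin

abbreviation filt :: "real \<Rightarrow> 'a measure" where
  "filt \<equiv> enlarged_filtration (space M) borel A \<Theta>"

lemma A_nonneg: "\<omega> \<in> space M \<Longrightarrow> 0 \<le> t \<Longrightarrow> 0 \<le> A t \<omega>"
  using A_mono[of \<omega> 0 t] A_zero[of \<omega>] by simp

lemma subalgebra_filt: "subalgebra M (filt t)"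
  by (rule enlarged_filtration_subalgebra) (use A_meas in auto)

lemma A_adapted: "0 \<le> s \<Longrightarrow> s \<le> t \<Longrightarrow> A s \<in> borel_measurable (filt t)"
  by (rule measurable_enlarged_process) auto

text \<open>Right-continuity expresses the values at all times in \<open>{0..s}\<close> through
  rational times, and a countable base of the reals leaves countably many preimages. Finite
  intersections make the family stable without losing countability.\<close>

lemma filt_countable_generator:
  assumes s: "s \<in> \<rat>" "0 \<le> s"
  obtains G where "countable G" "Int_stable G" "space M \<in> G" "G \<subseteq> sets (filt s)"
    "sets (filt s) \<subseteq> sigma_sets (space M) G"
proof -
  obtain \<B> :: "real set set" where B: "countable \<B>" "topological_basis \<B>"
    using ex_countable_basis by blast
  have borel: "borel = sigma UNIV \<B>" using B by (rule borel_eq_countable_basis)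
  define gen where "gen f = (\<lambda>b. f -` b \<inter> space M) ` \<B>" for f :: "'a \<Rightarrow> real"
  define C where "C = (\<Union>q\<in>\<rat> \<inter> {0..s}. gen (A q)) \<union> gen \<Theta>"
  \<comment> \<open>The empty family \<open>F\<close> contributes \<open>space M\<close>; cutting
    with \<open>space M\<close> gives the empty intersection its right meaning.\<close>
  define G where "G = (\<lambda>F. space M \<inter> \<Inter>F) ` {F. finite F \<and> F \<subseteq> C}"
  have "countable C" unfolding C_def gen_def using B countable_rat
    by (intro countable_Un countable_UN countable_image) (auto intro: countable_subset)
  then have 1: "countable G" unfolding G_def by (intro countable_image countable_Collect_finite_subset)
  have 2: "Int_stable G"
  proof (rule Int_stableI)
    fix a b assume "a \<in> G" "b \<in> G"
    then obtain F F' where "finite F" "F \<subseteq> C" "finite F'" "F' \<subseteq> C" "a = space M \<inter> \<Inter>F" "b = space M \<inter> \<Inter>F'"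
      unfolding G_def by blast
    then show "a \<inter> b \<in> G" unfolding G_def by (intro image_eqI[of _ _ "F \<union> F'"]) auto
  qed
  have 3: "space M \<in> G" unfolding G_def by (intro image_eqI[of _ _ "{}"]) auto
  have Bborel: "b \<in> sets borel" if "b \<in> \<B>" for b
    using B that by (intro borel_open topological_basis_open)
  have gen_sub: "gen f \<subseteq> sets (filt s)" if "f \<in> borel_measurable (filt s)" for f
    unfolding gen_def using measurable_sets[OF that Bborel] by auto
  have Csub: "C \<subseteq> sets (filt s)"
    unfolding C_def
    by (intro Un_least UN_least gen_sub A_adapted measurable_enlarged_parameter) auto
  have 4: "G \<subseteq> sets (filt s)"
  proof
    fix a assume "a \<in> G"
    then obtain F where F: "finite F" "F \<subseteq> C" "a = space M \<inter> \<Inter>F" unfolding G_def by blast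
    show "a \<in> sets (filt s)"
    proof (cases "F = {}")
      case True then show ?thesis using F sets.top[of "filt s"] by simp
    next
      case False
      then have "(\<Inter>x\<in>F. x) \<in> sets (filt s)" using F Csub by (intro sets.finite_INT) auto
      then show ?thesis using F sets.Int[OF sets.top[of "filt s"]] by simp
    qed
  qed
  define H where "H = sigma (space M) G"
  have "G \<subseteq> Pow (space M)" unfolding G_def by auto
  then have H: "space H = space M" "sets H = sigma_sets (space M) G" by (auto simp: H_def)
  have CH: "c \<in> sets H" if "c \<in> C" for c
  proof -
    have "c \<subseteq> space M" using that unfolding C_def gen_def by auto
    then have "c = space M \<inter> \<Inter>{c}" by auto
    then have "c \<in> G" unfolding G_def using that by (intro image_eqI[of _ _ "{c}"]) auto
    then show ?thesis unfolding H by auto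
  qed
  have genH: "f \<in> borel_measurable H" if "gen f \<subseteq> C" for f
    unfolding borel
  proof (rule measurable_measure_of)
    show "f -` b \<inter> space H \<in> sets H" if "b \<in> \<B>" for b
      using that \<open>gen f \<subseteq> C\<close> by (intro CH) (auto simp: gen_def H)
  qed auto
  have rat: "A q \<in> borel_measurable H" if "q \<in> \<rat>" "0 \<le> q" "q \<le> s" for q
    using that by (intro genH) (auto simp: C_def)
  have "A u \<in> borel_measurable H" if u: "0 \<le> u" "u \<le> s" for u
  proof (cases "u = s")
    case True then show ?thesis using rat[of s] s by simp
  next
    case False
    \<comment> \<open>Rational times are needed strictly to the right of \<open>u\<close> but still
      within \<open>{0..s}\<close>. For \<open>u = s\<close> there is no room, which is why
      \<open>s\<close> itself is assumed rational.\<close>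
    have "\<exists>q\<in>\<rat>. u < q \<and> q < min s (u + 1 / Suc n)" for n
      using False u by (intro Rats_dense_in_real) auto
    then obtain q where q: "\<And>n. q n \<in> \<rat>" "\<And>n. u < q n" "\<And>n. q n < min s (u + 1 / Suc n)" by metis
    have "q \<longlonglongrightarrow> u"
    proof (rule tendsto_sandwich[OF _ _ tendsto_const])
      show "(\<lambda>n. u + 1 / real (Suc n)) \<longlonglongrightarrow> u"
        using tendsto_add[OF tendsto_const LIMSEQ_inverse_real_of_nat, of u] by (simp add: field_simps)
    qed (use q(2,3) in \<open>auto intro!: always_eventually less_imp_le\<close>)
    then have "(\<lambda>n. A (q n) \<omega>) \<longlonglongrightarrow> A u \<omega>" if "\<omega> \<in> space H" for \<omega>
      using that u H \<open>q \<longlonglongrightarrow> u\<close> less_imp_le[OF q(2)] by (intro A_right) auto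
    moreover have "A (q n) \<in> borel_measurable H" for n
      using q(1)[of n] q(2)[of n] q(3)[of n] u by (intro rat) auto
    ultimately show ?thesis by (rule borel_measurable_LIMSEQ_real)
  qed
  moreover have "\<Theta> \<in> borel_measurable H" by (intro genH) (auto simp: C_def)
  ultimately have 5: "sets (filt s) \<subseteq> sigma_sets (space M) G"
    unfolding H(2)[symmetric] using H by (intro enlarged_filtration_least) auto
  show ?thesis by (rule that[OF 1 2 3 4 5])
qed

text \<open>Compensation on the fibres integrates to compensation under \<open>M\<close>. Conversely
  each choice of two times and an event brings its own null set of parameters, so only countably
  many choices may be made before a parameter is fixed; the extension to all choices takes place
  under that one kernel.\<close>

lemma compensated_disintegration:
  assumes c: "0 \<le> c"
  shows "compensated_by M filt A \<Theta> c \<longleftrightarrow>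
    (AE \<theta> in law. 0 < \<theta> \<longrightarrow> compensated_by (P \<theta>) filt A (\<lambda>_. \<theta>) c)"
proof -
  have sets_M: "E \<in> sets M" if "E \<in> sets (filt s)" for E s
    using that subalgebra_filt[of s] by (auto simp: subalgebra_def)
  have meas_A: "(\<lambda>\<omega>. ennreal (A t \<omega>) * indicator E \<omega>) \<in> borel_measurable M"
    if "0 \<le> t" "E \<in> sets M" for t E
    using A_meas[OF that(1)] that(2) by measurable
  have meas_\<Theta>: "(\<lambda>\<omega>. ennreal (\<Theta> \<omega>) * indicator E \<omega>) \<in> borel_measurable M" if "E \<in> sets M" for E
    using that by measurable
  have \<Theta>_kernel: "AE \<theta> in law. \<forall>E. (\<integral>\<^sup>+\<omega>\<in>E. \<Theta> \<omega> \<partial>kernel \<theta>) = (\<integral>\<^sup>+\<omega>\<in>E. \<theta> \<partial>kernel \<theta>)"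
    using AE_kernel_parameter
  proof eventually_elim
    fix \<theta> assume "AE \<omega> in kernel \<theta>. \<Theta> \<omega> = \<theta>"
    then show "\<forall>E. (\<integral>\<^sup>+\<omega>\<in>E. \<Theta> \<omega> \<partial>kernel \<theta>) = (\<integral>\<^sup>+\<omega>\<in>E. \<theta> \<partial>kernel \<theta>)"
      by (intro allI nn_integral_cong_AE) auto
  qed
  show ?thesis
  proof
    assume AE: "AE \<theta> in law. 0 < \<theta> \<longrightarrow> compensated_by (P \<theta>) filt A (\<lambda>_. \<theta>) c"
    show "compensated_by M filt A \<Theta> c"
      unfolding compensated_by_def
    proof (intro allI impI ballI)
      fix s t E assume st: "0 \<le> s \<and> s \<le> t" and E: "E \<in> sets (filt s)"
      note EM = sets_M[OF E]
      have "(\<integral>\<^sup>+\<omega>\<in>E. A t \<omega> \<partial>M) = (\<integral>\<^sup>+\<theta>. (\<integral>\<^sup>+\<omega>\<in>E. A t \<omega> \<partial>kernel \<theta>) \<partial>law)"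
        using st EM by (intro nn_integral_kernel meas_A) auto
      also have "\<dots> = (\<integral>\<^sup>+\<theta>. (\<integral>\<^sup>+\<omega>\<in>E. A s \<omega> \<partial>kernel \<theta>) +
          ennreal ((t - s) * c) * (\<integral>\<^sup>+\<omega>\<in>E. \<Theta> \<omega> \<partial>kernel \<theta>) \<partial>law)"
      proof (rule nn_integral_cong_AE)
        show "AE \<theta> in law. (\<integral>\<^sup>+\<omega>\<in>E. A t \<omega> \<partial>kernel \<theta>) = (\<integral>\<^sup>+\<omega>\<in>E. A s \<omega> \<partial>kernel \<theta>) +
            ennreal ((t - s) * c) * (\<integral>\<^sup>+\<omega>\<in>E. \<Theta> \<omega> \<partial>kernel \<theta>)"
          using AE AE_law_pos \<Theta>_kernel
        proof eventually_elim
          fix \<theta> :: real assume *: "0 < \<theta> \<longrightarrow> compensated_by (P \<theta>) filt A (\<lambda>_. \<theta>) c" "0 < \<theta>"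
            and eq: "\<forall>E. (\<integral>\<^sup>+\<omega>\<in>E. \<Theta> \<omega> \<partial>kernel \<theta>) = (\<integral>\<^sup>+\<omega>\<in>E. \<theta> \<partial>kernel \<theta>)"
          have "compensated_by (kernel \<theta>) filt A (\<lambda>_. \<theta>) c" using * kernel_pos by simp
          then show "(\<integral>\<^sup>+\<omega>\<in>E. A t \<omega> \<partial>kernel \<theta>) = (\<integral>\<^sup>+\<omega>\<in>E. A s \<omega> \<partial>kernel \<theta>) +
            ennreal ((t - s) * c) * (\<integral>\<^sup>+\<omega>\<in>E. \<Theta> \<omega> \<partial>kernel \<theta>)"
            using st E unfolding compensated_by_def eq[rule_format] by blast
        qed
      qed
      also have "\<dots> = (\<integral>\<^sup>+\<theta>. (\<integral>\<^sup>+\<omega>\<in>E. A s \<omega> \<partial>kernel \<theta>) \<partial>law) +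
          ennreal ((t - s) * c) * (\<integral>\<^sup>+\<theta>. (\<integral>\<^sup>+\<omega>\<in>E. \<Theta> \<omega> \<partial>kernel \<theta>) \<partial>law)"
        using measurable_nn_integral_kernel[OF meas_A, of s E] measurable_nn_integral_kernel[OF meas_\<Theta>, of E] st EM
        by (subst nn_integral_add) (auto simp: nn_integral_cmult)
      also have "\<dots> = (\<integral>\<^sup>+\<omega>\<in>E. A s \<omega> \<partial>M) + ennreal ((t - s) * c) * (\<integral>\<^sup>+\<omega>\<in>E. \<Theta> \<omega> \<partial>M)"
        using st EM nn_integral_kernel[OF meas_A, of s E] nn_integral_kernel[OF meas_\<Theta>, of E] by simp
      finally show "(\<integral>\<^sup>+\<omega>\<in>E. A t \<omega> \<partial>M) =
        (\<integral>\<^sup>+\<omega>\<in>E. A s \<omega> \<partial>M) + ennreal ((t - s) * c) * (\<integral>\<^sup>+\<omega>\<in>E. \<Theta> \<omega> \<partial>M)" .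
    qed
  next
    assume comp: "compensated_by M filt A \<Theta> c"
    \<comment> \<open>The right-hand side is packed into a single density, as the uniqueness lemmas
      compare two densities.\<close>
    define g where "g s t \<omega> = ennreal (A s \<omega>) + ennreal ((t - s) * c) * ennreal (\<Theta> \<omega>)" for s t \<omega>
    have g_meas [measurable]: "g s t \<in> borel_measurable M" if "0 \<le> s" for s t
      unfolding g_def using A_meas[OF that] by measurable
    have g_int: "(\<integral>\<^sup>+\<omega>\<in>E. g s t \<omega> \<partial>R) =
        (\<integral>\<^sup>+\<omega>\<in>E. A s \<omega> \<partial>R) + ennreal ((t - s) * c) * (\<integral>\<^sup>+\<omega>\<in>E. \<Theta> \<omega> \<partial>R)"
      if "0 \<le> s" "E \<in> sets M" "sets R = sets M" for s t E R
    proof -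
      have "(\<integral>\<^sup>+\<omega>\<in>E. g s t \<omega> \<partial>R) = (\<integral>\<^sup>+\<omega>. ennreal (A s \<omega>) * indicator E \<omega> +
          ennreal ((t - s) * c) * (ennreal (\<Theta> \<omega>) * indicator E \<omega>) \<partial>R)"
        by (intro nn_integral_cong) (auto simp: g_def indicator_def)
      also have "\<dots> = (\<integral>\<^sup>+\<omega>\<in>E. A s \<omega> \<partial>R) + ennreal ((t - s) * c) * (\<integral>\<^sup>+\<omega>\<in>E. \<Theta> \<omega> \<partial>R)"
        using meas_A[OF that(1,2)] meas_\<Theta>[OF that(2)]
        unfolding measurable_cong_sets[OF that(3) refl, symmetric]
        by (subst nn_integral_add) (auto simp: nn_integral_cmult)
      finally show ?thesis .
    qed
    \<comment> \<open>One generator per time is chosen before any parameter is fixed, so that the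
      exceptional set can be common.\<close>
    define G where "G s = (SOME G. countable G \<and> Int_stable G \<and> space M \<in> G \<and> G \<subseteq> sets (filt s) \<and>
      sets (filt s) \<subseteq> sigma_sets (space M) G)" for s
    have G: "countable (G s) \<and> Int_stable (G s) \<and> space M \<in> G s \<and> G s \<subseteq> sets (filt s) \<and>
      sets (filt s) \<subseteq> sigma_sets (space M) (G s)" if "s \<in> \<rat>" "0 \<le> s" for s
      unfolding G_def by (rule someI_ex) (rule filt_countable_generator[OF that], blast)
    have AE_eq: "AE \<theta> in law. (\<integral>\<^sup>+\<omega>\<in>E. A t \<omega> \<partial>kernel \<theta>) = (\<integral>\<^sup>+\<omega>\<in>E. g s t \<omega> \<partial>kernel \<theta>)"
      if st: "0 \<le> s" "s \<le> t" and E: "E \<in> sets (filt s)" for s t E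
    proof (rule AE_kernel_eqI)
      note EM = sets_M[OF E]
      show "(\<lambda>\<omega>. ennreal (A t \<omega>) * indicator E \<omega>) \<in> borel_measurable M" using st EM by (intro meas_A) auto
      show "(\<lambda>\<omega>. g s t \<omega> * indicator E \<omega>) \<in> borel_measurable M" using st EM by measurable
      fix B :: "real set" assume B: "B \<in> sets borel"
      \<comment> \<open>Events of \<Theta> belong to the past at every time, so the identity may
        also be tested on \<open>E'\<close>. This is what makes the filtration enlarged by \<Theta>
        the right one for disintegration.\<close>
      define E' where "E' = E \<inter> (\<Theta> -` B \<inter> space M)"
      have E': "E' \<in> sets (filt s)"
        unfolding E'_def using measurable_sets[OF measurable_enlarged_parameter B]
        by (intro sets.Int[OF E]) simp
      have ind: "(\<integral>\<^sup>+\<omega>. f \<omega> * indicator E \<omega> * indicator B (\<Theta> \<omega>) \<partial>M) = (\<integral>\<^sup>+\<omega>\<in>E'. f \<omega> \<partial>M)"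
        for f :: "'a \<Rightarrow> ennreal"
        by (intro nn_integral_cong) (auto simp: E'_def indicator_def)
      have "(\<integral>\<^sup>+\<omega>\<in>E'. A t \<omega> \<partial>M) = (\<integral>\<^sup>+\<omega>\<in>E'. g s t \<omega> \<partial>M)"
        using comp st E' g_int[OF st(1) sets_M[OF E'] refl] unfolding compensated_by_def by simp
      then show "(\<integral>\<^sup>+\<omega>. ennreal (A t \<omega>) * indicator E \<omega> * indicator B (\<Theta> \<omega>) \<partial>M) =
          (\<integral>\<^sup>+\<omega>. g s t \<omega> * indicator E \<omega> * indicator B (\<Theta> \<omega>) \<partial>M)"
        by (simp add: ind)
    qed
    have AE_all: "AE \<theta> in law. \<forall>s\<in>\<rat> \<inter> {0..}. \<forall>t\<in>\<rat> \<inter> {s..}. \<forall>E\<in>G s.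
        (\<integral>\<^sup>+\<omega>\<in>E. A t \<omega> \<partial>kernel \<theta>) = (\<integral>\<^sup>+\<omega>\<in>E. g s t \<omega> \<partial>kernel \<theta>)"
    proof (intro AE_ball_countable[THEN iffD2] ballI)
      show "countable (\<rat> \<inter> {0..} :: real set)" "countable (\<rat> \<inter> {s..} :: real set)" for s :: real
        using countable_rat by auto
      show "countable (G s)" if "s \<in> \<rat> \<inter> {0..}" for s using G that by auto
      show "AE \<theta> in law. (\<integral>\<^sup>+\<omega>\<in>E. A t \<omega> \<partial>kernel \<theta>) = (\<integral>\<^sup>+\<omega>\<in>E. g s t \<omega> \<partial>kernel \<theta>)"
        if "s \<in> \<rat> \<inter> {0..}" "t \<in> \<rat> \<inter> {s..}" "E \<in> G s" for s t E
        using G[of s] that by (intro AE_eq) auto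
    qed
    have fin_M: "(\<integral>\<^sup>+\<omega>. A t \<omega> \<partial>M) < \<infinity>" if "0 \<le> t" for t
    proof -
      have "(\<integral>\<^sup>+\<omega>. A t \<omega> \<partial>M) = (\<integral>\<^sup>+\<omega>\<in>space M. A t \<omega> \<partial>M)" by (intro nn_integral_cong) simp
      also have "\<dots> = (\<integral>\<^sup>+\<omega>\<in>space M. A 0 \<omega> \<partial>M) + ennreal ((t - 0) * c) * (\<integral>\<^sup>+\<omega>\<in>space M. \<Theta> \<omega> \<partial>M)"
        using comp[unfolded compensated_by_def, rule_format, of 0 t "space M"] that sets.top[of "filt 0"] by simp
      also have "(\<integral>\<^sup>+\<omega>\<in>space M. A 0 \<omega> \<partial>M) = (\<integral>\<^sup>+\<omega>. 0 \<partial>M)"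
        by (intro nn_integral_cong) (simp add: A_zero)
      also have "(\<integral>\<^sup>+\<omega>\<in>space M. \<Theta> \<omega> \<partial>M) = (\<integral>\<^sup>+\<omega>. \<Theta> \<omega> \<partial>M)" by (intro nn_integral_cong) simp
      finally have "(\<integral>\<^sup>+\<omega>. A t \<omega> \<partial>M) = ennreal (t * c) * (\<integral>\<^sup>+\<omega>. \<Theta> \<omega> \<partial>M)" by simp
      also have "(\<integral>\<^sup>+\<omega>. \<Theta> \<omega> \<partial>M) < \<infinity>"
        using \<Theta>_int AE_\<Theta>_pos by (subst nn_integral_eq_integral) (auto elim: eventually_mono)
      then have "ennreal (t * c) * (\<integral>\<^sup>+\<omega>. \<Theta> \<omega> \<partial>M) < \<infinity>" by (simp add: ennreal_mult_less_top)
      finally show ?thesis .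
    qed
    \<comment> \<open>Finite means at rational times serve twice on a fibre: for uniqueness of
      measures and for domination in the limit.\<close>
    have AE_fin: "AE \<theta> in law. \<forall>t\<in>\<rat> \<inter> {0..}. (\<integral>\<^sup>+\<omega>. A t \<omega> \<partial>kernel \<theta>) \<noteq> \<infinity>"
    proof (intro AE_ball_countable[THEN iffD2] ballI)
      fix t :: real assume t: "t \<in> \<rat> \<inter> {0..}"
      then have m: "(\<lambda>\<omega>. ennreal (A t \<omega>)) \<in> borel_measurable M" by (intro measurable_compose[OF A_meas measurable_ennreal]) auto
      show "AE \<theta> in law. (\<integral>\<^sup>+\<omega>. A t \<omega> \<partial>kernel \<theta>) \<noteq> \<infinity>"
        using fin_M[of t] t m by (intro nn_integral_PInf_AE) (auto simp: nn_integral_kernel[symmetric])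
    qed (use countable_rat in auto)
    show "AE \<theta> in law. 0 < \<theta> \<longrightarrow> compensated_by (P \<theta>) filt A (\<lambda>_. \<theta>) c"
      using AE_all AE_fin \<Theta>_kernel
    proof (eventually_elim, intro impI)
      fix \<theta> :: real
      assume eq: "\<forall>s\<in>\<rat> \<inter> {0..}. \<forall>t\<in>\<rat> \<inter> {s..}. \<forall>E\<in>G s.
          (\<integral>\<^sup>+\<omega>\<in>E. A t \<omega> \<partial>kernel \<theta>) = (\<integral>\<^sup>+\<omega>\<in>E. g s t \<omega> \<partial>kernel \<theta>)"
        and fin: "\<forall>t\<in>\<rat> \<inter> {0..}. (\<integral>\<^sup>+\<omega>. A t \<omega> \<partial>kernel \<theta>) \<noteq> \<infinity>"
        and \<Theta>_eq: "\<forall>E. (\<integral>\<^sup>+\<omega>\<in>E. \<Theta> \<omega> \<partial>kernel \<theta>) = (\<integral>\<^sup>+\<omega>\<in>E. \<theta> \<partial>kernel \<theta>)"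
        and pos: "0 < \<theta>"
      interpret K: prob_space "kernel \<theta>" by (rule kernel_prob)
      have A_K: "A t \<in> borel_measurable (kernel \<theta>)" if "0 \<le> t" for t
        using A_meas[OF that] measurable_cong_sets[OF sets_kernel refl] by blast
      have const: "ennreal ((t - s) * c) * (\<integral>\<^sup>+\<omega>\<in>E. \<theta> \<partial>kernel \<theta>) =
          ennreal ((t - s) * c * \<theta> * measure (kernel \<theta>) E)"
        if "E \<in> sets M" "s \<le> t" for s t E
        using that pos c by (simp add: nn_integral_cmult_indicator sets_kernel K.emeasure_eq_measure
            ennreal_mult[symmetric] mult_ac)
      have rational: "(\<integral>\<^sup>+\<omega>\<in>E. A t \<omega> \<partial>kernel \<theta>) = (\<integral>\<^sup>+\<omega>\<in>E. A s \<omega> \<partial>kernel \<theta>) +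
          ennreal ((t - s) * c * \<theta> * measure (kernel \<theta>) E)"
        if s: "s \<in> \<rat>" "t \<in> \<rat>" "0 \<le> s" "s \<le> t" and E: "E \<in> sets (filt s)" for s t E
      proof -
        have "(\<integral>\<^sup>+\<omega>\<in>E. A t \<omega> \<partial>kernel \<theta>) = (\<integral>\<^sup>+\<omega>\<in>E. g s t \<omega> \<partial>kernel \<theta>)"
        proof (rule nn_integral_eq_on_sigma[where G="G s"])
          show "(\<lambda>\<omega>. ennreal (A t \<omega>)) \<in> borel_measurable (kernel \<theta>)"
            using A_K[of t] s by (intro measurable_compose[OF _ measurable_ennreal]) auto
          show "g s t \<in> borel_measurable (kernel \<theta>)"
            using g_meas[of s t] s measurable_cong_sets[OF sets_kernel refl] by blast
          show "(\<integral>\<^sup>+\<omega>. A t \<omega> \<partial>kernel \<theta>) < \<infinity>" using fin s by (auto simp: less_top)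
          show "G s \<subseteq> sets (kernel \<theta>)" using G[OF s(1,3)] sets_M sets_kernel by auto
        qed (use G[OF s(1,3)] E eq s in auto)
        then show ?thesis using g_int[OF s(3) sets_M[OF E] sets_kernel] \<Theta>_eq const[OF sets_M[OF E] s(4)] by simp
      qed
      have "(\<integral>\<^sup>+\<omega>\<in>E. A t \<omega> \<partial>kernel \<theta>) = (\<integral>\<^sup>+\<omega>\<in>E. A s \<omega> \<partial>kernel \<theta>) +
          ennreal ((t - s) * c * \<theta> * measure (kernel \<theta>) E)"
        if st: "0 \<le> s" "s \<le> t" and E: "E \<in> sets (filt s)" for s t E
      proof -
        \<comment> \<open>The least multiple of \<open>1 / Suc n\<close> strictly above
          \<open>x\<close>: rational, monotone in \<open>x\<close>, and at distance at most
          \<open>1 / Suc n\<close>. Monotonicity keeps the two approximating times in order.\<close>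
        define r where "r x n = (of_int \<lfloor>real (Suc n) * x\<rfloor> + 1) / real (Suc n)" for x :: real and n
        have r_bounds: "x < r x n" "r x n \<le> x + 1 / real (Suc n)" for x n
        proof -
          define k where "k = real (Suc n)"
          have k: "0 < k" by (simp add: k_def)
          have "k * x < of_int \<lfloor>k * x\<rfloor> + 1" "of_int \<lfloor>k * x\<rfloor> \<le> k * x" by linarith+
          then show "x < r x n" "r x n \<le> x + 1 / real (Suc n)"
            unfolding r_def k_def[symmetric] using k by (auto simp: field_simps)
        qed
        have r_rat: "r x n \<in> \<rat>" for x n unfolding r_def by (intro Rats_divide Rats_add) auto
        have r_mono: "r s n \<le> r t n" for n unfolding r_def using st
          by (intro divide_right_mono add_right_mono) (auto intro!: floor_mono mult_left_mono)
        have r_lim: "r x \<longlonglongrightarrow> x" for x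
        proof (rule tendsto_sandwich[OF _ _ tendsto_const])
          show "(\<lambda>n. x + 1 / real (Suc n)) \<longlonglongrightarrow> x"
            using tendsto_add[OF tendsto_const LIMSEQ_inverse_real_of_nat, of x] by (simp add: field_simps)
        qed (use r_bounds in \<open>auto intro!: always_eventually less_imp_le\<close>)
        have r_le: "r x n \<le> x + 1" for x n
          using r_bounds(2)[of x n] by (rule order_trans) simp
        have EK: "E \<in> sets (kernel \<theta>)" using sets_M[OF E] sets_kernel by simp
        have lim: "(\<lambda>n. \<integral>\<^sup>+\<omega>\<in>E. A (r x n) \<omega> \<partial>kernel \<theta>) \<longlonglongrightarrow> (\<integral>\<^sup>+\<omega>\<in>E. A x \<omega> \<partial>kernel \<theta>)"
          if x: "0 \<le> x" for x
        proof -
          have rx: "0 \<le> r x n" for n using r_bounds(1)[of x n] x by linarith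
          \<comment> \<open>The dominating time is rational because finiteness on this fibre is
            known only there.\<close>
          obtain w where w: "w \<in> \<rat>" "x + 1 < w" using Rats_dense_in_real[of "x+1" "x+2"] by auto
          show ?thesis
          proof (rule nn_integral_dominated_convergence[where w="\<lambda>\<omega>. ennreal (A w \<omega>)"])
            show "(\<lambda>\<omega>. ennreal (A (r x n) \<omega>) * indicator E \<omega>) \<in> borel_measurable (kernel \<theta>)" for n
              using A_K[OF rx] EK by measurable
            show "(\<lambda>\<omega>. ennreal (A x \<omega>) * indicator E \<omega>) \<in> borel_measurable (kernel \<theta>)"
              using A_K[OF x] EK by measurable
            show "(\<lambda>\<omega>. ennreal (A w \<omega>)) \<in> borel_measurable (kernel \<theta>)"
              using w x by (intro measurable_compose[OF A_K measurable_ennreal]) auto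
            show "AE \<omega> in kernel \<theta>. ennreal (A (r x n) \<omega>) * indicator E \<omega> \<le> ennreal (A w \<omega>)" for n
            proof (rule AE_I2)
              fix \<omega> assume "\<omega> \<in> space (kernel \<theta>)"
              then have "A (r x n) \<omega> \<le> A w \<omega>" using rx r_le[of x n] w by (intro A_mono) auto
              then show "ennreal (A (r x n) \<omega>) * indicator E \<omega> \<le> ennreal (A w \<omega>)"
                by (auto simp: indicator_def ennreal_leI)
            qed
            show "(\<integral>\<^sup>+\<omega>. A w \<omega> \<partial>kernel \<theta>) < \<infinity>" using fin w x by (auto simp: less_top)
            show "AE \<omega> in kernel \<theta>. (\<lambda>n. ennreal (A (r x n) \<omega>) * indicator E \<omega>) \<longlonglongrightarrow>
                ennreal (A x \<omega>) * indicator E \<omega>"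
            proof (rule AE_I2)
              fix \<omega> assume "\<omega> \<in> space (kernel \<theta>)"
              then have "(\<lambda>n. A (r x n) \<omega>) \<longlonglongrightarrow> A x \<omega>"
                using x r_lim r_bounds(1) by (intro A_right) (auto intro: less_imp_le)
              then show "(\<lambda>n. ennreal (A (r x n) \<omega>) * indicator E \<omega>) \<longlonglongrightarrow> ennreal (A x \<omega>) * indicator E \<omega>"
                by (auto simp: indicator_def intro!: tendsto_ennrealI)
            qed
          qed
        qed
        have "(\<lambda>n. (\<integral>\<^sup>+\<omega>\<in>E. A (r s n) \<omega> \<partial>kernel \<theta>) +
            ennreal ((r t n - r s n) * c * \<theta> * measure (kernel \<theta>) E)) \<longlonglongrightarrow>
            (\<integral>\<^sup>+\<omega>\<in>E. A s \<omega> \<partial>kernel \<theta>) + ennreal ((t - s) * c * \<theta> * measure (kernel \<theta>) E)"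
          using st by (intro tendsto_add lim tendsto_ennrealI tendsto_intros r_lim) auto
        moreover have "(\<integral>\<^sup>+\<omega>\<in>E. A (r t n) \<omega> \<partial>kernel \<theta>) = (\<integral>\<^sup>+\<omega>\<in>E. A (r s n) \<omega> \<partial>kernel \<theta>) +
            ennreal ((r t n - r s n) * c * \<theta> * measure (kernel \<theta>) E)" for n
        proof (rule rational[OF r_rat r_rat])
          show "0 \<le> r s n" using r_bounds(1)[of s n] st by linarith
          \<comment> \<open>Since \<open>r s n\<close> lies above \<open>s\<close>, an event of the
            past at \<open>s\<close> stays admissible at the approximating time; approximation from
            below would lose it.\<close>
          show "E \<in> sets (filt (r s n))"
            using E enlarged_filtration_mono[OF less_imp_le[OF r_bounds(1)]] by blast
        qed (rule r_mono)
        ultimately show ?thesis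
          using LIMSEQ_unique[OF lim[of t]] st by simp
      qed
      then have "compensated_by (kernel \<theta>) filt A (\<lambda>_. \<theta>) c"
        unfolding compensated_by_def using const sets_M by auto
      then show "compensated_by (P \<theta>) filt A (\<lambda>_. \<theta>) c" using kernel_pos pos by simp
    qed
  qed
qed

end

section \<open>Independence of the claim sizes\<close>

lemma (in prob_space) indep_set_mono:
  assumes "indep_set A B" "A' \<subseteq> A" "B' \<subseteq> B"
  shows "indep_set A' B'"
  unfolding indep_set_def
  by (rule indep_sets_mono_sets[OF assms(1)[unfolded indep_set_def]]) (use assms in \<open>auto split: bool.splits\<close>)

lemma (in prob_space) indep_set_events: "indep_set A B \<Longrightarrow> A \<subseteq> events \<and> B \<subseteq> events"
  unfolding indep_set_def indep_sets_def by (auto split: bool.splits)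

lemma (in prob_space) indep_set_commute: "indep_set A B \<Longrightarrow> indep_set B A"
  using indep_set_events[of A B] by (intro indep_setI) (auto simp: Int_commute mult.commute dest: indep_setD)

text \<open>The product rule is required only on the intersections \<open>a \<inter> b\<close>,
  which are stable and generate the join.\<close>

lemma (in prob_space) indep_set_join_sigma:
  assumes sub: "subalgebra M A" "subalgebra M B" "subalgebra M C"
    and eq: "\<And>a b c. a \<in> sets A \<Longrightarrow> b \<in> sets B \<Longrightarrow> c \<in> sets C \<Longrightarrow> prob (a \<inter> b \<inter> c) = prob (a \<inter> b) * prob c"
  shows "indep_set (sets (join_sigma A B)) (sets C)"
proof -
  have sp: "space B = space A" "space A = space M" "space C = space M" using sub by (auto simp: subalgebra_def)
  have "indep_set {a \<inter> b | a b. a \<in> sets A \<and> b \<in> sets B} (sets C)"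
    using sub eq by (intro indep_setI) (auto simp: subalgebra_def)
  then have "indep_set (sigma_sets (space M) {a \<inter> b | a b. a \<in> sets A \<and> b \<in> sets B}) (sigma_sets (space M) (sets C))"
    by (rule indep_set_sigma_sets[OF _ Int_stable_Int]) (auto simp: Int_stable_def)
  then show ?thesis
    using sets_join_sigma_Int[OF sp(1)] sets.sigma_sets_eq[of C] sp by simp
qed

text \<open>Independence says that the indicator of \<open>b\<close> and the constant
  \<open>emeasure M b\<close> have equal integrals over every event of \<open>Z\<close>; a
  \<open>Z\<close>-measurable weight preserves this equality.\<close>

lemma (in prob_space) nn_integral_indep_set:
  assumes sub: "subalgebra M Z" and indep: "indep_set (sets Z) D" and b: "b \<in> D"
    and f: "f \<in> borel_measurable Z"
  shows "(\<integral>\<^sup>+\<omega>\<in>b. f \<omega> \<partial>M) = emeasure M b * (\<integral>\<^sup>+\<omega>. f \<omega> \<partial>M)"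
proof -
  have bM [measurable]: "b \<in> sets M" using indep b unfolding indep_set_def indep_sets_def by (auto split: bool.splits)
  have [measurable]: "f \<in> borel_measurable M" using measurable_from_subalg[OF sub f] .
  have "(\<integral>\<^sup>+\<omega>. f \<omega> * indicator b \<omega> \<partial>M) = (\<integral>\<^sup>+\<omega>. f \<omega> * emeasure M b \<partial>M)"
  proof (rule nn_integral_test_function[OF sub _ _ _ f])
    fix E assume E: "E \<in> sets Z"
    then have [measurable]: "E \<in> sets M" using sub by (auto simp: subalgebra_def)
    have "(\<integral>\<^sup>+\<omega>\<in>E. indicator b \<omega> \<partial>M) = (\<integral>\<^sup>+\<omega>. indicator (E \<inter> b) \<omega> \<partial>M)"
      by (intro nn_integral_cong) (auto simp: indicator_def)
    also have "\<dots> = emeasure M (E \<inter> b)" by (rule nn_integral_indicator) measurable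
    also have "\<dots> = emeasure M b * emeasure M E"
      using indep_setD[OF indep E b] by (simp add: emeasure_eq_measure ennreal_mult mult.commute)
    also have "\<dots> = (\<integral>\<^sup>+\<omega>\<in>E. emeasure M b \<partial>M)" by (simp add: nn_integral_cmult_indicator)
    finally show "(\<integral>\<^sup>+\<omega>\<in>E. indicator b \<omega> \<partial>M) = (\<integral>\<^sup>+\<omega>\<in>E. emeasure M b \<partial>M)" .
  qed auto
  then show ?thesis by (simp add: nn_integral_multc mult.commute)
qed

lemma measurable_count_space_real:
  fixes g :: "'a \<Rightarrow> nat"
  assumes "(\<lambda>x. real (g x)) \<in> borel_measurable H"
  shows "g \<in> measurable H (count_space UNIV)"
proof -
  have "(\<lambda>x. nat \<lfloor>real (g x)\<rfloor>) \<in> measurable H (count_space UNIV)" using assms by measurable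
  then show ?thesis by simp
qed

lemma borel_measurable_nat_ge:
  fixes g :: "'a \<Rightarrow> nat"
  assumes "\<And>k. {x\<in>space H. k \<le> g x} \<in> sets H"
  shows "(\<lambda>x. real (g x)) \<in> borel_measurable H"
proof (rule borel_measurableI_ge)
  fix y :: real
  have "y \<le> real (g x) \<longleftrightarrow> nat \<lceil>y\<rceil> \<le> g x" for x by linarith
  then have "{x\<in>space H. y \<le> real (g x)} = {x\<in>space H. nat \<lceil>y\<rceil> \<le> g x}" by simp
  then show "{x\<in>space H. y \<le> real (g x)} \<in> sets H" using assms[of "nat \<lceil>y\<rceil>"] by (simp only:)
qed

text \<open>Capping the number of summands at \<open>m\<close> restricts the requirement to the
  first \<open>m\<close> claims, which are all that an early \<sigma>-algebra knows.\<close>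

lemma measurable_random_sum:
  fixes X :: "nat \<Rightarrow> 'a \<Rightarrow> real"
  assumes "g \<in> measurable H (count_space UNIV)" "\<And>k. 1 \<le> k \<Longrightarrow> k \<le> m \<Longrightarrow> X k \<in> borel_measurable H"
  shows "(\<lambda>x. \<Sum>k=1..min (g x) m. X k x) \<in> borel_measurable H"
proof -
  have "(\<lambda>x. \<Sum>k=1..min i m. X k x) \<in> borel_measurable H" for i
    by (rule borel_measurable_sum) (use assms(2) in auto)
  from measurable_compose_countable'[OF this assms(1)] show ?thesis by simp
qed

text \<open>The sets whose trace on \<open>D\<close> lies in \<open>H\<close> form a
  \<sigma>-algebra, and a function that agrees on \<open>D\<close> with an
  \<open>H\<close>-measurable one is measurable for it. It will be applied with \<open>D\<close> the
  event that at most \<open>k\<close> claims have occurred.\<close>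

lemma enlarged_filtration_trace:
  fixes Y :: "real \<Rightarrow> 'a \<Rightarrow> real"
  assumes sp: "space H = \<Omega>" and D: "D \<in> sets H"
    and Y: "\<And>s. 0 \<le> s \<Longrightarrow> s \<le> t \<Longrightarrow> \<exists>f\<in>borel_measurable H. \<forall>x\<in>D. Y s x = f x"
    and \<Theta>: "\<Theta> \<in> borel_measurable H"
    and E: "E \<in> sets (enlarged_filtration \<Omega> borel Y \<Theta> t)"
  shows "E \<inter> D \<in> sets H"
proof -
  define \<L> where "\<L> = {E. E \<subseteq> \<Omega> \<and> E \<inter> D \<in> sets H}"
  have "sigma_algebra \<Omega> \<L>"
    unfolding sigma_algebra_iff2
  proof (intro conjI ballI allI impI)
    fix s assume "s \<in> \<L>"
    then have "D - s \<inter> D \<in> sets H" using D by (auto simp: \<L>_def)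
    moreover have "(\<Omega> - s) \<inter> D = D - s \<inter> D" using sets.sets_into_space[OF D] sp by auto
    ultimately show "\<Omega> - s \<in> \<L>" by (auto simp: \<L>_def)
  next
    fix A :: "nat \<Rightarrow> 'a set" assume "range A \<subseteq> \<L>"
    then have "(\<Union>i. A i \<inter> D) \<in> sets H" by (intro sets.countable_UN) (auto simp: \<L>_def)
    moreover have "(\<Union>i. A i) \<inter> D = (\<Union>i. A i \<inter> D)" by auto
    moreover have "(\<Union>i. A i) \<subseteq> \<Omega>" using \<open>range A \<subseteq> \<L>\<close> unfolding \<L>_def by blast
    ultimately show "(\<Union>i. A i) \<in> \<L>" by (simp only: \<L>_def mem_Collect_eq simp_thms)
  qed (auto simp: \<L>_def)
  then interpret L: sigma_algebra \<Omega> \<L> .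
  define L where "L = sigma \<Omega> \<L>"
  have L: "space L = \<Omega>" "sets L = \<L>" by (simp_all add: L_def)
  have meas: "f \<in> borel_measurable L" if g: "g \<in> borel_measurable H" and fg: "\<And>x. x \<in> D \<Longrightarrow> f x = g x"
    for f g :: "'a \<Rightarrow> real"
  proof (rule measurableI)
    fix B :: "real set" assume "B \<in> sets borel"
    then have "(g -` B \<inter> space H) \<inter> D \<in> sets H" using g D by (intro sets.Int measurable_sets)
    moreover have "f -` B \<inter> \<Omega> \<inter> D = (g -` B \<inter> space H) \<inter> D" using fg sp by auto
    ultimately show "f -` B \<inter> space L \<in> sets L" unfolding L \<L>_def by simp
  qed simp
  have "sets (enlarged_filtration \<Omega> borel Y \<Theta> t) \<subseteq> sets L"
  proof (rule enlarged_filtration_least)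
    fix s assume "0 \<le> s" "s \<le> t"
    then obtain f where "f \<in> borel_measurable H" "\<forall>x\<in>D. Y s x = f x" using Y by blast
    then show "Y s \<in> borel_measurable L" by (intro meas[of f]) auto
  qed (use L meas[OF \<Theta>, of \<Theta>] in auto)
  then have "E \<in> \<L>" using E L(2) by blast
  then show ?thesis by (simp add: \<L>_def)
qed

section \<open>The risk model and the independence of the claims from \<open>N\<close> and
  \<Theta>\<close>

locale risk_model = prob_space M for M :: "'a measure" +
  fixes N :: "real \<Rightarrow> 'a \<Rightarrow> nat" and X :: "nat \<Rightarrow> 'a \<Rightarrow> real" and \<Theta> :: "'a \<Rightarrow> real"
  assumes risk: "risk_process M N X"
    and \<Theta>_meas [measurable]: "\<Theta> \<in> borel_measurable M"
    and \<Theta>_pos: "AE \<omega> in M. 0 < \<Theta> \<omega>"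
    and \<Theta>_int: "integrable M \<Theta>"
    and X1_int: "integrable M (X 1)"
    and cond_indep: "cond_indep_sets M (vimage_algebra (space M) \<Theta> borel)
          (case_bool (sets (generated_sigma (space M) borel (interarrival N) {1..}))
                     (sets (generated_sigma (space M) borel X {1..}))) UNIV"
    and \<Theta>_indep: "indep_set (sets (vimage_algebra (space M) \<Theta> borel))
          (sets (generated_sigma (space M) borel X {1..}))"
begin

abbreviation sigma_\<Theta> :: "'a measure" where
  "sigma_\<Theta> \<equiv> vimage_algebra (space M) \<Theta> borel"

abbreviation sigma_X :: "nat set \<Rightarrow> 'a measure" where
  "sigma_X I \<equiv> generated_sigma (space M) borel X I"

text \<open>\<open>N\<close> is read as a real-valued process so that everything is generated over
  \<open>borel\<close>, as in the general lemmas; \<open>sets_generated_sigma_real_of_nat\<close>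
  shows that nothing changes.\<close>

definition sigma_N :: "'a measure" where
  "sigma_N = join_sigma (generated_sigma (space M) borel (\<lambda>t \<omega>. real (N t \<omega>)) {0..}) sigma_\<Theta>"

abbreviation filt_N :: "real \<Rightarrow> 'a measure" where
  "filt_N \<equiv> enlarged_filtration (space M) borel (\<lambda>t \<omega>. real (N t \<omega>)) \<Theta>"

abbreviation filt_S :: "real \<Rightarrow> 'a measure" where
  "filt_S \<equiv> enlarged_filtration (space M) borel (aggregate N X) \<Theta>"

abbreviation mean_X :: real where "mean_X \<equiv> integral\<^sup>L M (X 1)"

lemma counting: "counting_process M N" using risk by (simp add: risk_process_def)

lemma N_meas: "0 \<le> t \<Longrightarrow> N t \<in> measurable M (count_space UNIV)"
  using counting by (simp add: counting_process_def)

lemma real_N_meas: "0 \<le> t \<Longrightarrow> (\<lambda>\<omega>. real (N t \<omega>)) \<in> borel_measurable M"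
  using measurable_compose[OF N_meas, of t real borel] by simp

lemma X_meas: "1 \<le> k \<Longrightarrow> X k \<in> borel_measurable M"
  and X_pos: "1 \<le> k \<Longrightarrow> \<omega> \<in> space M \<Longrightarrow> 0 < X k \<omega>"
  using risk by (auto simp: risk_process_def size_process_def)

lemma X_int: "1 \<le> k \<Longrightarrow> integrable M (X k)" and X_mean: "1 \<le> k \<Longrightarrow> integral\<^sup>L M (X k) = mean_X"
proof -
  assume k: "1 \<le> k"
  have eq: "distr M borel (X k) = distr M borel (X 1)" using risk k unfolding risk_process_def by blast
  have "integrable (distr M borel (X 1)) (\<lambda>x. x)" using X1_int X_meas[of 1] by (subst integrable_distr_eq) auto
  then show "integrable M (X k)" using X_meas[OF k] unfolding eq[symmetric] by (subst (asm) integrable_distr_eq) auto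
  have "integral\<^sup>L M (X j) = (\<integral>x. x \<partial>distr M borel (X j))" if "1 \<le> j" for j
    using X_meas[OF that] by (subst integral_distr) auto
  from this[OF k] this[of 1] show "integral\<^sup>L M (X k) = mean_X" using eq by simp
qed

text \<open>A positive variable of mean zero would vanish almost surely. Positivity allows division
  by the mean when compensation passes from the aggregate process to \<open>N\<close>.\<close>

lemma mean_X_pos: "0 < mean_X"
proof -
  have "0 \<le> mean_X" using X_pos[of 1] by (intro integral_nonneg_AE AE_I2) (auto intro: less_imp_le)
  moreover have "mean_X \<noteq> 0"
  proof
    assume "mean_X = 0"
    then have "AE \<omega> in M. X 1 \<omega> = 0"
      using X1_int X_pos[of 1] by (subst (asm) integral_nonneg_eq_0_iff_AE) (auto intro: less_imp_le)
    then have "AE \<omega> in M. False" using AE_space by eventually_elim (use X_pos[of 1] in force)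
    then show False by simp
  qed
  ultimately show ?thesis by simp
qed

lemma subalgebra_\<Theta>: "subalgebra M sigma_\<Theta>"
  using vimage_algebra_subset[OF \<Theta>_meas] by (simp add: subalgebra_def)

lemma subalgebra_X: "I \<subseteq> {1..} \<Longrightarrow> subalgebra M (sigma_X I)"
  unfolding subalgebra_def by (intro conjI generated_sigma_subset X_meas) auto

lemma subalgebra_N: "subalgebra M sigma_N"
  unfolding subalgebra_def sigma_N_def using real_N_meas
  by (intro conjI join_sigma_least generated_sigma_subset vimage_algebra_subset) (auto simp: space_join_sigma)

lemma space_sigma_N [simp]: "space sigma_N = space M"
  by (simp add: sigma_N_def space_join_sigma)

lemma N_meas_sigma_N: "0 \<le> t \<Longrightarrow> (\<lambda>\<omega>. real (N t \<omega>)) \<in> borel_measurable sigma_N"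
  unfolding sigma_N_def
  by (intro measurable_join_left measurable_generated_sigma[where Y="\<lambda>t \<omega>. real (N t \<omega>)"]) auto

lemma \<Theta>_meas_sigma_N: "\<Theta> \<in> borel_measurable sigma_N"
  unfolding sigma_N_def by (intro measurable_join_right measurable_vimage_algebra1) auto

lemma filt_N_subset: "sets (filt_N t) \<subseteq> sets sigma_N"
  by (rule enlarged_filtration_least) (use N_meas_sigma_N \<Theta>_meas_sigma_N in auto)

text \<open>\<open>N\<close> is a function of \<open>W\<close>, so the conditional independence of \<open>W\<close> and \<open>X\<close> given \<open>\<Theta>\<close> and the
  independence of \<open>\<Theta>\<close> and \<open>X\<close> combine to the independence of \<open>(N, \<Theta>)\<close> and \<open>X\<close>.\<close>

lemma indep_sigma_N_X: "indep_set (sets sigma_N) (sets (sigma_X {1..}))"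
proof -
  let ?W = "generated_sigma (space M) borel (interarrival N) {1..}" and ?X = "sigma_X {1..}"
  interpret Z: finite_measure_subalgebra M sigma_\<Theta>
    by unfold_locales (rule subalgebra_\<Theta>)
  have W_events: "sets ?W \<subseteq> events" and X_events: "sets ?X \<subseteq> events"
    using cond_indep unfolding cond_indep_sets_def by (auto split: bool.splits)
  have ind_int: "integrable M (indicator A :: 'a \<Rightarrow> real)" if "A \<in> events" for A
    using that by (simp add: less_top[symmetric])
  have set_ind: "set_lebesgue_integral M b (indicator a) = prob (a \<inter> b)"
    if "a \<in> events" "b \<in> events" for a b
  proof -
    have "set_lebesgue_integral M b (indicator a) = integral\<^sup>L M (indicator (a \<inter> b))"
      unfolding set_lebesgue_integral_def by (intro Bochner_Integration.integral_cong) (auto simp: indicator_def)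
    also have "\<dots> = prob (a \<inter> b \<inter> space M)" by (rule Bochner_Integration.integral_indicator)
    also have "a \<inter> b \<inter> space M = a \<inter> b" using sets.sets_into_space[OF that(1)] by auto
    finally show ?thesis .
  qed
  have "indep_set (sets (join_sigma ?W sigma_\<Theta>)) (sets ?X)"
  proof (rule indep_set_join_sigma)
    show "subalgebra M ?W" "subalgebra M sigma_\<Theta>" "subalgebra M ?X"
      using W_events subalgebra_\<Theta> X_events by (auto simp: subalgebra_def)
    fix a b c assume a: "a \<in> sets ?W" and b: "b \<in> sets sigma_\<Theta>" and c: "c \<in> sets ?X"
    have ev [measurable]: "a \<in> events" "b \<in> events" "c \<in> events"
      using a b c W_events X_events subalgebra_\<Theta> by (auto simp: subalgebra_def)
    \<comment> \<open>By (a2), conditioning on \<Theta> does not change the probability of a claim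
      event. Together with (a1), the conditional probability of \<open>a \<inter> c\<close> becomes
      a constant multiple of that of \<open>a\<close>.\<close>
    have c_const: "AE \<omega> in M. real_cond_exp M sigma_\<Theta> (indicator c) \<omega> = prob c"
    proof (rule Z.real_cond_exp_charact)
      fix b assume b: "b \<in> sets sigma_\<Theta>"
      then have bM: "b \<in> events" using subalgebra_\<Theta> by (auto simp: subalgebra_def)
      have "set_lebesgue_integral M b (indicator c) = prob (b \<inter> c)" using set_ind[OF ev(3) bM] by (simp add: Int_commute)
      also have "\<dots> = prob b * prob c" by (rule indep_setD[OF \<Theta>_indep b c])
      also have "\<dots> = set_lebesgue_integral M b (\<lambda>_. prob c)"
        using bM unfolding set_lebesgue_integral_def by simp
      finally show "set_lebesgue_integral M b (indicator c) = set_lebesgue_integral M b (\<lambda>_. prob c)" .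
    qed (use ind_int ev in auto)
    have "\<forall>A\<in>Pi UNIV (case_bool (sets ?W) (sets ?X)). AE \<omega> in M.
        cond_prob_given M sigma_\<Theta> (\<Inter>j\<in>UNIV. A j) \<omega> = (\<Prod>j\<in>UNIV. cond_prob_given M sigma_\<Theta> (A j) \<omega>)"
      using cond_indep unfolding cond_indep_sets_def by auto
    moreover have "case_bool a c \<in> Pi UNIV (case_bool (sets ?W) (sets ?X))"
      using a c by (auto split: bool.splits)
    ultimately have "AE \<omega> in M. cond_prob_given M sigma_\<Theta> (\<Inter>j\<in>UNIV. case_bool a c j) \<omega> =
        (\<Prod>j\<in>UNIV. cond_prob_given M sigma_\<Theta> (case_bool a c j) \<omega>)" by blast
    then have "AE \<omega> in M. real_cond_exp M sigma_\<Theta> (indicator (a \<inter> c)) \<omega> =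
        real_cond_exp M sigma_\<Theta> (indicator a) \<omega> * real_cond_exp M sigma_\<Theta> (indicator c) \<omega>"
      by (simp add: UNIV_bool cond_prob_given_def Int_commute mult.commute)
    then have prod: "AE \<omega> in M. real_cond_exp M sigma_\<Theta> (indicator (a \<inter> c)) \<omega> =
        prob c * real_cond_exp M sigma_\<Theta> (indicator a) \<omega>"
      using c_const by eventually_elim simp
    have "prob (a \<inter> b \<inter> c) = set_lebesgue_integral M b (indicator (a \<inter> c))"
      using set_ind[of "a \<inter> c" b] ev by (simp add: Int_ac)
    also have "\<dots> = set_lebesgue_integral M b (real_cond_exp M sigma_\<Theta> (indicator (a \<inter> c)))"
      by (rule Z.real_cond_exp_intA[OF ind_int b]) measurable
    also have "\<dots> = (\<integral>\<omega>. prob c * (indicator b \<omega> * real_cond_exp M sigma_\<Theta> (indicator a) \<omega>) \<partial>M)"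
      unfolding set_lebesgue_integral_def
    proof (rule integral_cong_AE)
      show "AE \<omega> in M. indicator b \<omega> *\<^sub>R real_cond_exp M sigma_\<Theta> (indicator (a \<inter> c)) \<omega> =
          prob c * (indicator b \<omega> * real_cond_exp M sigma_\<Theta> (indicator a) \<omega>)"
        using prod by eventually_elim auto
    qed measurable
    also have "\<dots> = prob c * set_lebesgue_integral M b (real_cond_exp M sigma_\<Theta> (indicator a))"
      by (simp add: set_lebesgue_integral_def)
    also have "set_lebesgue_integral M b (real_cond_exp M sigma_\<Theta> (indicator a)) = set_lebesgue_integral M b (indicator a)"
      by (rule Z.real_cond_exp_intA[OF ind_int[OF ev(1)] b, symmetric])
    finally show "prob (a \<inter> b \<inter> c) = prob (a \<inter> b) * prob c"
      using set_ind[OF ev(1,2)] by simp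
  qed
  moreover have "sets sigma_N \<subseteq> sets (join_sigma ?W sigma_\<Theta>)"
    unfolding sigma_N_def
  proof (intro join_sigma_least generated_sigma_subset)
    fix t :: real assume t: "t \<in> {0..}"
    show "(\<lambda>\<omega>. real (N t \<omega>)) \<in> borel_measurable (join_sigma ?W sigma_\<Theta>)"
    proof (rule measurable_join_left)
      show "(\<lambda>\<omega>. real (N t \<omega>)) \<in> borel_measurable ?W"
      proof (rule borel_measurable_nat_ge)
        fix k
        have [measurable]: "(\<lambda>\<omega>. \<Sum>j=1..k. interarrival N j \<omega>) \<in> borel_measurable ?W"
          by (intro borel_measurable_sum measurable_generated_sigma) auto
        have "{\<omega>\<in>space ?W. k \<le> N t \<omega>} = {\<omega>\<in>space ?W. (\<Sum>j=1..k. interarrival N j \<omega>) \<le> t}"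
          using t counting_arrival_le_iff[OF counting] arrival_eq_sum_interarrival[OF counting] by auto
        also have "\<dots> \<in> sets ?W" by measurable
        finally show "{\<omega>\<in>space ?W. k \<le> N t \<omega>} \<in> sets ?W" .
      qed
    qed simp
  qed (auto simp: space_join_sigma intro: join_sigma_right[THEN subsetD])
  ultimately show ?thesis by (rule indep_set_mono) simp
qed

end

section \<open>Compensators of \<open>N\<close> and of the aggregate process\<close>

context risk_model
begin

text \<open>The whole path of \<open>N\<close> is included, future as well: whether claim
  \<open>k\<close> falls into a given time interval is then known, while its size is still
  independent.\<close>

abbreviation past :: "nat \<Rightarrow> 'a measure" where
  "past k \<equiv> join_sigma sigma_N (sigma_X {1..<k})"

lemma space_past: "space (past k) = space M"
  by (simp add: space_join_sigma)

text \<open>Two independences combine: all claims are independent of \<open>N\<close> and \<Theta>,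
  and claim \<open>k\<close> is independent of the earlier ones.\<close>

lemma X_indep_past:
  assumes k: "1 \<le> k"
  shows "indep_set (sets (sigma_X {k})) (sets (past k))"
proof (rule indep_set_commute, rule indep_set_join_sigma)
  show "subalgebra M sigma_N" by (rule subalgebra_N)
  show "subalgebra M (sigma_X {1..<k})" "subalgebra M (sigma_X {k})" using k by (auto intro!: subalgebra_X)
  fix a b c assume a: "a \<in> sets sigma_N" and b: "b \<in> sets (sigma_X {1..<k})" and c: "c \<in> sets (sigma_X {k})"
  let ?E = "\<lambda>i. {X i -` A \<inter> space M | A. A \<in> sets borel}"
  have "indep_vars (\<lambda>_. borel) X {1..}" using risk by (simp add: risk_process_def)
  then have "indep_sets ?E {1..}" unfolding indep_vars_def2 by simp
  then have "indep_sets ?E (\<Union>j\<in>UNIV. case_bool {1..<k} {k} j)"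
    by (rule indep_sets_mono_index[rotated]) (use k in \<open>auto simp: UNIV_bool\<close>)
  then have "indep_sets (\<lambda>j. sigma_sets (space M) (\<Union>i\<in>case_bool {1..<k} {k} j. ?E i)) UNIV"
  proof (rule indep_sets_collect_sigma)
    show "Int_stable (?E i)" for i
    proof (rule Int_stableI)
      fix x y assume "x \<in> ?E i" "y \<in> ?E i"
      then obtain A B where "x = X i -` A \<inter> space M" "y = X i -` B \<inter> space M" "A \<in> sets borel" "B \<in> sets borel"
        by blast
      then show "x \<inter> y \<in> ?E i" by (intro CollectI exI[of _ "A \<inter> B"]) auto
    qed
    show "disjoint_family_on (case_bool {1..<k} {k}) (UNIV :: bool set)"
      by (auto simp: disjoint_family_on_def split: bool.splits)
  qed
  moreover have "(\<lambda>j. sigma_sets (space M) (\<Union>i\<in>case_bool {1..<k} {k} j. ?E i)) =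
      case_bool (sets (sigma_X {1..<k})) (sets (sigma_X {k}))"
    by (rule ext) (simp add: sets_generated_sigma split: bool.splits)
  ultimately have X_indep: "indep_set (sets (sigma_X {1..<k})) (sets (sigma_X {k}))"
    unfolding indep_set_def by simp
  have mono: "sets (sigma_X {1..<k}) \<subseteq> sets (sigma_X {1..})" "sets (sigma_X {k}) \<subseteq> sets (sigma_X {1..})"
    using k by (auto intro!: generated_sigma_mono)
  have b': "b \<in> sets (sigma_X {1..})" and c': "c \<in> sets (sigma_X {1..})" using mono b c by auto
  have bc: "b \<inter> c \<in> sets (sigma_X {1..})" using b' c' by (rule sets.Int)
  have "prob (a \<inter> b \<inter> c) = prob (a \<inter> (b \<inter> c))" by (simp add: Int_assoc)
  also have "\<dots> = prob a * prob b * prob c"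
    by (simp add: indep_setD[OF indep_sigma_N_X a bc] indep_setD[OF X_indep b c])
  also have "\<dots> = prob (a \<inter> b) * prob c" by (simp add: indep_setD[OF indep_sigma_N_X a b'])
  finally show "prob (a \<inter> b \<inter> c) = prob (a \<inter> b) * prob c" .
qed

lemma nn_integral_X_past:
  assumes k: "1 \<le> k" and E: "E \<in> sets (past k)"
  shows "(\<integral>\<^sup>+\<omega>\<in>E. X k \<omega> \<partial>M) = ennreal mean_X * emeasure M E"
proof -
  have "X k \<in> borel_measurable (sigma_X {k})" by (rule measurable_generated_sigma) auto
  then have "(\<lambda>\<omega>. ennreal (X k \<omega>)) \<in> borel_measurable (sigma_X {k})" by measurable
  then have "(\<integral>\<^sup>+\<omega>\<in>E. X k \<omega> \<partial>M) = emeasure M E * (\<integral>\<^sup>+\<omega>. X k \<omega> \<partial>M)"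
    using k by (intro nn_integral_indep_set[OF subalgebra_X X_indep_past E]) auto
  also have "(\<integral>\<^sup>+\<omega>. X k \<omega> \<partial>M) = ennreal mean_X"
    using nn_integral_eq_integral[OF X_int[OF k]] X_pos[OF k] X_mean[OF k] by (auto intro: less_imp_le)
  finally show ?thesis by (simp add: mult.commute)
qed

lemma N_meas_past: "0 \<le> t \<Longrightarrow> N t \<in> measurable (past k) (count_space UNIV)"
  by (intro measurable_count_space_real measurable_join_left N_meas_sigma_N) auto

lemma N_le_past: "0 \<le> t \<Longrightarrow> {\<omega>\<in>space M. N t \<omega> \<le> j} \<in> sets (past k)"
  using measurable_sets[OF N_meas_past, of t "{..j}" k] unfolding space_past vimage_def Int_def
  by (simp add: conj_commute)

text \<open>While at most \<open>k\<close> claims have occurred by time \<open>s\<close>, the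
  aggregate process up to \<open>s\<close> involves only claims with index below
  \<open>Suc k\<close>.\<close>

lemma filt_S_past:
  assumes s: "0 \<le> s" and E: "E \<in> sets (filt_S s)"
  shows "E \<inter> {\<omega>\<in>space M. N s \<omega> \<le> k} \<in> sets (past (Suc k))"
proof (rule enlarged_filtration_trace[OF space_past N_le_past[OF s] _ _ E])
  show "\<Theta> \<in> borel_measurable (past (Suc k))"
    by (intro measurable_join_left \<Theta>_meas_sigma_N) simp
  fix u assume u: "0 \<le> u" "u \<le> s"
  show "\<exists>f\<in>borel_measurable (past (Suc k)). \<forall>\<omega>\<in>{\<omega>\<in>space M. N s \<omega> \<le> k}. aggregate N X u \<omega> = f \<omega>"
  proof (intro bexI ballI)
    show "(\<lambda>\<omega>. \<Sum>j=1..min (N u \<omega>) k. X j \<omega>) \<in> borel_measurable (past (Suc k))"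
    proof (rule measurable_random_sum[OF N_meas_past[OF u(1)]])
      fix j assume "1 \<le> j" "j \<le> k"
      then show "X j \<in> borel_measurable (past (Suc k))"
        by (intro measurable_join_right measurable_generated_sigma) auto
    qed
    fix \<omega> assume "\<omega> \<in> {\<omega>\<in>space M. N s \<omega> \<le> k}"
    then have "N u \<omega> \<le> k" using counting_mono[OF counting, of \<omega> u s] u by auto
    then show "aggregate N X u \<omega> = (\<Sum>j=1..min (N u \<omega>) k. X j \<omega>)" by (simp add: aggregate_def)
  qed
qed

lemma aggregate_meas: "0 \<le> t \<Longrightarrow> aggregate N X t \<in> borel_measurable M"
proof -
  assume t: "0 \<le> t"
  have "(\<lambda>\<omega>. \<Sum>j=1..i. X j \<omega>) \<in> borel_measurable M" for i
    using X_meas by (intro borel_measurable_sum) auto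
  from measurable_compose_countable'[OF this N_meas[OF t]]
  show ?thesis by (simp add: aggregate_def[abs_def])
qed

lemma subalgebra_filt_S: "subalgebra M (filt_S t)"
  by (rule enlarged_filtration_subalgebra) (use aggregate_meas in auto)

lemma subalgebra_filt_N: "subalgebra M (filt_N t)"
  by (rule enlarged_filtration_subalgebra) (use real_N_meas in auto)

lemma aggregate_nonneg: "\<omega> \<in> space M \<Longrightarrow> 0 \<le> aggregate N X t \<omega>"
  unfolding aggregate_def using X_pos by (intro sum_nonneg) (auto intro: less_imp_le)

text \<open>A form of Wald's identity. The increment is the sum of the claims that fall between
  \<open>s\<close> and \<open>t\<close>; for each of them the event of falling there, intersected
  with \<open>E\<close>, precedes its size, so the size may be replaced by its mean.\<close>

lemma nn_integral_aggregate_increment: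
  assumes st: "0 \<le> s" "s \<le> t" and E: "E \<in> sets (filt_S s)"
  shows "(\<integral>\<^sup>+\<omega>\<in>E. aggregate N X t \<omega> \<partial>M) = (\<integral>\<^sup>+\<omega>\<in>E. aggregate N X s \<omega> \<partial>M) +
    ennreal mean_X * (\<integral>\<^sup>+\<omega>\<in>E. real (N t \<omega> - N s \<omega>) \<partial>M)"
proof -
  \<comment> \<open>The event that claim number \<open>k + 1\<close> occurs after \<open>s\<close>
    and not after \<open>t\<close>; hence \<open>X (Suc k)\<close> and \<open>past (Suc k)\<close>
    below.\<close>
  define D where "D k = {\<omega>\<in>space M. N s \<omega> \<le> k} \<inter> {\<omega>\<in>space M. k < N t \<omega>}" for k
  have t: "0 \<le> t" using st by simp
  have EM [measurable]: "E \<in> events" using E subalgebra_filt_S by (auto simp: subalgebra_def)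
  have Dset: "E \<inter> D k \<in> sets (past (Suc k))" for k
  proof -
    have "{\<omega>\<in>space M. k < N t \<omega>} = space (past (Suc k)) - {\<omega>\<in>space M. N t \<omega> \<le> k}"
      unfolding space_past by auto
    also have "\<dots> \<in> sets (past (Suc k))" using N_le_past[OF t] by (rule sets.compl_sets)
    finally have "(E \<inter> {\<omega>\<in>space M. N s \<omega> \<le> k}) \<inter> {\<omega>\<in>space M. k < N t \<omega>} \<in> sets (past (Suc k))"
      by (intro sets.Int filt_S_past[OF st(1) E])
    then show ?thesis by (simp add: D_def Int_assoc)
  qed
  have pastM: "sets (past k) \<subseteq> events" if "1 \<le> k" for k
    using indep_set_events[OF X_indep_past[OF that]] by blast
  have EDM [measurable]: "E \<inter> D k \<in> events" for k using pastM[of "Suc k"] Dset[of k] by auto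
  have X_meas' [measurable]: "X (Suc k) \<in> borel_measurable M" for k by (rule X_meas) simp
  have in_D: "\<omega> \<in> D k \<longleftrightarrow> k \<in> {N s \<omega>..<N t \<omega>}" if "\<omega> \<in> space M" for k \<omega> using that by (auto simp: D_def)
  \<comment> \<open>Used twice: with the claim sizes it produces the aggregate increment, with the
    constant 1 the number of claims.\<close>
  have sums: "(\<Sum>k. ennreal (f k) * indicator (E \<inter> D k) \<omega>) = ennreal (\<Sum>k=N s \<omega>..<N t \<omega>. f k) * indicator E \<omega>"
    if \<omega>: "\<omega> \<in> space M" and f: "\<And>k. 0 \<le> f k" for \<omega> and f :: "nat \<Rightarrow> real"
  proof -
    have "(\<Sum>k. ennreal (f k) * indicator (E \<inter> D k) \<omega>) =
        (\<Sum>k=N s \<omega>..<N t \<omega>. ennreal (f k) * indicator (E \<inter> D k) \<omega>)"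
      by (rule suminf_finite) (auto simp: in_D[OF \<omega>] indicator_def)
    also have "\<dots> = (\<Sum>k=N s \<omega>..<N t \<omega>. ennreal (f k) * indicator E \<omega>)"
      by (rule sum.cong) (auto simp: in_D[OF \<omega>] indicator_def)
    also have "\<dots> = ennreal (\<Sum>k=N s \<omega>..<N t \<omega>. f k) * indicator E \<omega>"
      using f by (simp add: sum_distrib_right[symmetric] sum_ennreal)
    finally show ?thesis .
  qed
  have "(\<integral>\<^sup>+\<omega>\<in>E. aggregate N X t \<omega> \<partial>M) =
      (\<integral>\<^sup>+\<omega>. ennreal (aggregate N X s \<omega>) * indicator E \<omega> +
        (\<Sum>k. ennreal (X (Suc k) \<omega>) * indicator (E \<inter> D k) \<omega>) \<partial>M)"
  proof (rule nn_integral_cong)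
    fix \<omega> assume \<omega>: "\<omega> \<in> space M"
    have N_le: "N s \<omega> \<le> N t \<omega>" using counting_mono[OF counting \<omega>] st by auto
    have pos: "0 \<le> X (Suc k) \<omega>" for k using X_pos[OF _ \<omega>, of "Suc k"] by simp
    have "aggregate N X t \<omega> = (\<Sum>k<N t \<omega>. X (Suc k) \<omega>)" and "aggregate N X s \<omega> = (\<Sum>k<N s \<omega>. X (Suc k) \<omega>)"
      unfolding aggregate_def by (simp_all add: sum.atLeast1_atMost_eq)
    then have "aggregate N X t \<omega> = aggregate N X s \<omega> + (\<Sum>k=N s \<omega>..<N t \<omega>. X (Suc k) \<omega>)"
      using sum.atLeastLessThan_concat[of 0 "N s \<omega>" "N t \<omega>" "\<lambda>k. X (Suc k) \<omega>"] N_le by (simp add: atLeast0LessThan)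
    moreover have "0 \<le> aggregate N X s \<omega>" "0 \<le> (\<Sum>k=N s \<omega>..<N t \<omega>. X (Suc k) \<omega>)"
      using aggregate_nonneg[OF \<omega>] pos by (auto intro: sum_nonneg)
    ultimately show "ennreal (aggregate N X t \<omega>) * indicator E \<omega> = ennreal (aggregate N X s \<omega>) * indicator E \<omega> +
        (\<Sum>k. ennreal (X (Suc k) \<omega>) * indicator (E \<inter> D k) \<omega>)"
      unfolding sums[OF \<omega> pos] by (simp add: distrib_right)
  qed
  also have "\<dots> = (\<integral>\<^sup>+\<omega>\<in>E. aggregate N X s \<omega> \<partial>M) + (\<Sum>k. \<integral>\<^sup>+\<omega>\<in>E \<inter> D k. X (Suc k) \<omega> \<partial>M)"
    using aggregate_meas[OF st(1)] by (subst nn_integral_add) (auto simp: nn_integral_suminf)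
  also have "(\<Sum>k. \<integral>\<^sup>+\<omega>\<in>E \<inter> D k. X (Suc k) \<omega> \<partial>M) = (\<Sum>k. ennreal mean_X * \<integral>\<^sup>+\<omega>. ennreal 1 * indicator (E \<inter> D k) \<omega> \<partial>M)"
    using nn_integral_X_past[OF _ Dset] by simp
  also have "\<dots> = ennreal mean_X * (\<integral>\<^sup>+\<omega>. (\<Sum>k. ennreal 1 * indicator (E \<inter> D k) \<omega>) \<partial>M)"
    by (subst nn_integral_suminf) auto
  also have "(\<integral>\<^sup>+\<omega>. (\<Sum>k. ennreal 1 * indicator (E \<inter> D k) \<omega>) \<partial>M) = (\<integral>\<^sup>+\<omega>\<in>E. real (N t \<omega> - N s \<omega>) \<partial>M)"
    by (intro nn_integral_cong) (subst sums, auto)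
  finally show ?thesis .
qed

lemma nn_integral_counting_increment:
  assumes st: "0 \<le> s" "s \<le> t" and E: "E \<in> events"
  shows "(\<integral>\<^sup>+\<omega>\<in>E. real (N t \<omega>) \<partial>M) = (\<integral>\<^sup>+\<omega>\<in>E. real (N s \<omega>) \<partial>M) + (\<integral>\<^sup>+\<omega>\<in>E. real (N t \<omega> - N s \<omega>) \<partial>M)"
proof -
  have [measurable]: "N t \<in> measurable M (count_space UNIV)" "N s \<in> measurable M (count_space UNIV)" "E \<in> events"
    using st E by (auto intro: N_meas)
  have "(\<integral>\<^sup>+\<omega>\<in>E. real (N t \<omega>) \<partial>M) = (\<integral>\<^sup>+\<omega>. ennreal (real (N s \<omega>)) * indicator E \<omega> +
      ennreal (real (N t \<omega> - N s \<omega>)) * indicator E \<omega> \<partial>M)"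
  proof (rule nn_integral_cong)
    fix \<omega> assume \<omega>: "\<omega> \<in> space M"
    have "N s \<omega> \<le> N t \<omega>" using counting_mono[OF counting \<omega>] st by auto
    then have "ennreal (real (N t \<omega>)) = ennreal (real (N s \<omega>)) + ennreal (real (N t \<omega> - N s \<omega>))"
      by (subst ennreal_plus[symmetric]) auto
    then show "ennreal (real (N t \<omega>)) * indicator E \<omega> = ennreal (real (N s \<omega>)) * indicator E \<omega> +
      ennreal (real (N t \<omega> - N s \<omega>)) * indicator E \<omega>"
      by (simp only: distrib_right)
  qed
  also have "\<dots> = (\<integral>\<^sup>+\<omega>\<in>E. real (N s \<omega>) \<partial>M) + (\<integral>\<^sup>+\<omega>\<in>E. real (N t \<omega> - N s \<omega>) \<partial>M)"
    by (intro nn_integral_add) measurable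
  finally show ?thesis .
qed

lemma nn_integral_\<Theta>_finite: "E \<in> events \<Longrightarrow> (\<integral>\<^sup>+\<omega>\<in>E. \<Theta> \<omega> \<partial>M) < \<infinity>"
  using set_nn_integral_eq_set_integral[OF \<Theta>_int _] \<Theta>_pos by (simp add: eventually_mono less_imp_le)

text \<open>One value of the aggregate process does not reveal the number of claims, so the levels
  are reached one at a time: \<open>N\<close> is at least \<open>k + 1\<close> at \<open>u\<close>
  iff at some rational earlier time it is at least \<open>k\<close> and the aggregate process has
  grown since. Positive claims make growth equivalent to a jump of \<open>N\<close>.\<close>

lemma filt_N_subset_filt_S:
  assumes "0 \<le> s"
  shows "sets (filt_N s) \<subseteq> sets (filt_S s)"
proof (rule enlarged_filtration_least)
  have ge: "{\<omega>\<in>space M. k \<le> N u \<omega>} \<in> sets (filt_S u)" if "0 \<le> u" for k u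
    using that
  proof (induction k arbitrary: u)
    case 0
    then show ?case using sets.top[of "filt_S u"] by simp
  next
    case (Suc k)
    define Q where "Q = \<rat> \<inter> {0..<u}"
    have adapted: "aggregate N X q \<in> borel_measurable (filt_S u)" if "0 \<le> q" "q \<le> u" for q
      using that by (intro measurable_enlarged_process) auto
    have "{\<omega>\<in>space M. Suc k \<le> N u \<omega>} =
        (\<Union>q\<in>Q. {\<omega>\<in>space M. k \<le> N q \<omega>} \<inter> {\<omega>\<in>space (filt_S u). aggregate N X q \<omega> < aggregate N X u \<omega>})"
    proof (intro equalityI subsetI)
      fix \<omega> assume "\<omega> \<in> {\<omega>\<in>space M. Suc k \<le> N u \<omega>}"
      then have \<omega>: "\<omega> \<in> space M" "k < N u \<omega>" by auto
      then obtain q where q: "q \<in> \<rat>" "0 \<le> q" "q < u" "N q \<omega> = k"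
        using counting_value_before[OF counting \<omega>(1) Suc.prems \<omega>(2)] by blast
      have "aggregate N X q \<omega> < aggregate N X u \<omega>"
        unfolding aggregate_def q(4) using \<omega>
        by (intro sum_strict_mono2[where b="N u \<omega>"]) (auto intro!: X_pos less_imp_le[OF X_pos])
      then show "\<omega> \<in> (\<Union>q\<in>Q. {\<omega>\<in>space M. k \<le> N q \<omega>} \<inter> {\<omega>\<in>space (filt_S u). aggregate N X q \<omega> < aggregate N X u \<omega>})"
        using q \<omega> by (auto simp: Q_def)
    next
      fix \<omega> assume "\<omega> \<in> (\<Union>q\<in>Q. {\<omega>\<in>space M. k \<le> N q \<omega>} \<inter> {\<omega>\<in>space (filt_S u). aggregate N X q \<omega> < aggregate N X u \<omega>})"
      then obtain q where q: "0 \<le> q" "q < u" "\<omega> \<in> space M" "k \<le> N q \<omega>" "aggregate N X q \<omega> < aggregate N X u \<omega>"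
        by (auto simp: Q_def)
      have "N q \<omega> \<noteq> N u \<omega>" using q(5) by (auto simp: aggregate_def)
      then have "N q \<omega> < N u \<omega>" using counting_mono[OF counting q(3), of q u] q by simp
      then show "\<omega> \<in> {\<omega>\<in>space M. Suc k \<le> N u \<omega>}" using q by auto
    qed
    also have "\<dots> \<in> sets (filt_S u)"
    proof (intro sets.countable_UN'' sets.Int)
      show "countable Q" unfolding Q_def using countable_rat by auto
      fix q assume "q \<in> Q"
      then have q: "0 \<le> q" "q \<le> u" by (auto simp: Q_def)
      show "{\<omega>\<in>space M. k \<le> N q \<omega>} \<in> sets (filt_S u)"
        using Suc.IH[OF q(1)] enlarged_filtration_mono[OF q(2)] by blast
      show "{\<omega>\<in>space (filt_S u). aggregate N X q \<omega> < aggregate N X u \<omega>} \<in> sets (filt_S u)"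
        using adapted[of q] adapted[of u] q Suc.prems by measurable
    qed
    finally show ?case .
  qed
  fix u assume u: "0 \<le> u" "u \<le> s"
  show "(\<lambda>\<omega>. real (N u \<omega>)) \<in> borel_measurable (filt_S s)"
  proof (rule borel_measurable_nat_ge)
    show "{\<omega>\<in>space (filt_S s). k \<le> N u \<omega>} \<in> sets (filt_S s)" for k
      using subsetD[OF enlarged_filtration_mono[OF u(2)] ge[OF u(1), of k]] by simp
  qed
qed (auto intro: measurable_enlarged_parameter)

text \<open>Adding all claims to the past of \<open>N\<close> preserves compensation, since by
  independence both sides of the identity over \<open>a \<inter> b\<close> equal those over
  \<open>a\<close> times the probability of \<open>b\<close>. This bridges the gap to the filtration
  of the aggregate process, which is larger than that of \<open>N\<close>.\<close>

lemma compensated_N_join_X: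
  assumes comp: "compensated_by M filt_N (\<lambda>t \<omega>. real (N t \<omega>)) \<Theta> 1"
    and st: "0 \<le> s" "s \<le> t" and E: "E \<in> sets (join_sigma (filt_N s) (sigma_X {1..}))"
  shows "(\<integral>\<^sup>+\<omega>\<in>E. real (N t \<omega>) \<partial>M) = (\<integral>\<^sup>+\<omega>\<in>E. real (N s \<omega>) \<partial>M) + ennreal (t - s) * (\<integral>\<^sup>+\<omega>\<in>E. \<Theta> \<omega> \<partial>M)"
proof -
  define f where "f \<omega> = ennreal (real (N t \<omega>))" for \<omega>
  define g where "g \<omega> = ennreal (real (N s \<omega>)) + ennreal (t - s) * ennreal (\<Theta> \<omega>)" for \<omega>
  have t: "0 \<le> t" using st by simp
  have f_N: "f \<in> borel_measurable sigma_N" unfolding f_def using N_meas_sigma_N[OF t] by measurable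
  have g_N: "g \<in> borel_measurable sigma_N" unfolding g_def using N_meas_sigma_N[OF st(1)] \<Theta>_meas_sigma_N by measurable
  have [measurable]: "f \<in> borel_measurable M" "g \<in> borel_measurable M"
    using f_N g_N measurable_from_subalg[OF subalgebra_N] by auto
  have g_int: "(\<integral>\<^sup>+\<omega>\<in>E. g \<omega> \<partial>M) = (\<integral>\<^sup>+\<omega>\<in>E. real (N s \<omega>) \<partial>M) + ennreal (t - s) * (\<integral>\<^sup>+\<omega>\<in>E. \<Theta> \<omega> \<partial>M)"
    if [measurable]: "E \<in> events" for E
  proof -
    have "(\<integral>\<^sup>+\<omega>\<in>E. g \<omega> \<partial>M) = (\<integral>\<^sup>+\<omega>. ennreal (real (N s \<omega>)) * indicator E \<omega> +
        ennreal (t - s) * (ennreal (\<Theta> \<omega>) * indicator E \<omega>) \<partial>M)"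
      by (intro nn_integral_cong) (auto simp: g_def indicator_def)
    also have "\<dots> = (\<integral>\<^sup>+\<omega>\<in>E. real (N s \<omega>) \<partial>M) + ennreal (t - s) * (\<integral>\<^sup>+\<omega>\<in>E. \<Theta> \<omega> \<partial>M)"
      using real_N_meas[OF st(1)] by (subst nn_integral_add) (auto simp: nn_integral_cmult)
    finally show ?thesis .
  qed
  have eq: "(\<integral>\<^sup>+\<omega>\<in>a. f \<omega> \<partial>M) = (\<integral>\<^sup>+\<omega>\<in>a. g \<omega> \<partial>M)" if a: "a \<in> sets (filt_N s)" for a
  proof -
    have "a \<in> events" using a subalgebra_filt_N by (auto simp: subalgebra_def)
    then show ?thesis using comp st a g_int unfolding compensated_by_def f_def by simp
  qed
  let ?G = "{a \<inter> b | a b. a \<in> sets (filt_N s) \<and> b \<in> sets (sigma_X {1..})}"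
  have sp: "space (sigma_X {1..}) = space (filt_N s)" by simp
  have "(\<integral>\<^sup>+\<omega>\<in>E. f \<omega> \<partial>M) = (\<integral>\<^sup>+\<omega>\<in>E. g \<omega> \<partial>M)"
  proof (rule nn_integral_eq_on_sigma[where G="?G"])
    have top: "space M \<in> sets (filt_N s)" "space M \<in> sets (sigma_X {1..})"
      using sets.top[of "filt_N s"] sets.top[of "sigma_X {1..}"] by auto
    have 0: "space M \<in> sets (filt_N 0)" using sets.top[of "filt_N 0"] by simp
    have "(\<integral>\<^sup>+\<omega>. f \<omega> \<partial>M) = (\<integral>\<^sup>+\<omega>\<in>space M. f \<omega> \<partial>M)" by (intro nn_integral_cong) simp
    also have "\<dots> = (\<integral>\<^sup>+\<omega>\<in>space M. real (N 0 \<omega>) \<partial>M) + ennreal ((t - 0) * 1) * (\<integral>\<^sup>+\<omega>\<in>space M. \<Theta> \<omega> \<partial>M)"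
      using comp t 0 unfolding compensated_by_def f_def by blast
    also have "(\<integral>\<^sup>+\<omega>\<in>space M. real (N 0 \<omega>) \<partial>M) = (\<integral>\<^sup>+\<omega>. 0 \<partial>M)"
      using counting by (intro nn_integral_cong) (simp add: counting_process_def)
    finally have "(\<integral>\<^sup>+\<omega>. f \<omega> \<partial>M) = ennreal t * (\<integral>\<^sup>+\<omega>\<in>space M. \<Theta> \<omega> \<partial>M)" by simp
    also have "\<dots> < \<infinity>" using nn_integral_\<Theta>_finite[of "space M"] by (simp add: ennreal_mult_less_top)
    finally show "(\<integral>\<^sup>+\<omega>. f \<omega> \<partial>M) < \<infinity>" .
    show "?G \<subseteq> events" using subalgebra_filt_N[of s] subalgebra_X[of "{1..}"] by (auto simp: subalgebra_def)
    show "Int_stable ?G" by (rule Int_stable_Int)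
    show "space M \<in> ?G" using top by blast
    show "E \<in> sigma_sets (space M) ?G" using E sets_join_sigma_Int[OF sp] by simp
    fix x assume "x \<in> ?G"
    then obtain a b where x: "x = a \<inter> b" and a: "a \<in> sets (filt_N s)" and b: "b \<in> sets (sigma_X {1..})" by blast
    have aN: "a \<in> sets sigma_N" using a filt_N_subset by blast
    have split: "(\<integral>\<^sup>+\<omega>\<in>x. h \<omega> \<partial>M) = emeasure M b * (\<integral>\<^sup>+\<omega>\<in>a. h \<omega> \<partial>M)" if h: "h \<in> borel_measurable sigma_N" for h
    proof -
      have "(\<integral>\<^sup>+\<omega>\<in>x. h \<omega> \<partial>M) = (\<integral>\<^sup>+\<omega>\<in>b. (h \<omega> * indicator a \<omega>) \<partial>M)"
        by (intro nn_integral_cong) (auto simp: x indicator_def)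
      also have "\<dots> = emeasure M b * (\<integral>\<^sup>+\<omega>\<in>a. h \<omega> \<partial>M)"
        using h aN by (intro nn_integral_indep_set[OF subalgebra_N indep_sigma_N_X b] borel_measurable_times_ennreal
              borel_measurable_indicator)
      finally show ?thesis .
    qed
    show "(\<integral>\<^sup>+\<omega>\<in>x. f \<omega> \<partial>M) = (\<integral>\<^sup>+\<omega>\<in>x. g \<omega> \<partial>M)"
      using eq[OF a] by (simp add: split[OF f_N] split[OF g_N])
  qed auto
  moreover have "E \<in> events"
  proof -
    have "sets (join_sigma (filt_N s) (sigma_X {1..})) \<subseteq> events"
      using subalgebra_filt_N[of s] subalgebra_X[of "{1..}"] by (intro join_sigma_least) (auto simp: subalgebra_def)
    then show ?thesis using E by blast
  qed
  ultimately show ?thesis using g_int by (simp add: f_def)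
qed

lemma filt_S_subset_join:
  assumes "0 \<le> s"
  shows "sets (filt_S s) \<subseteq> sets (join_sigma (filt_N s) (sigma_X {1..}))" (is "_ \<subseteq> sets ?H")
proof (rule enlarged_filtration_least)
  fix u assume u: "0 \<le> u" "u \<le> s"
  have "(\<lambda>\<omega>. real (N u \<omega>)) \<in> borel_measurable (filt_N s)"
    by (rule measurable_enlarged_process[where Y="\<lambda>t \<omega>. real (N t \<omega>)"]) (use u in auto)
  then have N: "N u \<in> measurable ?H (count_space UNIV)"
    by (intro measurable_count_space_real measurable_join_left) auto
  have "(\<lambda>\<omega>. \<Sum>j=1..i. X j \<omega>) \<in> borel_measurable ?H" for i
    by (intro borel_measurable_sum measurable_join_right measurable_generated_sigma) auto
  from measurable_compose_countable'[OF this N]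
  show "aggregate N X u \<in> borel_measurable ?H" by (simp add: aggregate_def[abs_def])
qed (auto simp: space_join_sigma intro!: measurable_join_left measurable_enlarged_parameter)

text \<open>In both directions the increments are isolated and compared by Wald's identity. From
  \<open>N\<close> the filtration must first be enlarged by the claims; from the aggregate process
  the inclusion of the filtrations is enough.\<close>

lemma compensated_aggregate_iff:
  "compensated_by M filt_S (aggregate N X) \<Theta> mean_X \<longleftrightarrow>
   compensated_by M filt_N (\<lambda>t \<omega>. real (N t \<omega>)) \<Theta> 1"
proof
  assume comp: "compensated_by M filt_N (\<lambda>t \<omega>. real (N t \<omega>)) \<Theta> 1"
  show "compensated_by M filt_S (aggregate N X) \<Theta> mean_X"
    unfolding compensated_by_def
  proof (intro allI impI ballI)
    fix s t E assume st: "0 \<le> s \<and> s \<le> t" and E: "E \<in> sets (filt_S s)"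
    have EM: "E \<in> events" using E subalgebra_filt_S by (auto simp: subalgebra_def)
    have "E \<in> sets (join_sigma (filt_N s) (sigma_X {1..}))" using E filt_S_subset_join st by blast
    note eq = compensated_N_join_X[OF comp _ _ this, of t]
    \<comment> \<open>Compensation from time 0 makes the mean of \<open>N s\<close> finite;
      otherwise the common summand could not be cancelled in \<open>ennreal\<close>.\<close>
    have "space M \<in> sets (join_sigma (filt_N 0) (sigma_X {1..}))"
      using sets.top[of "join_sigma (filt_N 0) (sigma_X {1..})"] by (simp add: space_join_sigma)
    from compensated_N_join_X[OF comp _ _ this, of s]
    have "(\<integral>\<^sup>+\<omega>\<in>space M. real (N s \<omega>) \<partial>M) = (\<integral>\<^sup>+\<omega>\<in>space M. real (N 0 \<omega>) \<partial>M) + ennreal s * (\<integral>\<^sup>+\<omega>\<in>space M. \<Theta> \<omega> \<partial>M)"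
      using st by simp
    also have "(\<integral>\<^sup>+\<omega>\<in>space M. real (N 0 \<omega>) \<partial>M) = (\<integral>\<^sup>+\<omega>. 0 \<partial>M)"
      using counting by (intro nn_integral_cong) (simp add: counting_process_def)
    finally have "(\<integral>\<^sup>+\<omega>\<in>space M. real (N s \<omega>) \<partial>M) = ennreal s * (\<integral>\<^sup>+\<omega>\<in>space M. \<Theta> \<omega> \<partial>M)" by simp
    moreover have "\<dots> < \<infinity>" using nn_integral_\<Theta>_finite[of "space M"] by (simp add: ennreal_mult_less_top)
    moreover have "(\<integral>\<^sup>+\<omega>\<in>E. real (N s \<omega>) \<partial>M) \<le> (\<integral>\<^sup>+\<omega>\<in>space M. real (N s \<omega>) \<partial>M)"
      by (intro nn_integral_mono) (auto simp: indicator_def)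
    ultimately have fin: "(\<integral>\<^sup>+\<omega>\<in>E. real (N s \<omega>) \<partial>M) \<noteq> \<infinity>" by (auto simp: top_unique)
    have "(\<integral>\<^sup>+\<omega>\<in>E. real (N s \<omega>) \<partial>M) + (\<integral>\<^sup>+\<omega>\<in>E. real (N t \<omega> - N s \<omega>) \<partial>M) =
        (\<integral>\<^sup>+\<omega>\<in>E. real (N s \<omega>) \<partial>M) + ennreal (t - s) * (\<integral>\<^sup>+\<omega>\<in>E. \<Theta> \<omega> \<partial>M)"
      using eq nn_integral_counting_increment[of s t E] st EM by simp
    then have "(\<integral>\<^sup>+\<omega>\<in>E. real (N t \<omega> - N s \<omega>) \<partial>M) = ennreal (t - s) * (\<integral>\<^sup>+\<omega>\<in>E. \<Theta> \<omega> \<partial>M)"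
      using fin by (simp only: ennreal_add_left_cancel) simp
    then show "(\<integral>\<^sup>+\<omega>\<in>E. aggregate N X t \<omega> \<partial>M) = (\<integral>\<^sup>+\<omega>\<in>E. aggregate N X s \<omega> \<partial>M) +
        ennreal ((t - s) * mean_X) * (\<integral>\<^sup>+\<omega>\<in>E. \<Theta> \<omega> \<partial>M)"
      using nn_integral_aggregate_increment[of s t E] st E mean_X_pos by (simp add: ennreal_mult mult_ac)
  qed
next
  assume comp: "compensated_by M filt_S (aggregate N X) \<Theta> mean_X"
  show "compensated_by M filt_N (\<lambda>t \<omega>. real (N t \<omega>)) \<Theta> 1"
    unfolding compensated_by_def
  proof (intro allI impI ballI)
    fix s t E assume st: "0 \<le> s \<and> s \<le> t" and E: "E \<in> sets (filt_N s)"
    have ES: "E \<in> sets (filt_S s)" using E filt_N_subset_filt_S st by blast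
    have EM: "E \<in> events" using ES subalgebra_filt_S by (auto simp: subalgebra_def)
    have 0: "space M \<in> sets (filt_S 0)" using sets.top[of "filt_S 0"] by simp
    have "(\<integral>\<^sup>+\<omega>\<in>space M. aggregate N X s \<omega> \<partial>M) =
        (\<integral>\<^sup>+\<omega>\<in>space M. aggregate N X 0 \<omega> \<partial>M) + ennreal ((s - 0) * mean_X) * (\<integral>\<^sup>+\<omega>\<in>space M. \<Theta> \<omega> \<partial>M)"
      using comp st 0 unfolding compensated_by_def by blast
    also have "(\<integral>\<^sup>+\<omega>\<in>space M. aggregate N X 0 \<omega> \<partial>M) = (\<integral>\<^sup>+\<omega>. 0 \<partial>M)"
      using counting by (intro nn_integral_cong) (simp add: counting_process_def aggregate_def)
    finally have "(\<integral>\<^sup>+\<omega>\<in>space M. aggregate N X s \<omega> \<partial>M) = ennreal (s * mean_X) * (\<integral>\<^sup>+\<omega>\<in>space M. \<Theta> \<omega> \<partial>M)" by simp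
    moreover have "\<dots> < \<infinity>" using nn_integral_\<Theta>_finite[of "space M"] by (simp add: ennreal_mult_less_top)
    moreover have "(\<integral>\<^sup>+\<omega>\<in>E. aggregate N X s \<omega> \<partial>M) \<le> (\<integral>\<^sup>+\<omega>\<in>space M. aggregate N X s \<omega> \<partial>M)"
      by (intro nn_integral_mono) (auto simp: indicator_def)
    ultimately have fin: "(\<integral>\<^sup>+\<omega>\<in>E. aggregate N X s \<omega> \<partial>M) \<noteq> \<infinity>" by (auto simp: top_unique)
    have c1: "(\<integral>\<^sup>+\<omega>\<in>E. aggregate N X t \<omega> \<partial>M) = (\<integral>\<^sup>+\<omega>\<in>E. aggregate N X s \<omega> \<partial>M) +
        ennreal ((t - s) * mean_X) * (\<integral>\<^sup>+\<omega>\<in>E. \<Theta> \<omega> \<partial>M)"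
      using comp st ES unfolding compensated_by_def by blast
    have "s \<le> t" "0 \<le> s" using st by auto
    have "(\<integral>\<^sup>+\<omega>\<in>E. aggregate N X s \<omega> \<partial>M) + ennreal mean_X * (\<integral>\<^sup>+\<omega>\<in>E. real (N t \<omega> - N s \<omega>) \<partial>M) =
        (\<integral>\<^sup>+\<omega>\<in>E. aggregate N X s \<omega> \<partial>M) + ennreal ((t - s) * mean_X) * (\<integral>\<^sup>+\<omega>\<in>E. \<Theta> \<omega> \<partial>M)"
      using nn_integral_aggregate_increment[OF \<open>0 \<le> s\<close> \<open>s \<le> t\<close> ES] unfolding c1 by (rule sym)
    then have "ennreal mean_X * (\<integral>\<^sup>+\<omega>\<in>E. real (N t \<omega> - N s \<omega>) \<partial>M) =
        ennreal mean_X * (ennreal (t - s) * (\<integral>\<^sup>+\<omega>\<in>E. \<Theta> \<omega> \<partial>M))"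
      using fin st mean_X_pos by (simp only: ennreal_add_left_cancel) (simp add: ennreal_mult mult_ac)
    \<comment> \<open>Division by the mean claim size, which is positive and finite.\<close>
    then have "(\<integral>\<^sup>+\<omega>\<in>E. real (N t \<omega> - N s \<omega>) \<partial>M) = ennreal (t - s) * (\<integral>\<^sup>+\<omega>\<in>E. \<Theta> \<omega> \<partial>M)"
      using mean_X_pos by (simp add: ennreal_mult_cancel_left)
    then show "(\<integral>\<^sup>+\<omega>\<in>E. real (N t \<omega>) \<partial>M) = (\<integral>\<^sup>+\<omega>\<in>E. real (N s \<omega>) \<partial>M) +
        ennreal ((t - s) * 1) * (\<integral>\<^sup>+\<omega>\<in>E. \<Theta> \<omega> \<partial>M)"
      using nn_integral_counting_increment[of s t E] st EM by simp
  qed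
qed

end

section \<open>Conditionally Poisson increments\<close>

text \<open>Explicit weights are also meaningful at \<open>r = 0\<close>, the case
  \<open>s = t\<close>, where they give unit mass at 0.\<close>

definition poisson_density :: "real \<Rightarrow> nat \<Rightarrow> real" where
  "poisson_density r k = r ^ k / fact k * exp (- r)"

lemma poisson_density_nonneg: "0 \<le> r \<Longrightarrow> 0 \<le> poisson_density r k"
  by (simp add: poisson_density_def)

lemma measurable_poisson_density [measurable (raw)]:
  assumes [measurable]: "f \<in> borel_measurable M"
  shows "(\<lambda>x. poisson_density (f x) k) \<in> borel_measurable M"
  unfolding poisson_density_def by measurable

lemma poisson_density_generating_function:
  "(\<lambda>k. poisson_density r k * z ^ k) sums exp (- (1 - z) * r)"
proof -
  have "(\<lambda>k. exp (- r) * ((r * z) ^ k /\<^sub>R fact k)) sums (exp (- r) * exp (r * z))"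
    by (intro sums_mult exp_converges)
  moreover have "exp (- r) * exp (r * z) = exp (- (1 - z) * r)"
    by (simp add: exp_add[symmetric] algebra_simps)
  moreover have "(\<lambda>k. exp (- r) * ((r * z) ^ k /\<^sub>R fact k)) = (\<lambda>k. poisson_density r k * z ^ k)"
    by (simp add: poisson_density_def fun_eq_iff power_mult_distrib divide_inverse)
  ultimately show ?thesis by simp
qed

lemma poisson_density_le_1:
  assumes "0 \<le> r" shows "poisson_density r k \<le> 1"
proof -
  have s: "(\<lambda>k. poisson_density r k) sums 1" using poisson_density_generating_function[of r 1] by simp
  have "(\<Sum>i\<in>{k}. poisson_density r i) \<le> suminf (poisson_density r)"
    using s assms by (intro sum_le_suminf) (auto simp: sums_summable poisson_density_nonneg)
  then show ?thesis using sums_unique[OF s] by simp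
qed

text \<open>From \<open>r\<close> times weight \<open>k\<close> being \<open>k + 1\<close> times
  weight \<open>k + 1\<close>: the series of the mean is a shifted multiple of the total
  mass.\<close>

lemma poisson_density_mean: "(\<lambda>k. real k * poisson_density r k) sums r"
proof -
  have "(\<lambda>k. r * poisson_density r k) sums (r * 1)"
    using poisson_density_generating_function[of r 1] by (intro sums_mult) simp
  moreover have "r * poisson_density r k = real (Suc k) * poisson_density r (Suc k)" for k
    by (simp add: poisson_density_def field_simps del: of_nat_Suc)
  ultimately have "(\<lambda>k. real (Suc k) * poisson_density r (Suc k)) sums r" by simp
  then show ?thesis using sums_Suc_iff[of "\<lambda>k. real k * poisson_density r k" r] by simp
qed

text \<open>Once all coefficients of the difference before index \<open>k\<close> vanish, division
  by \<open>z ^ k\<close> and the limit at 0 isolate coefficient \<open>k\<close>.\<close>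

lemma powser_coefficient_unique:
  fixes a b :: "nat \<Rightarrow> real"
  assumes a: "\<And>z. \<bar>z\<bar> < 1 \<Longrightarrow> (\<lambda>k. a k * z ^ k) sums f z"
    and b: "\<And>z. \<bar>z\<bar> < 1 \<Longrightarrow> (\<lambda>k. b k * z ^ k) sums f z"
  shows "a k = b k"
proof (induction k rule: less_induct)
  case (less k)
  define c where "c i = a i - b i" for i
  have c0: "c i = 0" if "i < k" for i using less[OF that] by (simp add: c_def)
  have "(\<lambda>i. c (i + k) * z ^ i) sums 0" if z: "z \<noteq> 0" "norm z < 1" for z
  proof -
    have "(\<lambda>i. c i * z ^ i) sums 0" using sums_diff[OF a b, of z z] z by (simp add: c_def algebra_simps)
    then have "(\<lambda>i. c (i + k) * z ^ (i + k)) sums 0"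
      using sums_iff_shift'[of "\<lambda>i. c i * z ^ i" k 0] c0 by simp
    then have "(\<lambda>i. c (i + k) * z ^ (i + k) / z ^ k) sums (0 / z ^ k)" by (rule sums_divide)
    then show ?thesis using z by (simp add: power_add)
  qed
  then have "((\<lambda>_. 0) \<longlongrightarrow> c (0 + k)) (at (0::real))"
    by (intro powser_limit_0_strong[of 1 "\<lambda>i. c (i + k)" "\<lambda>_. 0"]) auto
  then have "c k = 0" using tendsto_unique[OF _ _ tendsto_const, of "at (0::real)"] by fastforce
  then show ?case by (simp add: c_def)
qed

text \<open>For the upper half, \<open>1 - x + x\<^sup>2\<close> times the quadratic Taylor
  polynomial of the exponential is at least 1 and at most the same factor times
  \<open>exp x\<close>. The bound becomes the error of order two of a partition cell.\<close>

lemma exp_minus_remainder: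
  assumes "0 \<le> (x::real)"
  shows "\<bar>exp (- x) - 1 + x\<bar> \<le> x\<^sup>2"
proof -
  have lower: "0 \<le> exp (- x) - 1 + x" using exp_ge_add_one_self[of "- x"] by simp
  have "1 \<le> (1 - x + x\<^sup>2) * (1 + x + x\<^sup>2 / 2)"
  proof -
    have "(1 - x + x\<^sup>2) * (1 + x + x\<^sup>2 / 2) = 1 + (x\<^sup>2 / 2 + x ^ 3 / 2 + x ^ 4 / 2)"
      by (simp add: field_simps power2_eq_square power3_eq_cube power4_eq_xxxx)
    then show ?thesis using assms by simp
  qed
  also have "\<dots> \<le> (1 - x + x\<^sup>2) * exp x"
  proof (rule mult_left_mono)
    show "1 + x + x\<^sup>2 / 2 \<le> exp x" using exp_lower_Taylor_quadratic[OF assms] by simp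
    have "1 - x + x\<^sup>2 = (x - 1/2)\<^sup>2 + 3/4" by (simp add: power2_eq_square algebra_simps)
    then show "0 \<le> 1 - x + x\<^sup>2" by simp
  qed
  finally have "exp (- x) \<le> 1 - x + x\<^sup>2" by (simp add: exp_minus field_simps)
  then show ?thesis using lower by simp
qed

text \<open>Linearisation is exact for \<open>d = 0\<close> and \<open>d = 1\<close>, so the error
  is carried by cells with at least two jumps. There the crude bound
  \<open>2 + 2 * d \<le> 4 * d\<close> yields the factor 4.\<close>

lemma power_remainder:
  fixes z :: real
  assumes "\<bar>z\<bar> \<le> 1"
  shows "\<bar>z ^ d - 1 + (1 - z) * real d\<bar> \<le> 4 * (if 2 \<le> d then real d else 0)"
proof (cases "2 \<le> d")
  case True
  have "\<bar>z ^ d\<bar> \<le> 1" using assms by (simp add: power_abs power_le_one)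
  moreover have "\<bar>(1 - z) * real d\<bar> \<le> 2 * real d"
    unfolding abs_mult using assms by (intro mult_mono) auto
  moreover have "\<bar>z ^ d - 1 + (1 - z) * real d\<bar> \<le> \<bar>z ^ d\<bar> + 1 + \<bar>(1 - z) * real d\<bar>" by linarith
  ultimately have "\<bar>z ^ d - 1 + (1 - z) * real d\<bar> \<le> 2 + 2 * real d" by linarith
  also have "\<dots> \<le> 4 * real d" using True by simp
  finally show ?thesis using True by simp
next
  case False
  then have "d = 0 \<or> d = 1" by auto
  then show ?thesis by auto
qed

context risk_model
begin

text \<open>Given the past at \<open>s\<close>, the increment is conditionally Poisson with
  parameter \<open>(t - s)\<close> times \<Theta>; the integrated form avoids versions of
  conditional probabilities. It mediates between the martingale property and the mixed Poisson
  property.\<close>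

definition poisson_increments :: bool where
  "poisson_increments \<longleftrightarrow> (\<forall>s t k. 0 \<le> s \<and> s \<le> t \<longrightarrow> (\<forall>E\<in>sets (filt_N s).
     emeasure M (E \<inter> {\<omega>\<in>space M. N t \<omega> - N s \<omega> = k}) =
     (\<integral>\<^sup>+\<omega>\<in>E. poisson_density ((t - s) * \<Theta> \<omega>) k \<partial>M)))"

lemma increment_meas:
  assumes "0 \<le> s" "0 \<le> t"
  shows "(\<lambda>\<omega>. N t \<omega> - N s \<omega>) \<in> measurable M (count_space UNIV)"
proof -
  have [measurable]: "N t \<in> measurable M (count_space UNIV)" "N s \<in> measurable M (count_space UNIV)"
    using assms by (auto intro: N_meas)
  show ?thesis by measurable
qed

lemma increment_set:
  assumes "0 \<le> s" "0 \<le> t" shows "{\<omega>\<in>space M. N t \<omega> - N s \<omega> \<in> B} \<in> events"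
  using measurable_sets[OF increment_meas[OF assms], of B] unfolding vimage_def Int_def
  by (simp add: conj_commute)

text \<open>Weighting the identity for \<open>k\<close> by \<open>k\<close> and summing yields the
  mean of the increment on one side and the mean of the Poisson law on the other.\<close>

lemma poisson_increments_imp_compensated:
  assumes pois: "poisson_increments"
  shows "compensated_by M filt_N (\<lambda>t \<omega>. real (N t \<omega>)) \<Theta> 1"
  unfolding compensated_by_def
proof (intro allI impI ballI)
  fix s t E assume st: "0 \<le> s \<and> s \<le> t" and E: "E \<in> sets (filt_N s)"
  have EM [measurable]: "E \<in> events" using E subalgebra_filt_N by (auto simp: subalgebra_def)
  let ?D = "\<lambda>k. {\<omega>\<in>space M. N t \<omega> - N s \<omega> = k}"
  have Dset [measurable]: "?D k \<in> events" for k using increment_set[of s t "{k}"] st by simp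
  have "(\<integral>\<^sup>+\<omega>\<in>E. real (N t \<omega> - N s \<omega>) \<partial>M) =
      (\<integral>\<^sup>+\<omega>. (\<Sum>k. ennreal (real k) * indicator (E \<inter> ?D k) \<omega>) \<partial>M)"
  proof (rule nn_integral_cong)
    fix \<omega> assume \<omega>: "\<omega> \<in> space M"
    have "(\<Sum>k. ennreal (real k) * indicator (E \<inter> ?D k) \<omega>) =
        (\<Sum>k\<in>{N t \<omega> - N s \<omega>}. ennreal (real k) * indicator (E \<inter> ?D k) \<omega>)"
      by (rule suminf_finite) (auto simp: indicator_def)
    then show "ennreal (real (N t \<omega> - N s \<omega>)) * indicator E \<omega> = (\<Sum>k. ennreal (real k) * indicator (E \<inter> ?D k) \<omega>)"
      using \<omega> by (simp add: indicator_def)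
  qed
  also have "\<dots> = (\<Sum>k. ennreal (real k) * emeasure M (E \<inter> ?D k))"
    by (subst nn_integral_suminf) (auto simp: nn_integral_cmult_indicator)
  also have "\<dots> = (\<Sum>k. ennreal (real k) * (\<integral>\<^sup>+\<omega>\<in>E. poisson_density ((t - s) * \<Theta> \<omega>) k \<partial>M))"
    using pois st E unfolding poisson_increments_def by simp
  also have "\<dots> = (\<integral>\<^sup>+\<omega>. (\<Sum>k. ennreal (real k) * (ennreal (poisson_density ((t - s) * \<Theta> \<omega>) k) * indicator E \<omega>)) \<partial>M)"
    by (subst nn_integral_suminf) (auto simp: nn_integral_cmult)
  also have "\<dots> = (\<integral>\<^sup>+\<omega>. ennreal (t - s) * (ennreal (\<Theta> \<omega>) * indicator E \<omega>) \<partial>M)"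
  proof (rule nn_integral_cong_AE)
    show "AE \<omega> in M. (\<Sum>k. ennreal (real k) * (ennreal (poisson_density ((t - s) * \<Theta> \<omega>) k) * indicator E \<omega>)) =
        ennreal (t - s) * (ennreal (\<Theta> \<omega>) * indicator E \<omega>)"
      using \<Theta>_pos
    proof eventually_elim
      fix \<omega> assume pos: "0 < \<Theta> \<omega>"
      define r where "r = (t - s) * \<Theta> \<omega>"
      have r: "0 \<le> r" using pos st by (simp add: r_def)
      have "(\<lambda>k. ennreal (real k * poisson_density r k)) sums ennreal r"
        using poisson_density_mean[of r] r by (subst sums_ennreal) (auto simp: poisson_density_nonneg)
      then have "(\<Sum>k. ennreal (real k * poisson_density r k)) = ennreal r" by (rule sums_unique[symmetric])
      moreover have "ennreal (real k * poisson_density r k) = ennreal (real k) * ennreal (poisson_density r k)" for k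
        using r by (intro ennreal_mult) (auto simp: poisson_density_nonneg)
      moreover have "ennreal r = ennreal (t - s) * ennreal (\<Theta> \<omega>)"
        unfolding r_def using pos st by (intro ennreal_mult) auto
      ultimately show "(\<Sum>k. ennreal (real k) * (ennreal (poisson_density ((t - s) * \<Theta> \<omega>) k) * indicator E \<omega>)) =
          ennreal (t - s) * (ennreal (\<Theta> \<omega>) * indicator E \<omega>)"
        unfolding r_def[symmetric] by (cases "\<omega> \<in> E") auto
    qed
  qed
  also have "\<dots> = ennreal (t - s) * (\<integral>\<^sup>+\<omega>\<in>E. \<Theta> \<omega> \<partial>M)" by (rule nn_integral_cmult) measurable
  finally show "(\<integral>\<^sup>+\<omega>\<in>E. real (N t \<omega>) \<partial>M) = (\<integral>\<^sup>+\<omega>\<in>E. real (N s \<omega>) \<partial>M) + ennreal ((t - s) * 1) * (\<integral>\<^sup>+\<omega>\<in>E. \<Theta> \<omega> \<partial>M)"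
    using nn_integral_counting_increment[of s t E] st EM by simp
qed

lemma counting_martingale_iff:
  "martingale_L1 M filt_N (\<lambda>t \<omega>. real (N t \<omega>) - t * \<Theta> \<omega>) \<longleftrightarrow>
   compensated_by M filt_N (\<lambda>t \<omega>. real (N t \<omega>)) \<Theta> 1"
proof -
  have "(\<lambda>\<omega>. real (N t \<omega>)) \<in> borel_measurable (filt_N t)" if "0 \<le> t" for t
    by (rule measurable_enlarged_process[where Y="\<lambda>t \<omega>. real (N t \<omega>)"]) (use that in auto)
  moreover have "AE \<omega> in M. 0 \<le> \<Theta> \<omega>" using \<Theta>_pos by eventually_elim simp
  ultimately have "martingale_L1 M filt_N (\<lambda>t \<omega>. real (N t \<omega>) - t * \<Theta> \<omega> * 1) \<longleftrightarrow>
      compensated_by M filt_N (\<lambda>t \<omega>. real (N t \<omega>)) \<Theta> 1"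
    using counting by (intro martingale_L1_iff_compensated subalgebra_filt_N measurable_enlarged_parameter \<Theta>_int)
      (auto simp: counting_process_def)
  then show ?thesis by simp
qed

end

section \<open>Watanabe's characterisation\<close>

text \<open>The geometric series in \<open>\<bar>z\<bar>\<close> dominates, so summation and
  integration may be exchanged.\<close>

lemma (in prob_space) sums_integral_power:
  fixes p :: "nat \<Rightarrow> 'a \<Rightarrow> real"
  assumes [measurable]: "\<And>k. p k \<in> borel_measurable M" and p: "AE \<omega> in M. \<forall>k. \<bar>p k \<omega>\<bar> \<le> 1"
    and z: "\<bar>z\<bar> < 1"
  shows "(\<lambda>k. (\<integral>\<omega>. p k \<omega> \<partial>M) * z ^ k) sums (\<integral>\<omega>. (\<Sum>k. p k \<omega> * z ^ k) \<partial>M)"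
proof -
  have bound: "AE \<omega> in M. norm (p k \<omega> * z ^ k) \<le> \<bar>z\<bar> ^ k" for k
    using p by eventually_elim (auto simp: abs_mult power_abs intro!: mult_left_le_one_le)
  have int: "integrable M (\<lambda>\<omega>. p k \<omega> * z ^ k)" for k
    using bound[of k] by (intro integrable_const_bound[where B="\<bar>z\<bar> ^ k"]) auto
  have geo: "summable (\<lambda>k. \<bar>z\<bar> ^ k)" using z by (intro summable_geometric) simp
  have "(\<lambda>k. \<integral>\<omega>. p k \<omega> * z ^ k \<partial>M) sums (\<integral>\<omega>. (\<Sum>k. p k \<omega> * z ^ k) \<partial>M)"
  proof (rule sums_integral[OF int])
    have "AE \<omega> in M. \<forall>k. norm (p k \<omega> * z ^ k) \<le> \<bar>z\<bar> ^ k" using bound by (simp add: AE_all_countable)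
    then show "AE \<omega> in M. summable (\<lambda>k. norm (p k \<omega> * z ^ k))"
      by eventually_elim (rule summable_comparison_test[OF _ geo], auto)
    have "(\<integral>\<omega>. norm (p k \<omega> * z ^ k) \<partial>M) \<le> (\<integral>\<omega>. \<bar>z\<bar> ^ k \<partial>M)" for k
      using bound[of k] int[of k] by (intro integral_mono_AE) auto
    then have le: "(\<integral>\<omega>. norm (p k \<omega> * z ^ k) \<partial>M) \<le> \<bar>z\<bar> ^ k" for k by (simp add: prob_space)
    show "summable (\<lambda>k. \<integral>\<omega>. norm (p k \<omega> * z ^ k) \<partial>M)"
      by (rule summable_comparison_test[OF _ geo]) (use le in \<open>auto intro!: exI[of _ 0]\<close>)
  qed
  then show ?thesis by simp
qed

context risk_model
begin

lemma integrable_bounded_mult: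
  fixes G h :: "'a \<Rightarrow> real"
  assumes "integrable M h" "G \<in> borel_measurable M" "\<And>\<omega>. \<omega> \<in> space M \<Longrightarrow> \<bar>G \<omega>\<bar> \<le> 1"
  shows "integrable M (\<lambda>\<omega>. G \<omega> * h \<omega>)"
proof (rule Bochner_Integration.integrable_bound[OF assms(1)])
  show "(\<lambda>\<omega>. G \<omega> * h \<omega>) \<in> borel_measurable M" using assms(1,2) by measurable
  show "AE \<omega> in M. norm (G \<omega> * h \<omega>) \<le> norm (h \<omega>)"
    using assms(3) by (intro AE_I2) (auto simp: abs_mult intro!: mult_left_le_one_le)
qed

lemma compensated_imp_integrable:
  assumes "compensated_by M filt_N (\<lambda>t \<omega>. real (N t \<omega>)) \<Theta> 1" "0 \<le> t"
  shows "integrable M (\<lambda>\<omega>. real (N t \<omega>))"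
proof -
  have "integrable M (\<lambda>\<omega>. real (N t \<omega>) - t * \<Theta> \<omega>)"
    using assms unfolding counting_martingale_iff[symmetric] martingale_L1_def by blast
  then have "integrable M (\<lambda>\<omega>. (real (N t \<omega>) - t * \<Theta> \<omega>) + t * \<Theta> \<omega>)"
    using \<Theta>_int by (intro Bochner_Integration.integrable_add) auto
  then show ?thesis by simp
qed

text \<open>Conditional expectation replaces events by bounded weights: \<open>Y u\<close> is a
  version of the conditional expectation of \<open>Y v\<close> given the past at \<open>u\<close>,
  and past-measurable factors pass through it.\<close>

lemma compensated_test_function:
  assumes comp: "compensated_by M filt_N (\<lambda>t \<omega>. real (N t \<omega>)) \<Theta> 1"
    and uv: "0 \<le> u" "u \<le> v" and G: "G \<in> borel_measurable (filt_N u)"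
    and bound: "\<And>\<omega>. \<omega> \<in> space M \<Longrightarrow> \<bar>G \<omega>\<bar> \<le> 1"
  shows "(\<integral>\<omega>. G \<omega> * (real (N v \<omega>) - real (N u \<omega>)) \<partial>M) = (v - u) * (\<integral>\<omega>. G \<omega> * \<Theta> \<omega> \<partial>M)"
proof -
  define Y where "Y t \<omega> = real (N t \<omega>) - t * \<Theta> \<omega>" for t \<omega>
  have v: "0 \<le> v" using uv by simp
  have mart: "martingale_L1 M filt_N Y"
    using comp unfolding counting_martingale_iff[symmetric] Y_def[abs_def] .
  have Y_int: "integrable M (Y u)" "integrable M (Y v)" and Y_meas: "Y u \<in> borel_measurable (filt_N u)"
    using mart uv v unfolding martingale_L1_def by blast+
  have Y_eq: "set_lebesgue_integral M E (Y u) = set_lebesgue_integral M E (Y v)" if "E \<in> sets (filt_N u)" for E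
    using mart uv v that unfolding martingale_L1_def by blast
  interpret Z: finite_measure_subalgebra M "filt_N u" by unfold_locales (rule subalgebra_filt_N)
  have GM: "G \<in> borel_measurable M" using G by (rule measurable_from_subalg[OF subalgebra_filt_N])
  have ce: "AE \<omega> in M. real_cond_exp M (filt_N u) (Y v) \<omega> = Y u \<omega>"
    using Y_eq Y_int Y_meas by (intro Z.real_cond_exp_charact) auto
  have "(\<integral>\<omega>. G \<omega> * Y v \<omega> \<partial>M) = (\<integral>\<omega>. G \<omega> * real_cond_exp M (filt_N u) (Y v) \<omega> \<partial>M)"
    using Y_int(2) by (intro Z.real_cond_exp_intg(2)[symmetric] integrable_bounded_mult[OF _ GM bound] G) auto
  also have "\<dots> = (\<integral>\<omega>. G \<omega> * Y u \<omega> \<partial>M)"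
  proof (rule integral_cong_AE)
    show "AE \<omega> in M. G \<omega> * real_cond_exp M (filt_N u) (Y v) \<omega> = G \<omega> * Y u \<omega>"
      using ce by eventually_elim simp
  qed (use GM Y_int in auto)
  finally have eq: "(\<integral>\<omega>. G \<omega> * Y v \<omega> \<partial>M) = (\<integral>\<omega>. G \<omega> * Y u \<omega> \<partial>M)" .
  have "(\<integral>\<omega>. G \<omega> * (real (N v \<omega>) - real (N u \<omega>)) \<partial>M) =
      (\<integral>\<omega>. (G \<omega> * Y v \<omega> - G \<omega> * Y u \<omega>) + (v - u) * (G \<omega> * \<Theta> \<omega>) \<partial>M)"
    by (intro Bochner_Integration.integral_cong) (auto simp: Y_def algebra_simps)
  also have "\<dots> = ((\<integral>\<omega>. G \<omega> * Y v \<omega> \<partial>M) - (\<integral>\<omega>. G \<omega> * Y u \<omega> \<partial>M)) + (v - u) * (\<integral>\<omega>. G \<omega> * \<Theta> \<omega> \<partial>M)"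
    using integrable_bounded_mult[OF Y_int(1) GM bound] integrable_bounded_mult[OF Y_int(2) GM bound]
      integrable_bounded_mult[OF \<Theta>_int GM bound]
    by (subst Bochner_Integration.integral_add) auto
  finally show ?thesis using eq by simp
qed

text \<open>Along a partition of \<open>[s, t]\<close> of mesh \<open>h\<close>, the martingale property replaces the generating function of each
  increment by \<open>exp (- (1 - z) \<Theta> h)\<close>, up to an error from increments of size at least two and an error of
  order \<open>h\<^sup>2\<close>; both vanish in the limit, since the jumps of \<open>N\<close> have size one.\<close>

lemma generating_function_bounded:
  assumes comp: "compensated_by M filt_N (\<lambda>t \<omega>. real (N t \<omega>)) \<Theta> 1"
    and st: "0 \<le> s" "s \<le> t" and E: "E \<in> sets (filt_N s)"
    and EK: "\<And>\<omega>. \<omega> \<in> E \<Longrightarrow> 0 < \<Theta> \<omega> \<and> \<Theta> \<omega> \<le> K" and z: "\<bar>z\<bar> \<le> 1"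
  shows "(\<integral>\<omega>. indicator E \<omega> * z ^ (N t \<omega> - N s \<omega>) \<partial>M) =
    (\<integral>\<omega>. indicator E \<omega> * exp (- (1 - z) * ((t - s) * \<Theta> \<omega>)) \<partial>M)"
proof -
  define a where "a = 1 - z"
  have a: "0 \<le> a" "a \<le> 2" using z by (auto simp: a_def)
  have t: "0 \<le> t" using st by simp
  have EM [measurable]: "E \<in> events" using E subalgebra_filt_N by (auto simp: subalgebra_def)
  define h where "h n = (t - s) / real (Suc n)" for n
  define \<tau> where "\<tau> n i = s + real i * h n" for n i
  define \<Delta> where "\<Delta> n i \<omega> = N (\<tau> n (Suc i)) \<omega> - N (\<tau> n i) \<omega>" for n i \<omega>
  define R where "R n i \<omega> = 4 * (if 2 \<le> \<Delta> n i \<omega> then real (\<Delta> n i \<omega>) else 0)" for n i \<omega>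
  \<comment> \<open>Interpolates between the two sides: \<open>f n 0\<close> contains only the
    exponential, \<open>f n (Suc n)\<close> only the power of \<open>z\<close>. Each step trades the
    exponential of one cell for the power belonging to the jumps in it.\<close>
  define f where "f n i \<omega> = indicator E \<omega> * z ^ (N (\<tau> n i) \<omega> - N s \<omega>) * exp (- a * \<Theta> \<omega> * (t - \<tau> n i))" for n i \<omega>
  have h0: "0 \<le> h n" for n using st by (simp add: h_def)
  have \<tau>_Suc: "\<tau> n (Suc i) = \<tau> n i + h n" for n i by (simp add: \<tau>_def algebra_simps)
  have \<tau>_0: "\<tau> n 0 = s" and \<tau>_end: "\<tau> n (Suc n) = t" for n by (simp_all add: \<tau>_def h_def del: of_nat_Suc)
  have \<tau>_s: "s \<le> \<tau> n i" for n i using h0[of n] by (simp add: \<tau>_def)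
  have \<tau>_0': "0 \<le> \<tau> n i" for n i using \<tau>_s[of n i] st by simp
  have \<tau>_t: "\<tau> n i \<le> t" if "i \<le> Suc n" for n i
  proof -
    have "real i * h n \<le> real (Suc n) * h n" using that h0[of n] by (intro mult_right_mono) auto
    then show ?thesis using \<tau>_end[of n] by (simp add: \<tau>_def)
  qed
  have \<tau>_le: "\<tau> n i \<le> \<tau> n (Suc i)" for n i using \<tau>_Suc h0 by simp
  have N_mono: "N u \<omega> \<le> N v \<omega>" if "\<omega> \<in> space M" "0 \<le> u" "u \<le> v" for u v \<omega>
    using counting_mono[OF counting that(1,2,3)] .
  have \<Delta>_real: "real (\<Delta> n i \<omega>) = real (N (\<tau> n (Suc i)) \<omega>) - real (N (\<tau> n i) \<omega>)" if "\<omega> \<in> space M" for n i \<omega>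
    using N_mono[OF that \<tau>_0' \<tau>_le, of n i] by (simp add: \<Delta>_def)
  have N_m [measurable]: "N (\<tau> n i) \<in> measurable M (count_space UNIV)" "N s \<in> measurable M (count_space UNIV)"
    "N t \<in> measurable M (count_space UNIV)" for n i
    using \<tau>_0' st t by (auto intro: N_meas)
  have [measurable]: "\<Delta> n i \<in> measurable M (count_space UNIV)" for n i unfolding \<Delta>_def by measurable
  have R_meas [measurable]: "R n i \<in> borel_measurable M" for n i unfolding R_def by measurable
  have f_meas [measurable]: "f n i \<in> borel_measurable M" for n i unfolding f_def by measurable
  have zpow: "\<bar>z ^ k\<bar> \<le> 1" for k using z by (simp add: power_abs power_le_one)
  have \<Theta>_E: "0 \<le> \<Theta> \<omega>" "\<Theta> \<omega> \<le> K" if "\<omega> \<in> E" for \<omega> using EK[OF that] by auto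
  have damp: "\<bar>indicator E \<omega> * z ^ k * exp (- a * \<Theta> \<omega> * x)\<bar> \<le> 1" if "0 \<le> x" for \<omega> k x
  proof (cases "\<omega> \<in> E")
    case True
    have "exp (- a * \<Theta> \<omega> * x) \<le> 1" using a \<Theta>_E[OF True] that by simp
    then show ?thesis using zpow[of k] by (simp add: True abs_mult mult_le_one)
  qed simp
  have f_int: "integrable M (f n i)" if "i \<le> Suc n" for n i
    by (rule integrable_const_bound[where B=1]) (use damp \<tau>_t[OF that] in \<open>auto simp: f_def\<close>)
  have N_int: "integrable M (\<lambda>\<omega>. real (N u \<omega>))" if "0 \<le> u" for u
    using compensated_imp_integrable[OF comp that] .
  have R_nonneg: "0 \<le> R n i \<omega>" for n i \<omega> by (simp add: R_def)
  have R_le: "R n i \<omega> \<le> 4 * real (\<Delta> n i \<omega>)" for n i \<omega> by (simp add: R_def)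
  have R_int: "integrable M (R n i)" for n i
  proof (rule Bochner_Integration.integrable_bound)
    show "integrable M (\<lambda>\<omega>. 4 * (real (N (\<tau> n (Suc i)) \<omega>) - real (N (\<tau> n i) \<omega>)))"
      using N_int[OF \<tau>_0'] by auto
    show "AE \<omega> in M. norm (R n i \<omega>) \<le> norm (4 * (real (N (\<tau> n (Suc i)) \<omega>) - real (N (\<tau> n i) \<omega>)))"
    proof (rule AE_I2)
      fix \<omega> assume "\<omega> \<in> space M"
      from \<Delta>_real[OF this] show "norm (R n i \<omega>) \<le> norm (4 * (real (N (\<tau> n (Suc i)) \<omega>) - real (N (\<tau> n i) \<omega>)))"
        using R_le[of n i \<omega>] R_nonneg[of n i \<omega>] by simp
    qed
  qed measurable
  have step: "\<bar>integral\<^sup>L M (f n (Suc i)) - integral\<^sup>L M (f n i)\<bar> \<le> integral\<^sup>L M (R n i) + (2 * K * h n)\<^sup>2"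
    if i: "i < Suc n" for n i
  proof -
    \<comment> \<open>The common factor of \<open>f n i\<close> and \<open>f n (Suc i)\<close>. It
      is known at the left end of the cell, so compensation may be tested against it.\<close>
    define G where "G \<omega> = indicator E \<omega> * z ^ (N (\<tau> n i) \<omega> - N s \<omega>) * exp (- a * \<Theta> \<omega> * (t - \<tau> n (Suc i)))" for \<omega>
    define e1 where "e1 \<omega> = G \<omega> * (z ^ \<Delta> n i \<omega> - 1 + a * real (\<Delta> n i \<omega>))" for \<omega>
    define e2 where "e2 \<omega> = G \<omega> * (exp (- (a * \<Theta> \<omega> * h n)) - 1 + a * \<Theta> \<omega> * h n)" for \<omega>
    have G_bound: "\<bar>G \<omega>\<bar> \<le> 1" for \<omega> unfolding G_def using \<tau>_t[of "Suc i" n] i by (intro damp) auto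
    have G_filt: "G \<in> borel_measurable (filt_N (\<tau> n i))"
    proof -
      have [measurable]: "E \<in> sets (filt_N (\<tau> n i))" using E enlarged_filtration_mono[OF \<tau>_s] by blast
      have [measurable]: "\<Theta> \<in> borel_measurable (filt_N (\<tau> n i))" by (rule measurable_enlarged_parameter)
      have "(\<lambda>\<omega>. real (N u \<omega>)) \<in> borel_measurable (filt_N (\<tau> n i))" if "0 \<le> u" "u \<le> \<tau> n i" for u
        by (rule measurable_enlarged_process[where Y="\<lambda>t \<omega>. real (N t \<omega>)"]) (use that in auto)
      then have [measurable]: "N s \<in> measurable (filt_N (\<tau> n i)) (count_space UNIV)"
          "N (\<tau> n i) \<in> measurable (filt_N (\<tau> n i)) (count_space UNIV)"
        using st \<tau>_s \<tau>_0' by (auto intro!: measurable_count_space_real)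
      show ?thesis unfolding G_def by measurable
    qed
    have GM [measurable]: "G \<in> borel_measurable M" using G_filt by (rule measurable_from_subalg[OF subalgebra_filt_N])
    have [measurable]: "e1 \<in> borel_measurable M" "e2 \<in> borel_measurable M" unfolding e1_def e2_def by measurable
    have e1_le: "\<bar>e1 \<omega>\<bar> \<le> R n i \<omega>" for \<omega>
      using mult_mono[OF G_bound power_remainder[OF z, of "\<Delta> n i \<omega>"]] by (simp add: e1_def R_def a_def abs_mult)
    \<comment> \<open>The constant arises from \<open>a \<le> 2\<close> and from \<Theta> being at
      most \<open>K\<close> on \<open>E\<close>; off \<open>E\<close> the factor \<open>G\<close> is
      zero.\<close>
    have e2_le: "\<bar>e2 \<omega>\<bar> \<le> (2 * K * h n)\<^sup>2" for \<omega>
    proof (cases "\<omega> \<in> E")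
      case True
      have x: "0 \<le> a * \<Theta> \<omega> * h n" using a \<Theta>_E[OF True] h0 by simp
      have "a * \<Theta> \<omega> * h n \<le> 2 * K * h n" using a \<Theta>_E[OF True] h0[of n] by (intro mult_mono) auto
      then have "(a * \<Theta> \<omega> * h n)\<^sup>2 \<le> (2 * K * h n)\<^sup>2" using x by (rule power_mono)
      moreover have "\<bar>e2 \<omega>\<bar> \<le> 1 * (a * \<Theta> \<omega> * h n)\<^sup>2"
        unfolding e2_def abs_mult using G_bound exp_minus_remainder[OF x] by (intro mult_mono) auto
      ultimately show ?thesis by simp
    qed (simp add: e2_def G_def)
    have e1_int: "integrable M e1"
      by (rule Bochner_Integration.integrable_bound[OF R_int[of n i]]) (use e1_le R_nonneg in auto)
    have e2_int: "integrable M e2"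
      by (rule integrable_const_bound[where B="(2 * K * h n)\<^sup>2"]) (use e2_le in auto)
    have I1: "integrable M (\<lambda>\<omega>. G \<omega> * (real (N (\<tau> n (Suc i)) \<omega>) - real (N (\<tau> n i) \<omega>)))"
      using N_int[OF \<tau>_0'] by (intro integrable_bounded_mult GM G_bound Bochner_Integration.integrable_diff)
    have I2: "integrable M (\<lambda>\<omega>. G \<omega> * \<Theta> \<omega>)" by (intro integrable_bounded_mult GM G_bound \<Theta>_int)
    have "integral\<^sup>L M (f n (Suc i)) - integral\<^sup>L M (f n i) = (\<integral>\<omega>. f n (Suc i) \<omega> - f n i \<omega> \<partial>M)"
      using f_int i by simp
    also have "\<dots> = (\<integral>\<omega>. (e1 \<omega> - e2 \<omega>) + ((- a) * (G \<omega> * (real (N (\<tau> n (Suc i)) \<omega>) - real (N (\<tau> n i) \<omega>))) +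
        (a * h n) * (G \<omega> * \<Theta> \<omega>)) \<partial>M)"
    proof (rule Bochner_Integration.integral_cong[OF refl])
      fix \<omega> assume \<omega>: "\<omega> \<in> space M"
      have "N (\<tau> n (Suc i)) \<omega> - N s \<omega> = (N (\<tau> n i) \<omega> - N s \<omega>) + \<Delta> n i \<omega>"
        using N_mono[OF \<omega> st(1) \<tau>_s, of n i] N_mono[OF \<omega> \<tau>_0' \<tau>_le, of n i] by (simp add: \<Delta>_def)
      then have 1: "f n (Suc i) \<omega> = G \<omega> * z ^ \<Delta> n i \<omega>" by (simp add: f_def G_def power_add)
      have "- a * \<Theta> \<omega> * (t - \<tau> n i) = - a * \<Theta> \<omega> * (t - \<tau> n (Suc i)) + (- (a * \<Theta> \<omega> * h n))"
        by (simp add: \<tau>_Suc algebra_simps)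
      then have 2: "f n i \<omega> = G \<omega> * exp (- (a * \<Theta> \<omega> * h n))" by (simp only: f_def G_def exp_add mult.assoc)
      show "f n (Suc i) \<omega> - f n i \<omega> = (e1 \<omega> - e2 \<omega>) +
          ((- a) * (G \<omega> * (real (N (\<tau> n (Suc i)) \<omega>) - real (N (\<tau> n i) \<omega>))) + (a * h n) * (G \<omega> * \<Theta> \<omega>))"
        unfolding 1 2 e1_def e2_def \<Delta>_real[OF \<omega>, symmetric] by (simp add: algebra_simps)
    qed
    also have "\<dots> = (\<integral>\<omega>. e1 \<omega> - e2 \<omega> \<partial>M) +
        ((- a) * (\<integral>\<omega>. G \<omega> * (real (N (\<tau> n (Suc i)) \<omega>) - real (N (\<tau> n i) \<omega>)) \<partial>M) + (a * h n) * (\<integral>\<omega>. G \<omega> * \<Theta> \<omega> \<partial>M))"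
      using e1_int e2_int I1 I2 by (simp only: Bochner_Integration.integral_add Bochner_Integration.integrable_diff
          Bochner_Integration.integrable_add integrable_mult_right integral_mult_right_zero)
    \<comment> \<open>Compensation enters here: the first-order terms, \<open>- a\<close> times the
      increment of \<open>N\<close> and \<open>a * h n\<close> times \<Theta>, cancel in the
      mean.\<close>
    also have "\<dots> = (\<integral>\<omega>. e1 \<omega> - e2 \<omega> \<partial>M)"
      using compensated_test_function[OF comp \<tau>_0' \<tau>_le G_filt G_bound] by (simp add: \<tau>_Suc)
    finally have eq: "integral\<^sup>L M (f n (Suc i)) - integral\<^sup>L M (f n i) = (\<integral>\<omega>. e1 \<omega> - e2 \<omega> \<partial>M)" .
    have "\<bar>\<integral>\<omega>. e1 \<omega> - e2 \<omega> \<partial>M\<bar> \<le> (\<integral>\<omega>. \<bar>e1 \<omega> - e2 \<omega>\<bar> \<partial>M)" by (rule integral_abs_bound)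
    also have "\<dots> \<le> (\<integral>\<omega>. R n i \<omega> + (2 * K * h n)\<^sup>2 \<partial>M)"
    proof (rule integral_mono)
      show "\<bar>e1 \<omega> - e2 \<omega>\<bar> \<le> R n i \<omega> + (2 * K * h n)\<^sup>2" for \<omega>
        using e1_le[of \<omega>] e2_le[of \<omega>] by linarith
    qed (use e1_int e2_int R_int in auto)
    also have "\<dots> = integral\<^sup>L M (R n i) + (2 * K * h n)\<^sup>2" using R_int by (simp add: prob_space)
    finally show ?thesis using eq by simp
  qed
  \<comment> \<open>There are \<open>Suc n\<close> cells with an error of order \<open>h n\<close>
    squared each, in total of order \<open>1 / Suc n\<close>.\<close>
  define err where "err n = (\<integral>\<omega>. (\<Sum>i<Suc n. R n i \<omega>) \<partial>M) + real (Suc n) * (2 * K * h n)\<^sup>2" for n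
  have diff: "\<bar>integral\<^sup>L M (f n (Suc n)) - integral\<^sup>L M (f n 0)\<bar> \<le> err n" for n
  proof -
    have "integral\<^sup>L M (f n (Suc n)) - integral\<^sup>L M (f n 0) = (\<Sum>i<Suc n. integral\<^sup>L M (f n (Suc i)) - integral\<^sup>L M (f n i))"
      by (rule sum_lessThan_telescope[symmetric])
    also have "\<bar>\<dots>\<bar> \<le> (\<Sum>i<Suc n. \<bar>integral\<^sup>L M (f n (Suc i)) - integral\<^sup>L M (f n i)\<bar>)" by (rule sum_abs)
    also have "\<dots> \<le> (\<Sum>i<Suc n. integral\<^sup>L M (R n i) + (2 * K * h n)\<^sup>2)" by (intro sum_mono step) auto
    also have "\<dots> = (\<Sum>i<Suc n. integral\<^sup>L M (R n i)) + real (Suc n) * (2 * K * h n)\<^sup>2"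
      by (simp only: sum.distrib sum_constant card_lessThan)
    also have "(\<Sum>i<Suc n. integral\<^sup>L M (R n i)) = (\<integral>\<omega>. (\<Sum>i<Suc n. R n i \<omega>) \<partial>M)"
      using R_int by (intro Bochner_Integration.integral_sum[symmetric]) auto
    finally show ?thesis by (simp add: err_def)
  qed
  have "(\<lambda>n. \<integral>\<omega>. (\<Sum>i<Suc n. R n i \<omega>) \<partial>M) \<longlonglongrightarrow> (\<integral>\<omega>. 0 \<partial>M)"
  proof (rule integral_dominated_convergence[where w="\<lambda>\<omega>. 4 * real (N t \<omega>)"])
    show "integrable M (\<lambda>\<omega>. 4 * real (N t \<omega>))" using N_int[OF t] by simp
    show "AE \<omega> in M. norm (\<Sum>i<Suc n. R n i \<omega>) \<le> 4 * real (N t \<omega>)" for n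
    proof (rule AE_I2)
      fix \<omega> assume \<omega>: "\<omega> \<in> space M"
      have "norm (\<Sum>i<Suc n. R n i \<omega>) = (\<Sum>i<Suc n. R n i \<omega>)" using R_nonneg by (simp add: sum_nonneg)
      also have "\<dots> \<le> (\<Sum>i<Suc n. 4 * (real (N (\<tau> n (Suc i)) \<omega>) - real (N (\<tau> n i) \<omega>)))"
        using R_le[of n _ \<omega>] \<Delta>_real[OF \<omega>] by (intro sum_mono) simp
      also have "\<dots> = 4 * (real (N (\<tau> n (Suc n)) \<omega>) - real (N (\<tau> n 0) \<omega>))"
        unfolding sum_distrib_left[symmetric] by (subst sum_lessThan_telescope) simp
      also have "\<dots> \<le> 4 * real (N t \<omega>)" by (simp add: \<tau>_end)
      finally show "norm (\<Sum>i<Suc n. R n i \<omega>) \<le> 4 * real (N t \<omega>)" .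
    qed
    show "AE \<omega> in M. (\<lambda>n. \<Sum>i<Suc n. R n i \<omega>) \<longlonglongrightarrow> 0"
    proof (rule AE_I2)
      fix \<omega> assume \<omega>: "\<omega> \<in> space M"
      \<comment> \<open>As soon as the mesh is below \<open>\<delta>\<close>, no cell contains two
        jumps of this path, so the sum of the errors is exactly zero.\<close>
      obtain \<delta> where \<delta>: "0 < \<delta>" "\<And>u v. 0 \<le> u \<Longrightarrow> u \<le> v \<Longrightarrow> v \<le> t \<Longrightarrow> v - u < \<delta> \<Longrightarrow> N v \<omega> \<le> N u \<omega> + 1"
        using counting_no_double_jump[OF counting \<omega> t] by blast
      have "h \<longlonglongrightarrow> (t - s) * 0"
        unfolding h_def using tendsto_mult[OF tendsto_const LIMSEQ_inverse_real_of_nat, of "t - s"]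
        by (simp add: divide_inverse)
      then have "\<forall>\<^sub>F n in sequentially. h n < \<delta>" using \<delta>(1) by (intro order_tendstoD) auto
      then have "\<forall>\<^sub>F n in sequentially. (\<Sum>i<Suc n. R n i \<omega>) = 0"
      proof eventually_elim
        fix n assume hn: "h n < \<delta>"
        have "R n i \<omega> = 0" if "i < Suc n" for i
        proof -
          have "N (\<tau> n (Suc i)) \<omega> \<le> N (\<tau> n i) \<omega> + 1"
            using that hn by (intro \<delta>(2) \<tau>_0' \<tau>_le \<tau>_t) (auto simp: \<tau>_Suc)
          then show ?thesis by (simp add: R_def \<Delta>_def)
        qed
        then show "(\<Sum>i<Suc n. R n i \<omega>) = 0" by (intro sum.neutral) auto
      qed
      then show "(\<lambda>n. \<Sum>i<Suc n. R n i \<omega>) \<longlonglongrightarrow> 0" by (rule tendsto_eventually)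
    qed
  qed measurable
  moreover have "(\<lambda>n. real (Suc n) * (2 * K * h n)\<^sup>2) \<longlonglongrightarrow> 0"
  proof -
    have "real (Suc n) * (2 * K * h n)\<^sup>2 = (2 * K * (t - s))\<^sup>2 * inverse (real (Suc n))" for n
      by (simp add: h_def power2_eq_square field_simps del: of_nat_Suc)
    then show ?thesis
      using tendsto_mult[OF tendsto_const LIMSEQ_inverse_real_of_nat, of "(2 * K * (t - s))\<^sup>2"] by simp
  qed
  ultimately have err: "err \<longlonglongrightarrow> 0" unfolding err_def by (auto intro: tendsto_eq_intros)
  define d where "d = (\<integral>\<omega>. indicator E \<omega> * z ^ (N t \<omega> - N s \<omega>) \<partial>M) - (\<integral>\<omega>. indicator E \<omega> * exp (- a * \<Theta> \<omega> * (t - s)) \<partial>M)"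
  have "\<bar>d\<bar> \<le> err n" for n
    using diff[of n] by (simp add: d_def f_def[abs_def] \<tau>_end \<tau>_0)
  then have "\<bar>d\<bar> \<le> 0" by (intro tendsto_lowerbound[OF err]) auto
  then show ?thesis by (simp add: d_def a_def mult_ac)
qed

text \<open>The events with \<Theta> positive and at most \<open>n\<close> exhaust \<open>E\<close>
  up to a null set, and both integrands are bounded by 1 almost everywhere.\<close>

lemma generating_function:
  assumes comp: "compensated_by M filt_N (\<lambda>t \<omega>. real (N t \<omega>)) \<Theta> 1"
    and st: "0 \<le> s" "s \<le> t" and E: "E \<in> sets (filt_N s)" and z: "\<bar>z\<bar> \<le> 1"
  shows "(\<integral>\<omega>. indicator E \<omega> * z ^ (N t \<omega> - N s \<omega>) \<partial>M) =
    (\<integral>\<omega>. indicator E \<omega> * exp (- (1 - z) * ((t - s) * \<Theta> \<omega>)) \<partial>M)"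
proof -
  define EK where "EK n = E \<inter> {\<omega>\<in>space M. 0 < \<Theta> \<omega> \<and> \<Theta> \<omega> \<le> real n}" for n :: nat
  have EM [measurable]: "E \<in> events" using E subalgebra_filt_N by (auto simp: subalgebra_def)
  have EKM [measurable]: "EK n \<in> events" for n unfolding EK_def by measurable
  have EK: "EK n \<in> sets (filt_N s)" for n
  proof -
    have [measurable]: "\<Theta> \<in> borel_measurable (filt_N s)" by (rule measurable_enlarged_parameter)
    have "{\<omega>\<in>space (filt_N s). 0 < \<Theta> \<omega> \<and> \<Theta> \<omega> \<le> real n} \<in> sets (filt_N s)" by measurable
    then show ?thesis unfolding EK_def using E by (intro sets.Int) auto
  qed
  have [measurable]: "(\<lambda>\<omega>. N t \<omega> - N s \<omega>) \<in> measurable M (count_space UNIV)"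
    using st by (intro increment_meas) auto
  have lim: "(\<lambda>n. \<integral>\<omega>. indicator (EK n) \<omega> * u \<omega> \<partial>M) \<longlonglongrightarrow> (\<integral>\<omega>. indicator E \<omega> * u \<omega> \<partial>M)"
    if [measurable]: "u \<in> borel_measurable M" and u: "AE \<omega> in M. \<bar>u \<omega>\<bar> \<le> 1" for u :: "'a \<Rightarrow> real"
  proof (rule integral_dominated_convergence[where w="\<lambda>_. 1"])
    show "AE \<omega> in M. norm (indicator (EK n) \<omega> * u \<omega>) \<le> 1" for n
      using u by eventually_elim (auto simp: indicator_def)
    show "AE \<omega> in M. (\<lambda>n. indicator (EK n) \<omega> * u \<omega>) \<longlonglongrightarrow> indicator E \<omega> * u \<omega>"
      using \<Theta>_pos AE_space
    proof eventually_elim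
      fix \<omega> assume pos: "0 < \<Theta> \<omega>" and \<omega>: "\<omega> \<in> space M"
      obtain n0 where n0: "\<Theta> \<omega> \<le> real n0" using real_arch_simple by blast
      have "\<forall>\<^sub>F n in sequentially. indicator (EK n) \<omega> * u \<omega> = indicator E \<omega> * u \<omega>"
        using eventually_ge_at_top[of n0]
      proof eventually_elim
        fix n assume "n0 \<le> n"
        then have "\<Theta> \<omega> \<le> real n" using n0 by (meson of_nat_le_iff order_trans)
        then show "indicator (EK n) \<omega> * u \<omega> = indicator E \<omega> * u \<omega>"
          using pos \<omega> by (simp add: EK_def indicator_def)
      qed
      then show "(\<lambda>n. indicator (EK n) \<omega> * u \<omega>) \<longlonglongrightarrow> indicator E \<omega> * u \<omega>" by (rule tendsto_eventually)
    qed
  qed auto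
  have "(\<lambda>n. \<integral>\<omega>. indicator (EK n) \<omega> * z ^ (N t \<omega> - N s \<omega>) \<partial>M) \<longlonglongrightarrow> (\<integral>\<omega>. indicator E \<omega> * z ^ (N t \<omega> - N s \<omega>) \<partial>M)"
    using z by (intro lim) (auto simp: power_abs power_le_one)
  moreover have "(\<lambda>n. \<integral>\<omega>. indicator (EK n) \<omega> * exp (- (1 - z) * ((t - s) * \<Theta> \<omega>)) \<partial>M) \<longlonglongrightarrow>
      (\<integral>\<omega>. indicator E \<omega> * exp (- (1 - z) * ((t - s) * \<Theta> \<omega>)) \<partial>M)"
  proof (rule lim)
    show "AE \<omega> in M. \<bar>exp (- (1 - z) * ((t - s) * \<Theta> \<omega>))\<bar> \<le> 1"
      using \<Theta>_pos
    proof eventually_elim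
      fix \<omega> assume "0 < \<Theta> \<omega>"
      then have "0 \<le> (1 - z) * ((t - s) * \<Theta> \<omega>)" using st z by (intro mult_nonneg_nonneg) auto
      then show "\<bar>exp (- (1 - z) * ((t - s) * \<Theta> \<omega>))\<bar> \<le> 1"
        by (simp only: mult_minus_left abs_exp_cancel exp_le_one_iff neg_le_0_iff_le)
    qed
  qed measurable
  moreover have "(\<integral>\<omega>. indicator (EK n) \<omega> * z ^ (N t \<omega> - N s \<omega>) \<partial>M) =
      (\<integral>\<omega>. indicator (EK n) \<omega> * exp (- (1 - z) * ((t - s) * \<Theta> \<omega>)) \<partial>M)" for n
    by (rule generating_function_bounded[OF comp st EK _ z, where K="real n"]) (auto simp: EK_def)
  ultimately show ?thesis by (simp add: LIMSEQ_unique)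
qed

text \<open>For fixed \<open>E\<close> the masses of the values of the increment and the integrated
  Poisson weights are the coefficients of the same power series on the open unit interval, hence
  equal.\<close>

lemma compensated_imp_poisson_increments:
  assumes comp: "compensated_by M filt_N (\<lambda>t \<omega>. real (N t \<omega>)) \<Theta> 1"
  shows "poisson_increments"
  unfolding poisson_increments_def
proof (intro allI impI ballI)
  fix s t k E assume st: "0 \<le> s \<and> s \<le> t" and E: "E \<in> sets (filt_N s)"
  have EM [measurable]: "E \<in> events" using E subalgebra_filt_N by (auto simp: subalgebra_def)
  let ?D = "\<lambda>k. {\<omega>\<in>space M. N t \<omega> - N s \<omega> = k}"
  have Dset [measurable]: "?D k \<in> events" for k using increment_set[of s t "{k}"] st by simp
  define p where "p k \<omega> = (indicator (E \<inter> ?D k) \<omega> :: real)" for k \<omega>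
  define q where "q k \<omega> = indicator E \<omega> * poisson_density ((t - s) * \<Theta> \<omega>) k" for k \<omega>
  have [measurable]: "p k \<in> borel_measurable M" "q k \<in> borel_measurable M" for k
    unfolding p_def q_def by measurable
  have r: "AE \<omega> in M. 0 \<le> (t - s) * \<Theta> \<omega>" using \<Theta>_pos by eventually_elim (use st in auto)
  have q_bound: "AE \<omega> in M. \<forall>k. \<bar>q k \<omega>\<bar> \<le> 1"
    using r by eventually_elim (auto simp: q_def indicator_def poisson_density_nonneg poisson_density_le_1)
  have eq: "(\<integral>\<omega>. p k \<omega> \<partial>M) = (\<integral>\<omega>. q k \<omega> \<partial>M)"
  proof (rule powser_coefficient_unique)
    fix z :: real assume z: "\<bar>z\<bar> < 1"
    have "(\<lambda>k. (\<integral>\<omega>. p k \<omega> \<partial>M) * z ^ k) sums (\<integral>\<omega>. (\<Sum>k. p k \<omega> * z ^ k) \<partial>M)"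
      by (intro sums_integral_power z) (auto simp: p_def indicator_def)
    also have "(\<integral>\<omega>. (\<Sum>k. p k \<omega> * z ^ k) \<partial>M) = (\<integral>\<omega>. indicator E \<omega> * z ^ (N t \<omega> - N s \<omega>) \<partial>M)"
    proof (rule Bochner_Integration.integral_cong[OF refl])
      fix \<omega> assume \<omega>: "\<omega> \<in> space M"
      have "(\<Sum>k. p k \<omega> * z ^ k) = (\<Sum>k\<in>{N t \<omega> - N s \<omega>}. p k \<omega> * z ^ k)"
        by (rule suminf_finite) (auto simp: p_def indicator_def)
      then show "(\<Sum>k. p k \<omega> * z ^ k) = indicator E \<omega> * z ^ (N t \<omega> - N s \<omega>)"
        using \<omega> by (simp add: p_def indicator_def)
    qed
    finally show "(\<lambda>k. (\<integral>\<omega>. p k \<omega> \<partial>M) * z ^ k) sums (\<integral>\<omega>. indicator E \<omega> * z ^ (N t \<omega> - N s \<omega>) \<partial>M)" .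
    have "(\<lambda>k. (\<integral>\<omega>. q k \<omega> \<partial>M) * z ^ k) sums (\<integral>\<omega>. (\<Sum>k. q k \<omega> * z ^ k) \<partial>M)"
      by (intro sums_integral_power z q_bound) auto
    also have "(\<integral>\<omega>. (\<Sum>k. q k \<omega> * z ^ k) \<partial>M) = (\<integral>\<omega>. indicator E \<omega> * exp (- (1 - z) * ((t - s) * \<Theta> \<omega>)) \<partial>M)"
    proof (rule Bochner_Integration.integral_cong[OF refl])
      fix \<omega>
      have "(\<lambda>k. indicator E \<omega> * (poisson_density ((t - s) * \<Theta> \<omega>) k * z ^ k)) sums
          (indicator E \<omega> * exp (- (1 - z) * ((t - s) * \<Theta> \<omega>)))"
        by (intro sums_mult poisson_density_generating_function)
      then show "(\<Sum>k. q k \<omega> * z ^ k) = indicator E \<omega> * exp (- (1 - z) * ((t - s) * \<Theta> \<omega>))"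
        by (simp add: q_def mult.assoc sums_iff)
    qed
    also have "\<dots> = (\<integral>\<omega>. indicator E \<omega> * z ^ (N t \<omega> - N s \<omega>) \<partial>M)"
      using st z by (intro generating_function[OF comp _ _ E, symmetric]) auto
    finally show "(\<lambda>k. (\<integral>\<omega>. q k \<omega> \<partial>M) * z ^ k) sums (\<integral>\<omega>. indicator E \<omega> * z ^ (N t \<omega> - N s \<omega>) \<partial>M)" .
  qed
  have "emeasure M (E \<inter> ?D k) = ennreal (\<integral>\<omega>. p k \<omega> \<partial>M)"
  proof -
    have "(\<integral>\<omega>. p k \<omega> \<partial>M) = prob (E \<inter> ?D k \<inter> space M)"
      unfolding p_def[abs_def] by (rule Bochner_Integration.integral_indicator)
    moreover have "E \<inter> ?D k \<inter> space M = E \<inter> ?D k" by auto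
    ultimately show ?thesis by (simp add: emeasure_eq_measure)
  qed
  also have "\<dots> = (\<integral>\<^sup>+\<omega>. ennreal (q k \<omega>) \<partial>M)"
    unfolding eq
  proof (rule nn_integral_eq_integral[symmetric])
    show "integrable M (q k)"
      using q_bound by (intro integrable_const_bound[where B=1]) (auto elim: eventually_mono)
    show "AE \<omega> in M. 0 \<le> q k \<omega>" using r by eventually_elim (auto simp: q_def poisson_density_nonneg)
  qed
  also have "\<dots> = (\<integral>\<^sup>+\<omega>\<in>E. poisson_density ((t - s) * \<Theta> \<omega>) k \<partial>M)"
    by (intro nn_integral_cong) (auto simp: q_def indicator_def)
  finally show "emeasure M (E \<inter> ?D k) = (\<integral>\<^sup>+\<omega>\<in>E. poisson_density ((t - s) * \<Theta> \<omega>) k \<partial>M)" .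
qed

end

section \<open>From conditionally Poisson increments to mixed Poisson processes\<close>

text \<open>As an explicit series it is visibly measurable in the rate and also covers rate 0;
  \<open>measure_poisson_pmf\<close> connects it with the distribution itself.\<close>

definition poisson_prob :: "real \<Rightarrow> nat set \<Rightarrow> real" where
  "poisson_prob r B = (\<Sum>k. poisson_density r k * indicator B k)"

text \<open>Convergence holds for negative rates too: the absolute values of the weights are those
  of rate \<open>\<bar>r\<bar>\<close>, rescaled by
  \<open>exp \<bar>r\<bar> * exp (- r)\<close>.\<close>

lemma poisson_prob_sums: "(\<lambda>k. poisson_density r k * indicator B k) sums poisson_prob r B"
proof -
  have "summable (\<lambda>k. poisson_density \<bar>r\<bar> k)"
    using poisson_density_generating_function[of "\<bar>r\<bar>" 1] by (simp add: sums_iff)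
  then have "summable (\<lambda>k. poisson_density \<bar>r\<bar> k * (exp \<bar>r\<bar> * exp (- r)))" by (rule summable_mult2)
  moreover have "poisson_density \<bar>r\<bar> k * (exp \<bar>r\<bar> * exp (- r)) = norm (poisson_density r k)" for k
  proof -
    have "exp (- \<bar>r\<bar>) * (exp \<bar>r\<bar> * exp (- r)) = exp (- r)" by (simp add: exp_add[symmetric])
    then show ?thesis by (simp add: poisson_density_def abs_mult power_abs)
  qed
  ultimately have "summable (\<lambda>k. norm (poisson_density r k))" by simp
  then have "summable (\<lambda>k. poisson_density r k * indicator B k)"
    by (rule summable_comparison_test'[where N=0]) (auto simp: indicator_def)
  then show ?thesis unfolding poisson_prob_def by (rule summable_sums)
qed

lemma poisson_prob_nonneg: "0 \<le> r \<Longrightarrow> 0 \<le> poisson_prob r B"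
  using poisson_prob_sums[of r B] unfolding sums_iff
  by (auto intro!: suminf_nonneg simp: poisson_prob_def poisson_density_nonneg)

lemma poisson_prob_UNIV: "poisson_prob r UNIV = 1"
  using poisson_density_generating_function[of r 1] by (simp add: poisson_prob_def sums_iff)

lemma poisson_prob_le_1:
  assumes "0 \<le> r" shows "poisson_prob r B \<le> 1"
proof -
  have "poisson_prob r B \<le> poisson_prob r UNIV"
    using poisson_prob_sums assms
    by (intro sums_le[OF _ poisson_prob_sums poisson_prob_sums]) (auto simp: indicator_def poisson_density_nonneg)
  then show ?thesis by (simp add: poisson_prob_UNIV)
qed

lemma ennreal_poisson_prob:
  assumes "0 \<le> r"
  shows "ennreal (poisson_prob r B) = (\<Sum>k. ennreal (poisson_density r k) * indicator B k)"
proof -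
  have "(\<lambda>k. ennreal (poisson_density r k * indicator B k)) sums ennreal (poisson_prob r B)"
    using poisson_prob_sums[of r B] assms poisson_prob_nonneg[OF assms]
    by (subst sums_ennreal) (auto simp: poisson_density_nonneg)
  moreover have "ennreal (poisson_density r k * indicator B k) = ennreal (poisson_density r k) * indicator B k" for k
    by (simp add: indicator_def)
  ultimately show ?thesis by (simp add: sums_iff)
qed

lemma measurable_poisson_prob [measurable (raw)]:
  assumes [measurable]: "f \<in> borel_measurable M"
  shows "(\<lambda>x. poisson_prob (f x) B) \<in> borel_measurable M"
  unfolding poisson_prob_def by measurable

lemma measure_poisson_pmf:
  assumes "0 < r"
  shows "measure (measure_pmf (poisson_pmf r)) B = poisson_prob r B"
proof -
  have "emeasure (measure_pmf (poisson_pmf r)) B = (\<integral>\<^sup>+k. indicator B k \<partial>measure_pmf (poisson_pmf r))" by simp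
  also have "\<dots> = (\<Sum>k. ennreal (pmf (poisson_pmf r) k) * indicator B k)"
    by (simp only: nn_integral_measure_pmf nn_integral_count_space_nat)
  also have "\<dots> = ennreal (poisson_prob r B)"
    using assms by (subst ennreal_poisson_prob) (auto simp: poisson_density_def)
  finally show ?thesis using assms by (simp add: measure_pmf.emeasure_eq_measure poisson_prob_nonneg)
qed

section \<open>Conditional probabilities given \<Theta> and the clauses of the mixed Poisson
  property\<close>

context risk_model
begin

text \<open>The exit from integrated identities to almost sure statements: a function of \<Theta>
  with the right integrals over all events of \<Theta> is a version of the conditional
  probability.\<close>

lemma cond_prob_charact:
  assumes F: "F \<in> events" and g: "g \<in> borel_measurable borel" and g_bound: "AE \<omega> in M. 0 \<le> g (\<Theta> \<omega>) \<and> g (\<Theta> \<omega>) \<le> 1"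
    and eq: "\<And>C. C \<in> sets borel \<Longrightarrow>
      emeasure M (F \<inter> (\<Theta> -` C \<inter> space M)) = (\<integral>\<^sup>+\<omega>\<in>\<Theta> -` C \<inter> space M. ennreal (g (\<Theta> \<omega>)) \<partial>M)"
  shows "AE \<omega> in M. cond_prob_given M sigma_\<Theta> F \<omega> = g (\<Theta> \<omega>)"
  unfolding cond_prob_given_def
proof -
  interpret Z: finite_measure_subalgebra M sigma_\<Theta> by unfold_locales (rule subalgebra_\<Theta>)
  have [measurable]: "F \<in> events" "g \<in> borel_measurable borel" by fact+
  have g_int: "integrable M (\<lambda>\<omega>. g (\<Theta> \<omega>))"
    using g_bound by (intro integrable_const_bound[where B=1]) (auto elim: eventually_mono)
  have F_int: "integrable M (indicator F :: 'a \<Rightarrow> real)" using F by (simp add: less_top[symmetric])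
  show "AE \<omega> in M. real_cond_exp M sigma_\<Theta> (indicator F) \<omega> = g (\<Theta> \<omega>)"
  proof (rule Z.real_cond_exp_charact[OF _ F_int g_int])
    show "(\<lambda>\<omega>. g (\<Theta> \<omega>)) \<in> borel_measurable sigma_\<Theta>"
      by (rule measurable_compose[OF measurable_vimage_algebra1 g]) auto
    fix b assume "b \<in> sets sigma_\<Theta>"
    then obtain C where C: "C \<in> sets borel" "b = \<Theta> -` C \<inter> space M" by (auto simp: sets_vimage_algebra2)
    then have [measurable]: "b \<in> events" by simp
    have "ennreal (set_lebesgue_integral M b (indicator F)) = (\<integral>\<^sup>+\<omega>\<in>b. ennreal (indicator F \<omega>) \<partial>M)"
      by (intro set_nn_integral_eq_set_integral(1)[symmetric] F_int) auto
    also have "\<dots> = (\<integral>\<^sup>+\<omega>. indicator (F \<inter> b) \<omega> \<partial>M)" by (intro nn_integral_cong) (auto simp: indicator_def)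
    also have "\<dots> = emeasure M (F \<inter> b)" by (rule nn_integral_indicator) measurable
    also have "\<dots> = (\<integral>\<^sup>+\<omega>\<in>b. ennreal (g (\<Theta> \<omega>)) \<partial>M)" using eq[OF C(1)] C by simp
    also have "\<dots> = ennreal (set_lebesgue_integral M b (\<lambda>\<omega>. g (\<Theta> \<omega>)))"
      using g_bound by (intro set_nn_integral_eq_set_integral(1) g_int) (auto elim: eventually_mono)
    finally show "set_lebesgue_integral M b (indicator F) = set_lebesgue_integral M b (\<lambda>\<omega>. g (\<Theta> \<omega>))"
    proof (rule ennreal_inj[THEN iffD1, rotated 2])
      show "0 \<le> set_lebesgue_integral M b (indicator F :: 'a \<Rightarrow> real)"
        by (intro set_nn_integral_eq_set_integral(2) F_int) auto
      show "0 \<le> set_lebesgue_integral M b (\<lambda>\<omega>. g (\<Theta> \<omega>))"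
        using g_bound by (intro set_nn_integral_eq_set_integral(2) g_int) (auto elim: eventually_mono)
    qed
  qed
qed

lemma AE_rate_nonneg: "s \<le> t \<Longrightarrow> AE \<omega> in M. 0 \<le> (t - s) * \<Theta> \<omega>"
  using \<Theta>_pos by (auto elim: eventually_mono)

text \<open>Summation over \<open>k\<close> passes from single values to sets, and uniqueness of
  restrictions from events of the past to past-measurable weights.\<close>

lemma poisson_increments_test_function:
  assumes pois: "poisson_increments" and st: "0 \<le> s" "s \<le> t" and u: "u \<in> borel_measurable (filt_N s)"
  shows "(\<integral>\<^sup>+\<omega>. u \<omega> * indicator {\<omega>\<in>space M. N t \<omega> - N s \<omega> \<in> B} \<omega> \<partial>M) =
    (\<integral>\<^sup>+\<omega>. u \<omega> * ennreal (poisson_prob ((t - s) * \<Theta> \<omega>) B) \<partial>M)"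
proof (rule nn_integral_test_function[OF subalgebra_filt_N _ _ _ u])
  let ?D = "\<lambda>B. {\<omega>\<in>space M. N t \<omega> - N s \<omega> \<in> B}"
  have Dset [measurable]: "?D B \<in> events" for B using increment_set[of s t B] st by simp
  let ?D1 = "\<lambda>k. {\<omega>\<in>space M. N t \<omega> - N s \<omega> = k}"
  have D1set [measurable]: "?D1 k \<in> events" for k using Dset[of "{k}"] by simp
  show "(\<lambda>\<omega>. indicator (?D B) \<omega>) \<in> borel_measurable M" by measurable
  show "(\<lambda>\<omega>. ennreal (poisson_prob ((t - s) * \<Theta> \<omega>) B)) \<in> borel_measurable M" by measurable
  fix E assume E: "E \<in> sets (filt_N s)"
  have EM [measurable]: "E \<in> events" using E subalgebra_filt_N by (auto simp: subalgebra_def)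
  have "(\<integral>\<^sup>+\<omega>\<in>E. indicator (?D B) \<omega> \<partial>M) = (\<integral>\<^sup>+\<omega>. (\<Sum>k. indicator B k * indicator (E \<inter> ?D1 k) \<omega>) \<partial>M)"
  proof (rule nn_integral_cong)
    fix \<omega> assume \<omega>: "\<omega> \<in> space M"
    have "(\<Sum>k. indicator B k * indicator (E \<inter> ?D1 k) \<omega> :: ennreal) =
        (\<Sum>k\<in>{N t \<omega> - N s \<omega>}. indicator B k * indicator (E \<inter> ?D1 k) \<omega>)"
      by (rule suminf_finite) (auto simp: indicator_def)
    then show "indicator (?D B) \<omega> * indicator E \<omega> = (\<Sum>k. indicator B k * indicator (E \<inter> ?D1 k) \<omega> :: ennreal)"
      using \<omega> by (simp add: indicator_def)
  qed
  also have "\<dots> = (\<Sum>k. indicator B k * emeasure M (E \<inter> ?D1 k))"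
    by (subst nn_integral_suminf) (auto simp: nn_integral_cmult_indicator)
  also have "\<dots> = (\<Sum>k. indicator B k * (\<integral>\<^sup>+\<omega>\<in>E. poisson_density ((t - s) * \<Theta> \<omega>) k \<partial>M))"
    using pois st E unfolding poisson_increments_def by simp
  also have "\<dots> = (\<integral>\<^sup>+\<omega>. (\<Sum>k. indicator B k * (ennreal (poisson_density ((t - s) * \<Theta> \<omega>) k) * indicator E \<omega>)) \<partial>M)"
    by (subst nn_integral_suminf) (auto simp: nn_integral_cmult)
  also have "\<dots> = (\<integral>\<^sup>+\<omega>\<in>E. ennreal (poisson_prob ((t - s) * \<Theta> \<omega>) B) \<partial>M)"
  proof (rule nn_integral_cong_AE)
    show "AE \<omega> in M. (\<Sum>k. indicator B k * (ennreal (poisson_density ((t - s) * \<Theta> \<omega>) k) * indicator E \<omega>)) =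
        ennreal (poisson_prob ((t - s) * \<Theta> \<omega>) B) * indicator E \<omega>"
      using AE_rate_nonneg[OF st(2)]
      by eventually_elim (auto simp: ennreal_poisson_prob indicator_def mult.commute)
  qed
  finally show "(\<integral>\<^sup>+\<omega>\<in>E. indicator (?D B) \<omega> \<partial>M) = (\<integral>\<^sup>+\<omega>\<in>E. ennreal (poisson_prob ((t - s) * \<Theta> \<omega>) B) \<partial>M)" .
qed

text \<open>The latest increment is integrated out first: all others and \<Theta> belong to the past
  at its left end. The factor it leaves depends on \<Theta> alone and is absorbed into
  \<open>\<phi>\<close>, which is why \<open>\<phi>\<close> is arbitrary in the induction.\<close>

lemma poisson_increments_product:
  fixes t :: "nat \<Rightarrow> real"
  assumes pois: "poisson_increments" and t0: "t 0 = 0" and t: "strict_mono_on {0..m} t" and h: "0 \<le> h"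
    and J: "finite J" "J \<subseteq> {1..m}" and \<phi>: "\<phi> \<in> borel_measurable borel"
  shows "(\<integral>\<^sup>+\<omega>. \<phi> (\<Theta> \<omega>) * (\<Prod>j\<in>J. indicator {\<omega>\<in>space M. N (t j + h) \<omega> - N (t (j - 1) + h) \<omega> \<in> B j} \<omega>) \<partial>M) =
    (\<integral>\<^sup>+\<omega>. \<phi> (\<Theta> \<omega>) * (\<Prod>j\<in>J. ennreal (poisson_prob ((t j - t (j - 1)) * \<Theta> \<omega>) (B j))) \<partial>M)"
  using J \<phi>
proof (induction J arbitrary: \<phi> rule: finite_linorder_max_induct)
  case empty
  then show ?case by simp
next
  case (insert b A)
  have mono: "t i \<le> t j" if "i \<le> j" "j \<le> m" for i j
    using strict_mono_onD[OF t, of i j] that by (cases "i = j") auto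
  have pos: "0 \<le> t i" if "i \<le> m" for i using mono[of 0 i] that t0 by simp
  have b: "1 \<le> b" "b \<le> m" and A: "A \<subseteq> {1..m}" and bA: "b \<notin> A" using insert.prems insert.hyps by auto
  let ?D = "\<lambda>j. {\<omega>\<in>space M. N (t j + h) \<omega> - N (t (j - 1) + h) \<omega> \<in> B j}"
  let ?q = "\<lambda>j x. ennreal (poisson_prob ((t j - t (j - 1)) * x) (B j))"
  \<comment> \<open>The left end of the latest shifted increment; every earlier increment in
    \<open>A\<close> ends by then, even if some indices are skipped.\<close>
  define s where "s = t (b - 1) + h"
  have s: "0 \<le> s" "s \<le> t b + h" using pos[of "b - 1"] mono[of "b - 1" b] h b by (auto simp: s_def)
  have D_filt: "?D j \<in> sets (filt_N s)" if j: "j \<in> A" for j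
  proof -
    have j': "1 \<le> j" "j < b" "j \<le> m" using j insert.hyps A b by auto
    have "(\<lambda>\<omega>. real (N u \<omega>)) \<in> borel_measurable (filt_N s)" if "0 \<le> u" "u \<le> s" for u
      by (rule measurable_enlarged_process[where Y="\<lambda>t \<omega>. real (N t \<omega>)"]) (use that in auto)
    then have meas: "N u \<in> measurable (filt_N s) (count_space UNIV)" if "0 \<le> u" "u \<le> s" for u
      using that by (intro measurable_count_space_real)
    have [measurable]: "N (t j + h) \<in> measurable (filt_N s) (count_space UNIV)"
      using pos[of j] mono[of j "b - 1"] j' b h by (intro meas) (auto simp: s_def)
    have [measurable]: "N (t (j - 1) + h) \<in> measurable (filt_N s) (count_space UNIV)"
      using pos[of "j - 1"] mono[of "j - 1" "b - 1"] j' b h by (intro meas) (auto simp: s_def)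
    have "(\<lambda>\<omega>. N (t j + h) \<omega> - N (t (j - 1) + h) \<omega>) \<in> measurable (filt_N s) (count_space UNIV)" by measurable
    from measurable_sets[OF this, of "B j"] show ?thesis
      by (simp add: vimage_def Int_def conj_commute)
  qed
  have [measurable]: "\<phi> \<in> borel_measurable borel" by (rule insert.prems)
  have u: "(\<lambda>\<omega>. \<phi> (\<Theta> \<omega>) * (\<Prod>j\<in>A. indicator (?D j) \<omega>)) \<in> borel_measurable (filt_N s)"
  proof (intro borel_measurable_times_ennreal borel_measurable_prod_ennreal borel_measurable_indicator D_filt)
    show "(\<lambda>\<omega>. \<phi> (\<Theta> \<omega>)) \<in> borel_measurable (filt_N s)"
      by (rule measurable_compose[OF measurable_enlarged_parameter]) measurable
  qed
  have "(\<integral>\<^sup>+\<omega>. \<phi> (\<Theta> \<omega>) * (\<Prod>j\<in>insert b A. indicator (?D j) \<omega>) \<partial>M) =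
      (\<integral>\<^sup>+\<omega>. (\<phi> (\<Theta> \<omega>) * (\<Prod>j\<in>A. indicator (?D j) \<omega>)) * indicator {\<omega>\<in>space M. N (t b + h) \<omega> - N s \<omega> \<in> B b} \<omega> \<partial>M)"
    using insert.hyps(1) bA by (simp add: s_def mult_ac)
  also have "\<dots> = (\<integral>\<^sup>+\<omega>. (\<phi> (\<Theta> \<omega>) * (\<Prod>j\<in>A. indicator (?D j) \<omega>)) * ennreal (poisson_prob ((t b + h - s) * \<Theta> \<omega>) (B b)) \<partial>M)"
    by (rule poisson_increments_test_function[OF pois s u])
  also have "\<dots> = (\<integral>\<^sup>+\<omega>. (\<phi> (\<Theta> \<omega>) * ?q b (\<Theta> \<omega>)) * (\<Prod>j\<in>A. indicator (?D j) \<omega>) \<partial>M)"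
    by (simp add: s_def mult_ac)
  also have "\<dots> = (\<integral>\<^sup>+\<omega>. (\<phi> (\<Theta> \<omega>) * ?q b (\<Theta> \<omega>)) * (\<Prod>j\<in>A. ?q j (\<Theta> \<omega>)) \<partial>M)"
    using insert.IH[OF A, of "\<lambda>x. \<phi> x * ?q b x"] by simp
  also have "\<dots> = (\<integral>\<^sup>+\<omega>. \<phi> (\<Theta> \<omega>) * (\<Prod>j\<in>insert b A. ?q j (\<Theta> \<omega>)) \<partial>M)"
    using insert.hyps(1) bA by (simp add: mult_ac)
  finally show ?case .
qed

text \<open>The two freedoms serve different clauses: the product over an arbitrary \<open>J\<close>
  gives conditional independence, and the absence of \<open>h\<close> on the right gives
  stationarity.\<close>

lemma poisson_increments_emeasure:
  fixes t :: "nat \<Rightarrow> real"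
  assumes pois: "poisson_increments" and t: "t 0 = 0" "strict_mono_on {0..m} t" and h: "0 \<le> h"
    and J: "J \<subseteq> {1..m}" and C: "C \<in> sets borel"
  shows "emeasure M ({\<omega>\<in>space M. \<forall>j\<in>J. N (t j + h) \<omega> - N (t (j - 1) + h) \<omega> \<in> B j} \<inter> (\<Theta> -` C \<inter> space M)) =
    (\<integral>\<^sup>+\<omega>\<in>\<Theta> -` C \<inter> space M. ennreal (\<Prod>j\<in>J. poisson_prob ((t j - t (j - 1)) * \<Theta> \<omega>) (B j)) \<partial>M)"
    and "{\<omega>\<in>space M. \<forall>j\<in>J. N (t j + h) \<omega> - N (t (j - 1) + h) \<omega> \<in> B j} \<in> events" (is "?F \<in> _")
    and "AE \<omega> in M. 0 \<le> (\<Prod>j\<in>J. poisson_prob ((t j - t (j - 1)) * \<Theta> \<omega>) (B j)) \<and>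
      (\<Prod>j\<in>J. poisson_prob ((t j - t (j - 1)) * \<Theta> \<omega>) (B j)) \<le> 1"
proof -
  let ?D = "\<lambda>j. {\<omega>\<in>space M. N (t j + h) \<omega> - N (t (j - 1) + h) \<omega> \<in> B j}"
  have fin: "finite J" using J finite_subset by auto
  have mono: "t i \<le> t j" if "i \<le> j" "j \<le> m" for i j
    using strict_mono_onD[OF t(2), of i j] that by (cases "i = j") auto
  have pos: "0 \<le> t i" if "i \<le> m" for i using mono[of 0 i] that t(1) by simp
  have D: "?D j \<in> events" if "j \<in> J" for j
    using subsetD[OF J that] h by (intro increment_set add_nonneg_nonneg pos) auto
  have F_eq: "?F = space M \<inter> (\<Inter>j\<in>J. ?D j)" by auto
  show F: "?F \<in> events"
  proof (cases "J = {}")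
    case True then show ?thesis by simp
  next
    case False
    then show ?thesis unfolding F_eq using D fin by (intro sets.Int sets.finite_INT) auto
  qed
  have rate: "AE \<omega> in M. \<forall>j\<in>J. 0 \<le> (t j - t (j - 1)) * \<Theta> \<omega>"
    using J mono by (intro AE_finite_allI[OF fin] AE_rate_nonneg) auto
  show "AE \<omega> in M. 0 \<le> (\<Prod>j\<in>J. poisson_prob ((t j - t (j - 1)) * \<Theta> \<omega>) (B j)) \<and>
      (\<Prod>j\<in>J. poisson_prob ((t j - t (j - 1)) * \<Theta> \<omega>) (B j)) \<le> 1"
    using rate by eventually_elim (auto intro!: prod_nonneg prod_le_1 simp: poisson_prob_nonneg poisson_prob_le_1)
  let ?b = "\<Theta> -` C \<inter> space M"
  have [measurable]: "?b \<in> events" using C by measurable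
  have "emeasure M (?F \<inter> ?b) = (\<integral>\<^sup>+\<omega>. indicator (?F \<inter> ?b) \<omega> \<partial>M)" using F by simp
  also have "\<dots> = (\<integral>\<^sup>+\<omega>. indicator C (\<Theta> \<omega>) * (\<Prod>j\<in>J. indicator (?D j) \<omega>) \<partial>M)"
  proof (rule nn_integral_cong)
    fix \<omega> assume \<omega>: "\<omega> \<in> space M"
    have "(\<Prod>j\<in>J. indicator (?D j) \<omega> :: ennreal) = indicator ?F \<omega>"
    proof (cases "\<omega> \<in> ?F")
      case True then show ?thesis by (auto intro!: prod.neutral)
    next
      case False
      then obtain j where "j \<in> J" "\<omega> \<notin> ?D j" using \<omega> by auto
      then show ?thesis using fin False by (auto intro!: prod_zero bexI[of _ j] simp: indicator_def)
    qed
    then show "indicator (?F \<inter> ?b) \<omega> = (indicator C (\<Theta> \<omega>) * (\<Prod>j\<in>J. indicator (?D j) \<omega>) :: ennreal)"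
      using \<omega> by (simp add: indicator_def)
  qed
  also have "\<dots> = (\<integral>\<^sup>+\<omega>. indicator C (\<Theta> \<omega>) * (\<Prod>j\<in>J. ennreal (poisson_prob ((t j - t (j - 1)) * \<Theta> \<omega>) (B j))) \<partial>M)"
    by (rule poisson_increments_product[OF pois t h fin J borel_measurable_indicator[OF C]])
  also have "\<dots> = (\<integral>\<^sup>+\<omega>\<in>?b. ennreal (\<Prod>j\<in>J. poisson_prob ((t j - t (j - 1)) * \<Theta> \<omega>) (B j)) \<partial>M)"
  proof (rule nn_integral_cong_AE)
    show "AE \<omega> in M. indicator C (\<Theta> \<omega>) * (\<Prod>j\<in>J. ennreal (poisson_prob ((t j - t (j - 1)) * \<Theta> \<omega>) (B j))) =
        ennreal (\<Prod>j\<in>J. poisson_prob ((t j - t (j - 1)) * \<Theta> \<omega>) (B j)) * indicator ?b \<omega>"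
      using rate AE_space
      by eventually_elim (auto simp: indicator_def intro!: prod_ennreal poisson_prob_nonneg)
  qed
  finally show "emeasure M (?F \<inter> ?b) = (\<integral>\<^sup>+\<omega>\<in>?b. ennreal (\<Prod>j\<in>J. poisson_prob ((t j - t (j - 1)) * \<Theta> \<omega>) (B j)) \<partial>M)" .
qed

lemma poisson_increments_cond_prob:
  fixes t :: "nat \<Rightarrow> real"
  assumes pois: "poisson_increments" and t: "t 0 = 0" "strict_mono_on {0..m} t" and h: "0 \<le> h" and J: "J \<subseteq> {1..m}"
  shows "AE \<omega> in M. cond_prob_given M sigma_\<Theta>
      {\<omega>\<in>space M. \<forall>j\<in>J. N (t j + h) \<omega> - N (t (j - 1) + h) \<omega> \<in> B j} \<omega> =
    (\<Prod>j\<in>J. poisson_prob ((t j - t (j - 1)) * \<Theta> \<omega>) (B j))"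
proof -
  note * = poisson_increments_emeasure[OF pois t h J]
  show ?thesis
    by (rule cond_prob_charact[where g="\<lambda>x. \<Prod>j\<in>J. poisson_prob ((t j - t (j - 1)) * x) (B j)"])
      (use *(2) *(3)[where B=B] *(1) in auto)
qed

lemma increment_eq_nat:
  assumes "\<omega> \<in> space M" "0 \<le> s" "s \<le> t"
  shows "increment N s t \<omega> = real (N t \<omega> - N s \<omega>)"
  using counting_mono[OF counting assms] by (simp add: increment_def)

lemma poisson_increments_imp_mixed_poisson:
  assumes pois: "poisson_increments"
  shows "mixed_poisson_process M N \<Theta>"
  unfolding mixed_poisson_process_def
proof (intro conjI allI impI)
  show "counting_process M N" by (rule counting)
next
  show "cond_indep_increments M N \<Theta>"
    unfolding cond_indep_increments_def
  proof (intro allI impI)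
    fix m :: nat and t :: "nat \<Rightarrow> real"
    assume "t 0 = 0 \<and> strict_mono_on {0..m} t"
    then have t: "t 0 = 0" "strict_mono_on {0..m} t" by auto
    have mono: "t i \<le> t j" if "i \<le> j" "j \<le> m" for i j
      using strict_mono_onD[OF t(2), of i j] that by (cases "i = j") auto
    have pos: "0 \<le> t i" if "i \<le> m" for i using mono[of 0 i] that t(1) by simp
    let ?V = "\<lambda>j. sets (vimage_algebra (space M) (increment N (t (j - 1)) (t j)) borel)"
    \<comment> \<open>Increments take natural values, so every event generated by one of them is
      described by a set of naturals, although the \<sigma>-algebra is over
      \<open>borel\<close>.\<close>
    have V: "\<exists>B. A = {\<omega>\<in>space M. N (t j) \<omega> - N (t (j - 1)) \<omega> \<in> B}" if "j \<in> {1..m}" and A: "A \<in> ?V j" for j A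
    proof -
      obtain C where C: "A = increment N (t (j - 1)) (t j) -` C \<inter> space M"
        using A by (auto simp: sets_vimage_algebra2)
      have "A = {\<omega>\<in>space M. N (t j) \<omega> - N (t (j - 1)) \<omega> \<in> {k. real k \<in> C}}"
        unfolding C using that pos[of "j - 1"] mono[of "j - 1" j] by (auto simp: increment_eq_nat)
      then show ?thesis by blast
    qed
    show "cond_indep_sets M sigma_\<Theta> ?V {1..m}"
      unfolding cond_indep_sets_def
    proof (intro conjI ballI allI impI)
      fix j assume j: "j \<in> {1..m}"
      show "?V j \<subseteq> events"
      proof
        fix A assume "A \<in> ?V j"
        from V[OF j this] obtain B where B: "A = {\<omega>\<in>space M. N (t j) \<omega> - N (t (j - 1)) \<omega> \<in> B}" by (rule exE)
        show "A \<in> events" unfolding B using j pos[of j] pos[of "j - 1"] by (intro increment_set) auto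
      qed
    next
      fix J A assume J: "J \<subseteq> {1..m}" "J \<noteq> {}" "finite J" and A: "A \<in> Pi J ?V"
      have "\<forall>j\<in>J. \<exists>B. A j = {\<omega>\<in>space M. N (t j) \<omega> - N (t (j - 1)) \<omega> \<in> B}"
      proof
        fix j assume j: "j \<in> J"
        show "\<exists>B. A j = {\<omega>\<in>space M. N (t j) \<omega> - N (t (j - 1)) \<omega> \<in> B}"
          by (rule V) (use j J A in \<open>auto dest: Pi_mem\<close>)
      qed
      then obtain B where B: "\<And>j. j \<in> J \<Longrightarrow> A j = {\<omega>\<in>space M. N (t j) \<omega> - N (t (j - 1)) \<omega> \<in> B j}" by metis
      note cp = poisson_increments_cond_prob[OF pois t order_refl, where B=B]
      have single: "AE \<omega> in M. \<forall>j\<in>J. cond_prob_given M sigma_\<Theta> (A j) \<omega> = poisson_prob ((t j - t (j - 1)) * \<Theta> \<omega>) (B j)"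
      proof (intro AE_finite_allI[OF J(3)])
        fix j assume j: "j \<in> J"
        show "AE \<omega> in M. cond_prob_given M sigma_\<Theta> (A j) \<omega> = poisson_prob ((t j - t (j - 1)) * \<Theta> \<omega>) (B j)"
          using cp[of "{j}"] subsetD[OF J(1) j] B[OF j] by simp
      qed
      have "(\<Inter>j\<in>J. A j) = {\<omega>\<in>space M. \<forall>j\<in>J. N (t j) \<omega> - N (t (j - 1)) \<omega> \<in> B j}" using B J(2) by auto
      then have "AE \<omega> in M. cond_prob_given M sigma_\<Theta> (\<Inter>j\<in>J. A j) \<omega> = (\<Prod>j\<in>J. poisson_prob ((t j - t (j - 1)) * \<Theta> \<omega>) (B j))"
        using cp[OF J(1)] by simp
      then show "AE \<omega> in M. cond_prob_given M sigma_\<Theta> (\<Inter>j\<in>J. A j) \<omega> = (\<Prod>j\<in>J. cond_prob_given M sigma_\<Theta> (A j) \<omega>)"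
        using single by eventually_elim auto
    qed
  qed
next
  show "cond_stationary_increments M N \<Theta>"
    unfolding cond_stationary_increments_def
  proof (intro allI impI ballI)
    fix m :: nat and t :: "nat \<Rightarrow> real" and h :: real and B
    assume h: "0 \<le> h" and "t 0 = 0 \<and> strict_mono_on {0..m} t" and B: "B \<in> sets (PiM {1..m} (\<lambda>_. borel :: real measure))"
    then have t: "t 0 = 0" "strict_mono_on {0..m} t" by auto
    have mono: "t i \<le> t j" if "i \<le> j" "j \<le> m" for i j
      using strict_mono_onD[OF t(2), of i j] that by (cases "i = j") auto
    have pos: "0 \<le> t i" if "i \<le> m" for i using mono[of 0 i] that t(1) by simp
    define vec where "vec h \<omega> = (\<lambda>j\<in>{1..m}. increment N (t (j - 1) + h) (t j + h) \<omega>)" for h \<omega>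
    have vec_meas: "vec h \<in> measurable M (PiM {1..m} (\<lambda>_. borel))" if "0 \<le> h" for h
      unfolding vec_def
    proof (rule measurable_restrict)
      fix j assume j: "j \<in> {1..m}"
      show "increment N (t (j - 1) + h) (t j + h) \<in> borel_measurable M"
        unfolding increment_def[abs_def] using j that pos[of j] pos[of "j - 1"]
        by (intro borel_measurable_diff real_N_meas) auto
    qed
    \<comment> \<open>The definition of stationarity quantifies over all measurable sets of vectors,
      while the product formula covers rectangles only; uniqueness of finite measures on the product
      space closes the gap.\<close>
    have law: "emeasure M ({\<omega>\<in>space M. vec h \<omega> \<in> B} \<inter> (\<Theta> -` C \<inter> space M)) =
        emeasure M ({\<omega>\<in>space M. vec 0 \<omega> \<in> B} \<inter> (\<Theta> -` C \<inter> space M))" if C: "C \<in> sets borel" for C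
    proof -
      let ?b = "\<Theta> -` C \<inter> space M"
      have [measurable]: "?b \<in> events" using C by measurable
      \<comment> \<open>The law of the shifted increments, with mass restricted to one event of
        \<Theta>.\<close>
      define \<nu> where "\<nu> h = distr (density M (indicator ?b)) (PiM {1..m} (\<lambda>_. borel)) (vec h)" for h
      have \<nu>: "emeasure (\<nu> h) B = emeasure M ({\<omega>\<in>space M. vec h \<omega> \<in> B} \<inter> ?b)"
        if "0 \<le> h" and B: "B \<in> sets (PiM {1..m} (\<lambda>_. borel))" for h B
      proof -
        have "emeasure (\<nu> h) B = emeasure (density M (indicator ?b)) (vec h -` B \<inter> space M)"
          unfolding \<nu>_def using vec_meas[OF that(1)] B by (subst emeasure_distr) auto
        also have "\<dots> = (\<integral>\<^sup>+\<omega>. indicator ?b \<omega> * indicator (vec h -` B \<inter> space M) \<omega> \<partial>M)"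
          using measurable_sets[OF vec_meas[OF that(1)] B] by (intro emeasure_density) auto
        also have "\<dots> = (\<integral>\<^sup>+\<omega>. indicator ({\<omega>\<in>space M. vec h \<omega> \<in> B} \<inter> ?b) \<omega> \<partial>M)"
          by (intro nn_integral_cong) (auto simp: indicator_def)
        also have "\<dots> = emeasure M ({\<omega>\<in>space M. vec h \<omega> \<in> B} \<inter> ?b)"
        proof (rule nn_integral_indicator)
          have "{\<omega>\<in>space M. vec h \<omega> \<in> B} = vec h -` B \<inter> space M" by auto
          then show "{\<omega>\<in>space M. vec h \<omega> \<in> B} \<inter> ?b \<in> events"
            using measurable_sets[OF vec_meas[OF that(1)] B] by auto
        qed
        finally show ?thesis .
      qed
      have rect: "emeasure (\<nu> h) (Pi\<^sub>E {1..m} A) =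
          (\<integral>\<^sup>+\<omega>\<in>?b. ennreal (\<Prod>j\<in>{1..m}. poisson_prob ((t j - t (j - 1)) * \<Theta> \<omega>) {k. real k \<in> A j}) \<partial>M)"
        if h: "0 \<le> h" and A: "\<And>j. j \<in> {1..m} \<Longrightarrow> A j \<in> sets borel" for h A
      proof -
        have inc: "increment N (t (j - 1) + h) (t j + h) \<omega> = real (N (t j + h) \<omega> - N (t (j - 1) + h) \<omega>)"
          if "\<omega> \<in> space M" "j \<in> {1..m}" for j \<omega>
          using that h pos[of "j - 1"] mono[of "j - 1" j] by (intro increment_eq_nat) auto
        have "{\<omega>\<in>space M. vec h \<omega> \<in> Pi\<^sub>E {1..m} A} =
            {\<omega>\<in>space M. \<forall>j\<in>{1..m}. N (t j + h) \<omega> - N (t (j - 1) + h) \<omega> \<in> {k. real k \<in> A j}}"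
          using inc by (auto simp: vec_def PiE_iff)
        moreover have "Pi\<^sub>E {1..m} A \<in> sets (PiM {1..m} (\<lambda>_. borel))" using A by (intro sets_PiM_I_finite) auto
        ultimately show ?thesis
          using \<nu>[OF h] poisson_increments_emeasure(1)[OF pois t h order_refl C, of "\<lambda>j. {k. real k \<in> A j}"]
          by simp
      qed
      have "\<nu> h = \<nu> 0"
      proof (rule measure_eqI_PiM_finite[where I="{1..m}" and M="\<lambda>_. borel" and A="\<lambda>_. Pi\<^sub>E {1..m} (\<lambda>_. UNIV)"])
        show "emeasure (\<nu> h) (Pi\<^sub>E {1..m} A) = emeasure (\<nu> 0) (Pi\<^sub>E {1..m} A)"
          if "\<And>i. i \<in> {1..m} \<Longrightarrow> A i \<in> sets borel" for A using rect[OF h that] rect[OF order_refl that] by simp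
        show "range (\<lambda>_::nat. Pi\<^sub>E {1..m} (\<lambda>_. UNIV)) \<subseteq> prod_algebra {1..m} (\<lambda>_. borel :: real measure)"
          by (auto intro!: prod_algebraI_finite)
        have "emeasure (\<nu> h) (Pi\<^sub>E {1..m} (\<lambda>_. UNIV)) \<le> 1"
          using \<nu>[OF h, of "Pi\<^sub>E {1..m} (\<lambda>_. UNIV)"] by (simp add: emeasure_eq_measure sets_PiM_I_finite)
        then show "emeasure (\<nu> h) (Pi\<^sub>E {1..m} (\<lambda>_. UNIV)) \<noteq> \<infinity>" by (auto simp: top_unique)
      qed (auto simp: \<nu>_def space_PiM)
      then show ?thesis using \<nu>[OF h B] \<nu>[OF order_refl B] by simp
    qed
    have F: "{\<omega>\<in>space M. vec h \<omega> \<in> B} \<in> events" if "0 \<le> h" for h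
      using measurable_sets[OF vec_meas[OF that] B] by (simp add: vimage_def Int_def conj_commute)
    interpret Z: finite_measure_subalgebra M sigma_\<Theta> by unfold_locales (rule subalgebra_\<Theta>)
    let ?F = "\<lambda>h. {\<omega>\<in>space M. vec h \<omega> \<in> B}"
    have int: "integrable M (indicator (?F h) :: 'a \<Rightarrow> real)" if "0 \<le> h" for h
      using F[OF that] by (simp add: less_top[symmetric])
    have set_ind: "set_lebesgue_integral M b (indicator (?F h)) = prob (?F h \<inter> b)"
      if "0 \<le> h" "b \<in> events" for h b
    proof -
      have "set_lebesgue_integral M b (indicator (?F h)) = integral\<^sup>L M (indicator (?F h \<inter> b))"
        unfolding set_lebesgue_integral_def by (intro Bochner_Integration.integral_cong) (auto simp: indicator_def)
      also have "\<dots> = prob (?F h \<inter> b \<inter> space M)" by (rule Bochner_Integration.integral_indicator)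
      also have "?F h \<inter> b \<inter> space M = ?F h \<inter> b" by auto
      finally show ?thesis .
    qed
    have "AE \<omega> in M. real_cond_exp M sigma_\<Theta> (indicator (?F h)) \<omega> = real_cond_exp M sigma_\<Theta> (indicator (?F 0)) \<omega>"
    proof (rule Z.real_cond_exp_charact)
      fix b assume b: "b \<in> sets sigma_\<Theta>"
      then obtain C where C: "C \<in> sets borel" "b = \<Theta> -` C \<inter> space M" by (auto simp: sets_vimage_algebra2)
      have bM: "b \<in> events" using b subalgebra_\<Theta> by (auto simp: subalgebra_def)
      have "set_lebesgue_integral M b (indicat_real (?F h)) = set_lebesgue_integral M b (indicat_real (?F 0))"
        using law[OF C(1)] set_ind[OF h bM] set_ind[OF order_refl bM] C by (simp add: measure_def)
      also have "\<dots> = set_lebesgue_integral M b (real_cond_exp M sigma_\<Theta> (indicator (?F 0)))"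
        by (rule Z.real_cond_exp_intA[OF int b]) simp
      finally show "set_lebesgue_integral M b (indicator (?F h)) =
        set_lebesgue_integral M b (real_cond_exp M sigma_\<Theta> (indicator (?F 0)))" .
    qed (use int[OF h] int[of 0] in auto)
    then show "AE \<omega> in M. cond_prob_given M sigma_\<Theta>
          {\<omega>\<in>space M. (\<lambda>j\<in>{1..m}. increment N (t (j - 1) + h) (t j + h) \<omega>) \<in> B} \<omega> =
        cond_prob_given M sigma_\<Theta> {\<omega>\<in>space M. (\<lambda>j\<in>{1..m}. increment N (t (j - 1)) (t j) \<omega>) \<in> B} \<omega>"
      by (simp add: vec_def cond_prob_given_def)
  qed
next
  fix t :: real and B assume t: "0 < t"
  have N0: "N 0 \<omega> = 0" if "\<omega> \<in> space M" for \<omega> using counting that by (simp add: counting_process_def)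
  \<comment> \<open>The partition with the two points 0 and \<open>t\<close>; as \<open>N\<close>
    starts at 0, its single increment is \<open>N t\<close>.\<close>
  define \<tau> where "\<tau> i = real i * t" for i
  have \<tau>: "\<tau> 0 = 0" "strict_mono_on {0..1} \<tau>" using t by (auto simp: \<tau>_def strict_mono_on_def)
  have "{\<omega>\<in>space M. \<forall>j\<in>{1}. N (\<tau> j + 0) \<omega> - N (\<tau> (j - 1) + 0) \<omega> \<in> B} = {\<omega>\<in>space M. N t \<omega> \<in> B}"
    by (auto simp: \<tau>_def N0)
  then have cp: "AE \<omega> in M. cond_prob_given M sigma_\<Theta> {\<omega>\<in>space M. N t \<omega> \<in> B} \<omega> = poisson_prob (t * \<Theta> \<omega>) B"
    using poisson_increments_cond_prob[OF pois \<tau> order_refl, of "{1}" "\<lambda>_. B"] by (simp add: \<tau>_def)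
  have [measurable]: "\<Theta> \<in> borel_measurable sigma_\<Theta>" by (rule measurable_vimage_algebra1) auto
  have [measurable]: "cond_prob_given M sigma_\<Theta> {\<omega>\<in>space M. N t \<omega> \<in> B} \<in> borel_measurable sigma_\<Theta>"
    by (simp add: cond_prob_given_def)
  have "AE \<omega> in restr_to_subalg M sigma_\<Theta>. cond_prob_given M sigma_\<Theta> {\<omega>\<in>space M. N t \<omega> \<in> B} \<omega> = poisson_prob (t * \<Theta> \<omega>) B"
    by (rule AE_restr_to_subalg2[OF subalgebra_\<Theta> cp]) measurable
  moreover have "AE \<omega> in restr_to_subalg M sigma_\<Theta>. 0 < \<Theta> \<omega>"
    by (rule AE_restr_to_subalg2[OF subalgebra_\<Theta> \<Theta>_pos]) measurable
  ultimately show "AE \<omega> in restr_to_subalg M sigma_\<Theta>. cond_prob_given M sigma_\<Theta> {\<omega>\<in>space M. N t \<omega> \<in> B} \<omega> =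
      measure (measure_pmf (poisson_pmf (t * \<Theta> \<omega>))) B"
    by eventually_elim (use t in \<open>simp add: measure_poisson_pmf\<close>)
qed

end

section \<open>From mixed Poisson processes to conditionally Poisson increments\<close>

context risk_model
begin

abbreviation increment_algebra :: "(nat \<Rightarrow> real) \<Rightarrow> nat \<Rightarrow> 'a measure" where
  "increment_algebra t j \<equiv> vimage_algebra (space M) (increment N (t (j - 1)) (t j)) borel"

text \<open>Applied to finite sets of times: this is as much of the past as finitely many increments
  can describe.\<close>

definition finite_past :: "real set \<Rightarrow> 'a measure" where
  "finite_past U = join_sigma (generated_sigma (space M) borel (\<lambda>t \<omega>. real (N t \<omega>)) U) sigma_\<Theta>"

lemma space_finite_past [simp]: "space (finite_past U) = space M"
  by (simp add: finite_past_def space_join_sigma)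

lemma finite_past_least:
  assumes "space H = space M" "\<And>u. u \<in> U \<Longrightarrow> (\<lambda>\<omega>. real (N u \<omega>)) \<in> borel_measurable H" "\<Theta> \<in> borel_measurable H"
  shows "sets (finite_past U) \<subseteq> sets H"
  unfolding finite_past_def using assms
  by (intro join_sigma_least generated_sigma_subset vimage_algebra_subset) auto

lemma N_meas_finite_past: "u \<in> U \<Longrightarrow> (\<lambda>\<omega>. real (N u \<omega>)) \<in> borel_measurable (finite_past U)"
  unfolding finite_past_def
  by (intro measurable_join_left measurable_generated_sigma[where Y="\<lambda>t \<omega>. real (N t \<omega>)"]) auto

lemma \<Theta>_meas_finite_past: "\<Theta> \<in> borel_measurable (finite_past U)"
  unfolding finite_past_def by (intro measurable_join_right measurable_vimage_algebra1) auto

lemma finite_past_mono: "U \<subseteq> V \<Longrightarrow> sets (finite_past U) \<subseteq> sets (finite_past V)"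
  by (rule finite_past_least) (auto intro: N_meas_finite_past \<Theta>_meas_finite_past)

lemma increment_measurable:
  "0 \<le> s \<Longrightarrow> 0 \<le> t \<Longrightarrow> increment N s t \<in> borel_measurable M"
  unfolding increment_def[abs_def] by (intro borel_measurable_diff real_N_meas)

text \<open>Stationarity with shift \<open>s\<close> moves the increment to the interval from 0 to
  \<open>t - s\<close>, where its conditional law is part of the definition.\<close>

lemma mixed_poisson_increment:
  assumes mixed: "mixed_poisson_process M N \<Theta>" and st: "0 \<le> s" "s < t"
  shows "AE \<omega> in M. cond_prob_given M sigma_\<Theta> {\<omega>\<in>space M. N t \<omega> - N s \<omega> = k} \<omega> = poisson_density ((t - s) * \<Theta> \<omega>) k"
proof -
  define r where "r = t - s"
  define \<tau> where "\<tau> i = real i * r" for i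
  \<comment> \<open>Stationarity is stated for sets of vectors, so the event that the single
    increment equals \<open>k\<close> is written in a product with one factor.\<close>
  define B where "B = {x\<in>space (PiM {1..1::nat} (\<lambda>_. borel :: real measure)). x 1 = real k}"
  have r: "0 < r" using st by (simp add: r_def)
  have \<tau>: "\<tau> 0 = 0 \<and> strict_mono_on {0..1} \<tau>" using r by (auto simp: \<tau>_def strict_mono_on_def)
  have [measurable]: "(\<lambda>x. x 1) \<in> borel_measurable (PiM {1..1::nat} (\<lambda>_. borel :: real measure))"
    by (rule measurable_component_singleton) simp
  have B: "B \<in> sets (PiM {1..1} (\<lambda>_. borel))" unfolding B_def by measurable
  have eq: "{\<omega>\<in>space M. (\<lambda>j\<in>{1..1}. increment N (\<tau> (j - 1) + h) (\<tau> j + h) \<omega>) \<in> B} = {\<omega>\<in>space M. N (r + h) \<omega> - N h \<omega> = k}"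
    if h: "0 \<le> h" for h
  proof -
    have "increment N h (r + h) \<omega> = real (N (r + h) \<omega> - N h \<omega>)" if "\<omega> \<in> space M" for \<omega>
      using that h r by (intro increment_eq_nat) auto
    then show ?thesis by (auto simp: B_def space_PiM \<tau>_def)
  qed
  have stat: "AE \<omega> in M. cond_prob_given M sigma_\<Theta> {\<omega>\<in>space M. (\<lambda>j\<in>{1..1}. increment N (\<tau> (j - 1) + s) (\<tau> j + s) \<omega>) \<in> B} \<omega> =
      cond_prob_given M sigma_\<Theta> {\<omega>\<in>space M. (\<lambda>j\<in>{1..1}. increment N (\<tau> (j - 1)) (\<tau> j) \<omega>) \<in> B} \<omega>"
    using mixed st(1) \<tau> B unfolding mixed_poisson_process_def cond_stationary_increments_def by blast
  have "N 0 \<omega> = 0" if "\<omega> \<in> space M" for \<omega> using counting that by (simp add: counting_process_def)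
  then have "{\<omega>\<in>space M. N (r + 0) \<omega> - N 0 \<omega> = k} = {\<omega>\<in>space M. N r \<omega> \<in> {k}}" by auto
  then have stat': "AE \<omega> in M. cond_prob_given M sigma_\<Theta> {\<omega>\<in>space M. N t \<omega> - N s \<omega> = k} \<omega> =
      cond_prob_given M sigma_\<Theta> {\<omega>\<in>space M. N r \<omega> \<in> {k}} \<omega>"
    using stat unfolding eq[OF st(1)] using eq[of 0] by (simp add: r_def)
  have "AE \<omega> in restr_to_subalg M sigma_\<Theta>. cond_prob_given M sigma_\<Theta> {\<omega>\<in>space M. N r \<omega> \<in> {k}} \<omega> =
      measure (measure_pmf (poisson_pmf (r * \<Theta> \<omega>))) {k}"
    using mixed r unfolding mixed_poisson_process_def by blast
  then have "AE \<omega> in M. cond_prob_given M sigma_\<Theta> {\<omega>\<in>space M. N r \<omega> \<in> {k}} \<omega> =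
      measure (measure_pmf (poisson_pmf (r * \<Theta> \<omega>))) {k}"
    by (rule AE_restr_to_subalg[OF subalgebra_\<Theta>])
  then show ?thesis
    using stat' \<Theta>_pos by eventually_elim (use r in \<open>simp add: measure_pmf_single poisson_density_def r_def\<close>)
qed

text \<open>Given \<Theta>, the last increment is independent of the earlier ones and its
  conditional probability is a function of \<Theta>. That factor may be moved out of the conditional
  probability of the earlier increments and integrated over \<open>b\<close>.\<close>

lemma mixed_poisson_rectangle:
  fixes t :: "nat \<Rightarrow> real"
  assumes mixed: "mixed_poisson_process M N \<Theta>" and t0: "t 0 = 0" and t: "strict_mono_on {0..Suc m} t"
    and A: "\<And>j. j \<in> {1..m} \<Longrightarrow> A j \<in> sets (increment_algebra t j)" and b: "b \<in> sets sigma_\<Theta>"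
  shows "emeasure M (space M \<inter> (\<Inter>j\<in>{1..m}. A j) \<inter> b \<inter> {\<omega>\<in>space M. N (t (Suc m)) \<omega> - N (t m) \<omega> = k}) =
    (\<integral>\<^sup>+\<omega>\<in>space M \<inter> (\<Inter>j\<in>{1..m}. A j) \<inter> b. poisson_density ((t (Suc m) - t m) * \<Theta> \<omega>) k \<partial>M)"
proof -
  define Q where "Q = space M \<inter> (\<Inter>j\<in>{1..m}. A j)"
  define I where "I = {\<omega>\<in>space M. N (t (Suc m)) \<omega> - N (t m) \<omega> = k}"
  define d where "d \<omega> = poisson_density ((t (Suc m) - t m) * \<Theta> \<omega>) k" for \<omega>
  have mono: "t i \<le> t j" if "i \<le> j" "j \<le> Suc m" for i j
    using strict_mono_onD[OF t, of i j] that by (cases "i = j") auto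
  have pos: "0 \<le> t i" if "i \<le> Suc m" for i using mono[of 0 i] that t0 by simp
  have step: "t m < t (Suc m)" using strict_mono_onD[OF t, of m "Suc m"] by simp
  interpret Z: finite_measure_subalgebra M sigma_\<Theta> by unfold_locales (rule subalgebra_\<Theta>)
  have AM: "A j \<in> events" if j: "j \<in> {1..m}" for j
  proof -
    have "sets (increment_algebra t j) \<subseteq> events"
      using j pos by (intro vimage_algebra_subset increment_measurable) auto
    then show ?thesis using A[OF j] by blast
  qed
  have IM [measurable]: "I \<in> events" unfolding I_def using increment_set[of "t m" "t (Suc m)" "{k}"] pos by simp
  have bM [measurable]: "b \<in> events" using b subalgebra_\<Theta> by (auto simp: subalgebra_def)
  have QM [measurable]: "Q \<in> events"
  proof (cases "m = 0")
    case True then show ?thesis by (simp add: Q_def)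
  next
    case False
    then show ?thesis unfolding Q_def using AM by (intro sets.Int sets.finite_INT) auto
  qed
  have int: "integrable M (indicator F :: 'a \<Rightarrow> real)" if "F \<in> events" for F
    using that by (simp add: less_top[symmetric])
  let ?cp = "\<lambda>F. real_cond_exp M sigma_\<Theta> (indicator F)"
  have cpI: "AE \<omega> in M. ?cp I \<omega> = d \<omega>"
    using mixed_poisson_increment[OF mixed pos[of m] step, of k] by (simp add: cond_prob_given_def I_def d_def)
  have I_alg: "I \<in> sets (increment_algebra t (Suc m))"
  proof -
    have "I = increment N (t m) (t (Suc m)) -` {real k} \<inter> space M"
      using pos[of m] step by (auto simp: I_def increment_eq_nat)
    then show ?thesis by (simp add: in_vimage_algebra)
  qed
  \<comment> \<open>The last event is appended as index \<open>Suc m\<close>, so that conditional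
    independence can be used with and without it.\<close>
  define A' where "A' j = (if j = Suc m then I else A j)" for j
  have indep: "AE \<omega> in M. ?cp (\<Inter>j\<in>J. A' j) \<omega> = (\<Prod>j\<in>J. ?cp (A' j) \<omega>)"
    if J: "J \<subseteq> {1..Suc m}" "J \<noteq> {}" for J
  proof -
    have "cond_indep_sets M sigma_\<Theta> (\<lambda>j. sets (increment_algebra t j)) {1..Suc m}"
      using mixed t0 t unfolding mixed_poisson_process_def cond_indep_increments_def by blast
    moreover have "A' \<in> Pi J (\<lambda>j. sets (increment_algebra t j))"
    proof (rule Pi_I)
      fix j assume "j \<in> J"
      then have "j \<in> {1..m} \<or> j = Suc m" using J by force
      then show "A' j \<in> sets (increment_algebra t j)" using A[of j] I_alg by (auto simp: A'_def)
    qed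
    moreover have "finite J" using J finite_subset by blast
    ultimately show ?thesis using J unfolding cond_indep_sets_def cond_prob_given_def by blast
  qed
  have prod: "AE \<omega> in M. ?cp (Q \<inter> I) \<omega> = ?cp Q \<omega> * d \<omega>"
  proof (cases "m = 0")
    case True
    \<comment> \<open>Without earlier increments the intersection is the whole space; conditional
      independence over an empty index set says nothing, so conditional probability 1 is shown
      directly.\<close>
    then have Q: "Q = space M" by (simp add: Q_def)
    have "AE \<omega> in M. ?cp (space M) \<omega> = 1"
    proof (rule Z.real_cond_exp_charact)
      show "set_lebesgue_integral M F (indicator (space M)) = set_lebesgue_integral M F (\<lambda>_. 1)" for F
        unfolding set_lebesgue_integral_def by (intro Bochner_Integration.integral_cong) auto
    qed (use int[of "space M"] in auto)
    moreover have "space M \<inter> I = I" by (auto simp: I_def)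
    ultimately show ?thesis using cpI unfolding Q by (auto elim: eventually_elim2)
  next
    case False
    have Q_eq: "Q = (\<Inter>j\<in>{1..m}. A' j)"
    proof -
      have "A j \<subseteq> space M" if "j \<in> {1..m}" for j using AM[OF that] by (rule sets.sets_into_space)
      then have "Q = (\<Inter>j\<in>{1..m}. A j)" using False unfolding Q_def by fastforce
      also have "\<dots> = (\<Inter>j\<in>{1..m}. A' j)" by (rule INF_cong) (auto simp: A'_def)
      finally show ?thesis .
    qed
    have ins: "{1..Suc m} = insert (Suc m) {1..m}" by auto
    have QI_eq: "Q \<inter> I = (\<Inter>j\<in>{1..Suc m}. A' j)" unfolding Q_eq ins by (auto simp: A'_def)
    have "AE \<omega> in M. ?cp (Q \<inter> I) \<omega> = (\<Prod>j\<in>{1..Suc m}. ?cp (A' j) \<omega>)"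
      unfolding QI_eq by (rule indep) auto
    moreover have "AE \<omega> in M. ?cp Q \<omega> = (\<Prod>j\<in>{1..m}. ?cp (A' j) \<omega>)"
      unfolding Q_eq using False by (intro indep) auto
    ultimately show ?thesis using cpI
      by eventually_elim (simp add: ins mult.commute A'_def[of "Suc m"])
  qed
  have rate: "AE \<omega> in M. 0 \<le> d \<omega> \<and> d \<omega> \<le> 1"
    using AE_rate_nonneg[OF less_imp_le[OF step]]
    by eventually_elim (simp add: d_def poisson_density_nonneg poisson_density_le_1)
  have \<Theta>Z [measurable]: "\<Theta> \<in> borel_measurable sigma_\<Theta>" by (rule measurable_vimage_algebra1) auto
  have dZ: "(\<lambda>\<omega>. indicator b \<omega> * d \<omega>) \<in> borel_measurable sigma_\<Theta>"
    unfolding d_def using b by measurable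
  have [measurable]: "d \<in> borel_measurable M" unfolding d_def by measurable
  have bounded_int: "integrable M (\<lambda>\<omega>. indicator b \<omega> * d \<omega> * indicator Q \<omega> :: real)"
    using rate by (intro integrable_const_bound[where B=1]) (auto simp: indicator_def elim: eventually_mono)
  have "prob (Q \<inter> b \<inter> I) = prob (Q \<inter> I \<inter> b \<inter> space M)"
    by (rule arg_cong[where f=prob]) (auto simp: Q_def)
  also have "\<dots> = integral\<^sup>L M (indicator (Q \<inter> I \<inter> b))"
    by (rule Bochner_Integration.integral_indicator[symmetric])
  also have "\<dots> = (\<integral>\<omega>. indicator b \<omega> * indicator (Q \<inter> I) \<omega> \<partial>M)"
    by (intro Bochner_Integration.integral_cong) (auto simp: indicator_def)
  also have "\<dots> = (\<integral>\<omega>. indicator b \<omega> * ?cp (Q \<inter> I) \<omega> \<partial>M)"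
  proof (rule Z.real_cond_exp_intg(2)[symmetric])
    show "integrable M (\<lambda>\<omega>. indicator b \<omega> * indicator (Q \<inter> I) \<omega> :: real)"
      by (intro integrable_const_bound[where B=1]) (auto simp: indicator_def)
  qed (use b in auto)
  also have "\<dots> = (\<integral>\<omega>. (indicator b \<omega> * d \<omega>) * ?cp Q \<omega> \<partial>M)"
  proof (rule integral_cong_AE)
    show "AE \<omega> in M. indicator b \<omega> * ?cp (Q \<inter> I) \<omega> = (indicator b \<omega> * d \<omega>) * ?cp Q \<omega>"
      using prod by eventually_elim simp
  qed measurable
  also have "\<dots> = (\<integral>\<omega>. (indicator b \<omega> * d \<omega>) * indicator Q \<omega> \<partial>M)"
    by (rule Z.real_cond_exp_intg(2)[OF bounded_int dZ]) measurable
  finally have "emeasure M (Q \<inter> b \<inter> I) = ennreal (\<integral>\<omega>. indicator b \<omega> * d \<omega> * indicator Q \<omega> \<partial>M)"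
    by (simp add: emeasure_eq_measure)
  also have "\<dots> = (\<integral>\<^sup>+\<omega>. ennreal (indicator b \<omega> * d \<omega> * indicator Q \<omega>) \<partial>M)"
    using rate by (intro nn_integral_eq_integral[symmetric] bounded_int) (auto elim: eventually_mono)
  also have "\<dots> = (\<integral>\<^sup>+\<omega>\<in>Q \<inter> b. d \<omega> \<partial>M)"
    by (intro nn_integral_cong) (auto simp: indicator_def)
  finally show ?thesis by (simp add: Q_def I_def d_def)
qed

text \<open>The past at the partition points is generated by rectangles of increments intersected
  with events of \<Theta>, so the rectangle formula extends by uniqueness.\<close>

lemma mixed_poisson_partition:
  fixes t :: "nat \<Rightarrow> real"
  assumes mixed: "mixed_poisson_process M N \<Theta>" and t0: "t 0 = 0" and t: "strict_mono_on {0..Suc m} t"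
    and E: "E \<in> sets (finite_past (t ` {0..m}))"
  shows "(\<integral>\<^sup>+\<omega>\<in>E. indicator {\<omega>\<in>space M. N (t (Suc m)) \<omega> - N (t m) \<omega> = k} \<omega> \<partial>M) =
    (\<integral>\<^sup>+\<omega>\<in>E. poisson_density ((t (Suc m) - t m) * \<Theta> \<omega>) k \<partial>M)"
proof -
  define I where "I = {\<omega>\<in>space M. N (t (Suc m)) \<omega> - N (t m) \<omega> = k}"
  have mono: "t i \<le> t j" if "i \<le> j" "j \<le> Suc m" for i j
    using strict_mono_onD[OF t, of i j] that by (cases "i = j") auto
  have pos: "0 \<le> t i" if "i \<le> Suc m" for i using mono[of 0 i] that t0 by simp
  have IM [measurable]: "I \<in> events" unfolding I_def using increment_set[of "t m" "t (Suc m)" "{k}"] pos by simp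
  let ?V = "\<lambda>j. sets (increment_algebra t j)"
  define Q where "Q A = space M \<inter> (\<Inter>j\<in>{1..m}. A j)" for A :: "nat \<Rightarrow> 'a set"
  define G where "G = {Q A \<inter> b | A b. A \<in> Pi {1..m} ?V \<and> b \<in> sets sigma_\<Theta>}"
  have V_events: "?V j \<subseteq> events" if "j \<in> {1..m}" for j
    using that pos by (intro vimage_algebra_subset increment_measurable) auto
  have V_top: "space M \<in> ?V j" for j using sets.top[of "increment_algebra t j"] by simp
  have QM: "Q A \<in> events" if "A \<in> Pi {1..m} ?V" for A
  proof (cases "m = 0")
    case True then show ?thesis by (simp add: Q_def)
  next
    case False
    have "A j \<in> events" if "j \<in> {1..m}" for j using V_events[OF that] Pi_mem[OF \<open>A \<in> _\<close> that] by blast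
    then show ?thesis unfolding Q_def using False by (intro sets.Int sets.finite_INT) auto
  qed
  have G_events: "G \<subseteq> events" unfolding G_def using QM subalgebra_\<Theta> by (auto simp: subalgebra_def)
  have I_nn: "(\<integral>\<^sup>+\<omega>\<in>E. indicator I \<omega> \<partial>M) = emeasure M (E \<inter> I)" if "E \<in> events" for E
  proof -
    have "(\<integral>\<^sup>+\<omega>\<in>E. indicator I \<omega> \<partial>M) = (\<integral>\<^sup>+\<omega>. indicator (E \<inter> I) \<omega> \<partial>M)"
      by (intro nn_integral_cong) (auto simp: indicator_def)
    then show ?thesis using that by simp
  qed
  have "(\<integral>\<^sup>+\<omega>\<in>E. indicator I \<omega> \<partial>M) = (\<integral>\<^sup>+\<omega>\<in>E. poisson_density ((t (Suc m) - t m) * \<Theta> \<omega>) k \<partial>M)"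
  proof (rule nn_integral_eq_on_sigma[where G=G])
    show "(\<integral>\<^sup>+\<omega>. indicator I \<omega> \<partial>M) < \<infinity>" by (simp add: less_top[symmetric])
    show "Int_stable G"
    proof (rule Int_stableI)
      fix x y assume "x \<in> G" "y \<in> G"
      then obtain A b A' b' where x: "x = Q A \<inter> b" "A \<in> Pi {1..m} ?V" "b \<in> sets sigma_\<Theta>"
        and y: "y = Q A' \<inter> b'" "A' \<in> Pi {1..m} ?V" "b' \<in> sets sigma_\<Theta>" unfolding G_def by blast
      have "x \<inter> y = Q (\<lambda>j. A j \<inter> A' j) \<inter> (b \<inter> b')" unfolding x y Q_def by blast
      moreover have "(\<lambda>j. A j \<inter> A' j) \<in> Pi {1..m} ?V"
        using x(2) y(2) by (auto simp: Pi_iff)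
      moreover have "b \<inter> b' \<in> sets sigma_\<Theta>" using x(3) y(3) by (rule sets.Int)
      ultimately show "x \<inter> y \<in> G" unfolding G_def by blast
    qed
    show top: "space M \<in> G" unfolding G_def
      using V_top sets.top[of sigma_\<Theta>] by (intro CollectI exI[of _ "\<lambda>_. space M"] exI[of _ "space M"]) (auto simp: Q_def)
    fix x assume "x \<in> G"
    then obtain A b where x: "x = Q A \<inter> b" "A \<in> Pi {1..m} ?V" "b \<in> sets sigma_\<Theta>" unfolding G_def by blast
    have "x \<in> events" using G_events \<open>x \<in> G\<close> by blast
    then show "(\<integral>\<^sup>+\<omega>\<in>x. indicator I \<omega> \<partial>M) = (\<integral>\<^sup>+\<omega>\<in>x. poisson_density ((t (Suc m) - t m) * \<Theta> \<omega>) k \<partial>M)"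
      using mixed_poisson_rectangle[OF mixed t0 t Pi_mem[OF x(2)] x(3), of k] x(1)
      unfolding I_nn[OF \<open>x \<in> events\<close>] by (simp add: Q_def I_def)
  next
    define H where "H = sigma (space M) G"
    have GP: "G \<subseteq> Pow (space M)" using G_events sets.space_closed[of M] by blast
    have H: "space H = space M" "sets H = sigma_sets (space M) G" using GP by (auto simp: H_def)
    have GH: "x \<in> sets H" if "x \<in> G" for x using that unfolding H by auto
    have inc: "increment N (t (j - 1)) (t j) \<in> borel_measurable H" if j: "j \<in> {1..m}" for j
    proof (rule measurableI)
      fix B :: "real set" assume B: "B \<in> sets borel"
      define A where "A i = (if i = j then increment N (t (j - 1)) (t j) -` B \<inter> space M else space M)" for i
      have "A \<in> Pi {1..m} ?V" using V_top B by (auto simp: A_def in_vimage_algebra)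
      moreover have "increment N (t (j - 1)) (t j) -` B \<inter> space H = Q A \<inter> space M"
        using j unfolding Q_def A_def H by (auto split: if_splits)
      ultimately have "increment N (t (j - 1)) (t j) -` B \<inter> space H \<in> G"
        unfolding G_def using sets.top[of sigma_\<Theta>] by auto
      then show "increment N (t (j - 1)) (t j) -` B \<inter> space H \<in> sets H" by (rule GH)
    qed simp
    \<comment> \<open>As \<open>t 0 = 0\<close> and \<open>N\<close> starts at 0, the values at the
      partition points are recovered from the increments by telescoping.\<close>
    have N_eq: "real (N (t i) \<omega>) = (\<Sum>j=1..i. increment N (t (j - 1)) (t j) \<omega>)" if "\<omega> \<in> space M" for i \<omega>
    proof (induction i)
      case 0
      then show ?case using counting that t0 by (simp add: counting_process_def)
    qed (simp add: increment_def)
    have "sets (finite_past (t ` {0..m})) \<subseteq> sets H"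
    proof (rule finite_past_least)
      fix u assume "u \<in> t ` {0..m}"
      then obtain i where i: "u = t i" "i \<le> m" by auto
      have "(\<lambda>\<omega>. \<Sum>j=1..i. increment N (t (j - 1)) (t j) \<omega>) \<in> borel_measurable H"
        using i by (intro borel_measurable_sum inc) auto
      then show "(\<lambda>\<omega>. real (N u \<omega>)) \<in> borel_measurable H"
        using N_eq[of _ i] unfolding i(1) H(1)[symmetric] by (simp cong: measurable_cong)
    next
      show "\<Theta> \<in> borel_measurable H"
      proof (rule measurableI)
        fix B :: "real set" assume B: "B \<in> sets borel"
        have "Q (\<lambda>_. space M) \<inter> (\<Theta> -` B \<inter> space M) \<in> G"
          unfolding G_def by (intro CollectI exI conjI, rule refl) (use V_top B in \<open>auto simp: in_vimage_algebra\<close>)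
        moreover have "Q (\<lambda>_. space M) \<inter> (\<Theta> -` B \<inter> space M) = \<Theta> -` B \<inter> space H" by (auto simp: Q_def H)
        ultimately show "\<Theta> -` B \<inter> space H \<in> sets H" using GH by simp
      qed simp
    qed (rule H)
    then show "E \<in> sigma_sets (space M) G" using E H by blast
  qed (use G_events in auto)
  then show ?thesis by (simp add: I_def)
qed

text \<open>Any finite set of times up to \<open>s\<close> can be completed to a partition from 0 to
  \<open>s\<close>, with \<open>t\<close> as the next point. Pasts at finitely many times then
  generate the full past.\<close>

lemma mixed_poisson_imp_poisson_increments:
  assumes mixed: "mixed_poisson_process M N \<Theta>"
  shows "poisson_increments"
  unfolding poisson_increments_def
proof (intro allI impI ballI)
  fix s t :: real and k E assume st': "0 \<le> s \<and> s \<le> t" and E: "E \<in> sets (filt_N s)"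
  then have st: "0 \<le> s" "s \<le> t" by auto
  define I where "I = {\<omega>\<in>space M. N t \<omega> - N s \<omega> = k}"
  have IM [measurable]: "I \<in> events" unfolding I_def using increment_set[of s t "{k}"] st by simp
  have EM [measurable]: "E \<in> events" using E subalgebra_filt_N by (auto simp: subalgebra_def)
  have "(\<integral>\<^sup>+\<omega>\<in>E. indicator I \<omega> \<partial>M) = (\<integral>\<^sup>+\<omega>\<in>E. poisson_density ((t - s) * \<Theta> \<omega>) k \<partial>M)"
  proof (cases "s = t")
    case True
    \<comment> \<open>The partition argument needs \<open>s < t\<close>. For \<open>s = t\<close>
      the increment is 0, and the Poisson law of rate 0 is unit mass at 0.\<close>
    then have "indicator I \<omega> = ennreal (poisson_density ((t - s) * \<Theta> \<omega>) k)" if "\<omega> \<in> space M" for \<omega>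
      using that by (cases "k = 0") (auto simp: I_def poisson_density_def power_0_left)
    then show ?thesis by (intro nn_integral_cong) simp
  next
    case False
    then have less: "s < t" using st by simp
    \<comment> \<open>Two finite sets of times have a common finite enlargement, which makes this
      union stable under intersections.\<close>
    define G where "G = (\<Union>U\<in>{U. finite U \<and> U \<subseteq> {0..s}}. sets (finite_past U))"
    have sub: "sets (finite_past U) \<subseteq> events" if "U \<subseteq> {0..s}" for U
      using that by (intro finite_past_least real_N_meas) auto
    show ?thesis
    proof (rule nn_integral_eq_on_sigma[where G=G])
      show "(\<integral>\<^sup>+\<omega>. indicator I \<omega> \<partial>M) < \<infinity>" by (simp add: less_top[symmetric])
      show G_events: "G \<subseteq> events" unfolding G_def using sub by blast
      show "Int_stable G"
      proof (rule Int_stableI)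
        fix x y assume "x \<in> G" "y \<in> G"
        then obtain U V where U: "finite U" "U \<subseteq> {0..s}" "x \<in> sets (finite_past U)"
          and V: "finite V" "V \<subseteq> {0..s}" "y \<in> sets (finite_past V)" unfolding G_def by blast
        have "x \<in> sets (finite_past (U \<union> V))" "y \<in> sets (finite_past (U \<union> V))"
          using U V finite_past_mono[of U "U \<union> V"] finite_past_mono[of V "U \<union> V"] by auto
        then have "x \<inter> y \<in> sets (finite_past (U \<union> V))" by (rule sets.Int)
        then show "x \<inter> y \<in> G" unfolding G_def using U V by blast
      qed
      have "space M \<in> sets (finite_past {})" using sets.top[of "finite_past {}"] by simp
      then show "space M \<in> G" unfolding G_def by blast
      fix x assume "x \<in> G"
      then obtain U where U: "finite U" "U \<subseteq> {0..s}" "x \<in> sets (finite_past U)" unfolding G_def by blast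
      \<comment> \<open>Adding 0 and \<open>s\<close> fixes the ends of the partition; it only
        enlarges the \<sigma>-algebra that contains \<open>x\<close>.\<close>
      define V where "V = insert 0 (insert s U)"
      have V: "finite V" "V \<subseteq> {0..s}" "0 \<in> V" "s \<in> V" "V \<noteq> {}" using U st by (auto simp: V_def)
      define m where "m = card V - 1"
      define L where "L = sorted_list_of_set V"
      have L: "sorted L" "distinct L" "set L = V" "length L = Suc m"
        using V by (auto simp: L_def m_def card_gt_0_iff)
      \<comment> \<open>The increasing enumeration of \<open>V\<close>, with \<open>t\<close> as the
        point of index \<open>Suc m\<close>.\<close>
      define \<tau> where "\<tau> i = (if i \<le> m then L ! i else t)" for i
      have L_less: "L ! i < L ! j" if "i < j" "j \<le> m" for i j
        using sorted_nth_mono[OF L(1), of i j] nth_eq_iff_index_eq[OF L(2), of i j] that L(4) by fastforce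
      have in_V: "L ! i \<in> V" if "i \<le> m" for i using nth_mem[of i L] that L by simp
      have img: "\<tau> ` {0..m} = V"
      proof -
        have "\<tau> ` {0..m} = (!) L ` {0..<length L}" unfolding L(4) by (intro image_cong) (auto simp: \<tau>_def)
        also have "\<dots> = set L" by (simp add: nth_image)
        finally show ?thesis using L by simp
      qed
      have \<tau>0: "\<tau> 0 = 0"
      proof -
        obtain i where i: "i \<le> m" "L ! i = 0" using img V(3) by (force simp: \<tau>_def)
        have "0 \<le> L ! 0" using in_V[of 0] V(2) by auto
        then have "i = 0" using L_less[of 0 i] i by (cases "i = 0") auto
        then show ?thesis using i by (simp add: \<tau>_def)
      qed
      have \<tau>m: "\<tau> m = s"
      proof -
        obtain i where i: "i \<le> m" "L ! i = s" using img V(4) by (force simp: \<tau>_def)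
        have "L ! m \<le> s" using in_V[of m] V(2) by auto
        then have "i = m" using L_less[of i m] i by (cases "i = m") auto
        then show ?thesis using i by (simp add: \<tau>_def)
      qed
      have mono: "strict_mono_on {0..Suc m} \<tau>"
      proof (rule strict_mono_onI)
        fix i j assume ij: "i \<in> {0..Suc m}" "j \<in> {0..Suc m}" "i < j"
        show "\<tau> i < \<tau> j"
        proof (cases "j = Suc m")
          case True
          then have "\<tau> i \<in> V" using ij in_V[of i] by (simp add: \<tau>_def)
          then have "\<tau> i \<le> s" using V(2) by auto
          then show ?thesis using True less by (simp add: \<tau>_def)
        next
          case False
          then show ?thesis using ij L_less[of i j] by (simp add: \<tau>_def)
        qed
      qed
      have "x \<in> sets (finite_past (\<tau> ` {0..m}))" using U(3) finite_past_mono[of U V] unfolding img by (auto simp: V_def)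
      from mixed_poisson_partition[OF mixed \<tau>0 mono this, of k]
      show "(\<integral>\<^sup>+\<omega>\<in>x. indicator I \<omega> \<partial>M) = (\<integral>\<^sup>+\<omega>\<in>x. poisson_density ((t - s) * \<Theta> \<omega>) k \<partial>M)"
        unfolding \<tau>m by (simp add: \<tau>_def I_def)
    next
      define H where "H = sigma (space M) G"
      have "G \<subseteq> Pow (space M)" unfolding G_def using sub sets.space_closed[of M] by blast
      then have H: "space H = space M" "sets H = sigma_sets (space M) G" by (auto simp: H_def)
      have GH: "sets (finite_past U) \<subseteq> sets H" if "finite U" "U \<subseteq> {0..s}" for U
        using that unfolding H G_def by (auto intro: sigma_sets.Basic)
      have meas: "f \<in> borel_measurable H" if "f \<in> borel_measurable (finite_past U)" "finite U" "U \<subseteq> {0..s}"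
        for f :: "'a \<Rightarrow> real" and U
        using that(1) GH[OF that(2,3)] by (auto simp: measurable_def H)
      have "sets (filt_N s) \<subseteq> sets H"
      proof (rule enlarged_filtration_least)
        show "(\<lambda>\<omega>. real (N u \<omega>)) \<in> borel_measurable H" if "0 \<le> u" "u \<le> s" for u
          using that by (intro meas[of _ "{u}"] N_meas_finite_past) auto
        show "\<Theta> \<in> borel_measurable H" by (intro meas[of _ "{}"] \<Theta>_meas_finite_past) auto
      qed (rule H)
      then show "E \<in> sigma_sets (space M) G" using E H by blast
    qed auto
  qed
  moreover have "(\<integral>\<^sup>+\<omega>\<in>E. indicator I \<omega> \<partial>M) = (\<integral>\<^sup>+\<omega>. indicator (E \<inter> I) \<omega> \<partial>M)"
    by (intro nn_integral_cong) (auto simp: indicator_def)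
  ultimately show "emeasure M (E \<inter> {\<omega>\<in>space M. N t \<omega> - N s \<omega> = k}) =
      (\<integral>\<^sup>+\<omega>\<in>E. poisson_density ((t - s) * \<Theta> \<omega>) k \<partial>M)"
    by (simp add: I_def[symmetric])
qed

lemma mixed_poisson_iff_compensated:
  "mixed_poisson_process M N \<Theta> \<longleftrightarrow> compensated_by M filt_N (\<lambda>t \<omega>. real (N t \<omega>)) \<Theta> 1"
  using mixed_poisson_imp_poisson_increments poisson_increments_imp_compensated
    compensated_imp_poisson_increments poisson_increments_imp_mixed_poisson by blast

end

section \<open>The equivalences\<close>

context increasing_process
begin

lemma martingale_iff_compensated:
  assumes c: "0 \<le> c"
  shows "martingale_L1 M filt (\<lambda>t \<omega>. A t \<omega> - t * \<Theta> \<omega> * c) \<longleftrightarrow> compensated_by M filt A \<Theta> c"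
proof (rule martingale_L1_iff_compensated)
  show "AE \<omega> in M. 0 \<le> \<Theta> \<omega>" using AE_\<Theta>_pos by eventually_elim simp
qed (auto intro: subalgebra_filt A_adapted measurable_enlarged_parameter A_nonneg A_zero \<Theta>_int c)

lemma kernel_martingale_iff_compensated:
  assumes c: "0 \<le> c" and \<theta>: "0 < \<theta>"
  shows "martingale_L1 (P \<theta>) filt (\<lambda>t \<omega>. A t \<omega> - t * \<theta> * c) \<longleftrightarrow> compensated_by (P \<theta>) filt A (\<lambda>_. \<theta>) c"
proof (rule martingale_L1_iff_compensated)
  interpret K: prob_space "P \<theta>" using kernel_prob[of \<theta>] kernel_pos[OF \<theta>] by simp
  have sp: "space (P \<theta>) = space M" "sets (P \<theta>) = sets M" using space_kernel[of \<theta>] sets_kernel[of \<theta>] kernel_pos[OF \<theta>] by auto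
  show "subalgebra (P \<theta>) (filt t)" for t using subalgebra_filt[of t] by (simp add: subalgebra_def sp)
  show "integrable (P \<theta>) (\<lambda>_. \<theta>)" by simp
  show "0 \<le> A t \<omega>" if "0 \<le> t" "\<omega> \<in> space (P \<theta>)" for t \<omega> using that A_nonneg sp by simp
  show "A 0 \<omega> = 0" if "\<omega> \<in> space (P \<theta>)" for \<omega> using that A_zero sp by simp
qed (use \<theta> c in \<open>auto intro: A_adapted\<close>)

text \<open>The constant \<open>c\<close> is the same for all \<theta>. For statement (iii) the
  means under the fibres therefore have to be identified beforehand.\<close>

lemma martingale_disintegration:
  assumes c: "0 \<le> c"
  shows "(AE \<theta> in law. 0 < \<theta> \<longrightarrow> martingale_L1 (P \<theta>) filt (\<lambda>t \<omega>. A t \<omega> - t * \<theta> * c)) \<longleftrightarrow>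
    compensated_by M filt A \<Theta> c"
  unfolding compensated_disintegration[OF c]
  by (rule AE_cong) (auto simp: kernel_martingale_iff_compensated[OF c])

end

lemma sets_generated_sigma_real_of_nat:
  "sets (generated_sigma \<Omega> (count_space UNIV) N I) = sets (generated_sigma \<Omega> borel (\<lambda>t \<omega>. real (N t \<omega>)) I)"
proof
  show "sets (generated_sigma \<Omega> (count_space UNIV) N I) \<subseteq> sets (generated_sigma \<Omega> borel (\<lambda>t \<omega>. real (N t \<omega>)) I)"
  proof (rule generated_sigma_subset)
    fix i assume "i \<in> I"
    then have "(\<lambda>\<omega>. real (N i \<omega>)) \<in> borel_measurable (generated_sigma \<Omega> borel (\<lambda>t \<omega>. real (N t \<omega>)) I)"
      by (intro measurable_generated_sigma[where Y="\<lambda>t \<omega>. real (N t \<omega>)"]) auto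
    then show "N i \<in> measurable (generated_sigma \<Omega> borel (\<lambda>t \<omega>. real (N t \<omega>)) I) (count_space UNIV)"
      by (rule measurable_count_space_real)
  qed simp
  show "sets (generated_sigma \<Omega> borel (\<lambda>t \<omega>. real (N t \<omega>)) I) \<subseteq> sets (generated_sigma \<Omega> (count_space UNIV) N I)"
  proof (rule generated_sigma_subset)
    fix i assume "i \<in> I"
    then have "N i \<in> measurable (generated_sigma \<Omega> (count_space UNIV) N I) (count_space UNIV)"
      by (intro measurable_generated_sigma) auto
    from measurable_compose[OF this, of real borel]
    show "(\<lambda>\<omega>. real (N i \<omega>)) \<in> borel_measurable (generated_sigma \<Omega> (count_space UNIV) N I)" by simp
  qed simp
qed

theorem theorem3p6:
  fixes M :: "'a measure"
    and N :: "real \<Rightarrow> 'a \<Rightarrow> nat"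
    and X :: "nat \<Rightarrow> 'a \<Rightarrow> real"
    and S :: "real \<Rightarrow> 'a \<Rightarrow> real"
    and W :: "nat \<Rightarrow> 'a \<Rightarrow> real"
    and \<Theta> :: "'a \<Rightarrow> real"
    and P :: "real \<Rightarrow> 'a measure"
    and F FN :: "real \<Rightarrow> 'a measure"
  defines "S \<equiv> aggregate N X"
    and "W \<equiv> interarrival N"
    and "F \<equiv> enlarged_filtration (space M) borel S \<Theta>"
    and "FN \<equiv> enlarged_filtration (space M) (count_space UNIV) N \<Theta>"
  assumes "prob_space M"
    and "risk_process M N X"
    and "\<Theta> \<in> borel_measurable M"
    and "measure (distr M borel \<Theta>) {0<..} = 1"
    and "sets M = sets (enlarged_filtration_inf (space M) borel S \<Theta>)"
    and "regular_cond_prob M \<Theta> P"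
    and "consistent_with M \<Theta> P"
    and a1: "cond_indep_sets M (vimage_algebra (space M) \<Theta> borel)
          (case_bool (sets (generated_sigma (space M) borel W {1..}))
                     (sets (generated_sigma (space M) borel X {1..}))) UNIV"
    and a2: "prob_space.indep_set M (sets (vimage_algebra (space M) \<Theta> borel))
          (sets (generated_sigma (space M) borel X {1..}))"
    and "integrable M (X 1)"
    and "integrable M \<Theta>"
  shows
    "(compound_mixed_poisson_process M N X S \<Theta> (distr M borel (X 1)) \<longleftrightarrow>
      martingale_L1 M F (\<lambda>t \<omega>. S t \<omega> - t * \<Theta> \<omega> * integral\<^sup>L M (X 1))) \<and>
     (compound_mixed_poisson_process M N X S \<Theta> (distr M borel (X 1)) \<longleftrightarrow>
      (AE \<theta> in distr M borel \<Theta>. 0 < \<theta> \<longrightarrow>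
        martingale_L1 (P \<theta>) F (\<lambda>t \<omega>. S t \<omega> - t * \<theta> * integral\<^sup>L (P \<theta>) (X 1)))) \<and>
     (compound_mixed_poisson_process M N X S \<Theta> (distr M borel (X 1)) \<longleftrightarrow>
      martingale_L1 M FN (\<lambda>t \<omega>. real (N t \<omega>) - t * \<Theta> \<omega>)) \<and>
     (compound_mixed_poisson_process M N X S \<Theta> (distr M borel (X 1)) \<longleftrightarrow>
      (AE \<theta> in distr M borel \<Theta>. 0 < \<theta> \<longrightarrow>
        martingale_L1 (P \<theta>) FN (\<lambda>t \<omega>. real (N t \<omega>) - t * \<theta>)))"
proof -
  interpret D: disintegration M \<Theta> P
    using assms(5,7,8,10,11) by (intro disintegration.intro disintegration_axioms.intro)
  interpret R: risk_model M N X \<Theta>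
    using assms(5-7,14,15) a1 a2 D.AE_\<Theta>_pos unfolding W_def
    by (intro risk_model.intro risk_model_axioms.intro) auto
  note counting = R.counting
  have N_mono: "N s \<omega> \<le> N t \<omega>" if "\<omega> \<in> space M" "0 \<le> s" "s \<le> t" for \<omega> s t
    using counting_mono[OF counting that] .
  have N_zero: "N 0 \<omega> = 0" if "\<omega> \<in> space M" for \<omega> using counting that by (simp add: counting_process_def)
  interpret IN: increasing_process M \<Theta> P "\<lambda>t \<omega>. real (N t \<omega>)"
  proof unfold_locales
    fix \<omega> and t :: real and r :: "nat \<Rightarrow> real" assume *: "\<omega> \<in> space M" "0 \<le> t" "r \<longlonglongrightarrow> t" "\<And>n. t \<le> r n"
    show "(\<lambda>n. real (N (r n) \<omega>)) \<longlonglongrightarrow> real (N t \<omega>)"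
      by (rule tendsto_eventually) (use counting_eventually_eq[OF counting *] in eventually_elim, simp)
  qed (use R.real_N_meas N_mono N_zero R.\<Theta>_int in auto)
  interpret IS: increasing_process M \<Theta> P "aggregate N X"
  proof unfold_locales
    fix \<omega> and t :: real and r :: "nat \<Rightarrow> real" assume *: "\<omega> \<in> space M" "0 \<le> t" "r \<longlonglongrightarrow> t" "\<And>n. t \<le> r n"
    show "(\<lambda>n. aggregate N X (r n) \<omega>) \<longlonglongrightarrow> aggregate N X t \<omega>"
      by (rule tendsto_eventually) (use counting_eventually_eq[OF counting *] in eventually_elim, simp add: aggregate_def)
  next
    fix \<omega> and s t :: real assume *: "\<omega> \<in> space M" "0 \<le> s" "s \<le> t"
    show "aggregate N X s \<omega> \<le> aggregate N X t \<omega>"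
      unfolding aggregate_def using N_mono[OF *] R.X_pos[OF _ *(1)]
      by (intro sum_mono2) (auto intro: less_imp_le)
  qed (use R.aggregate_meas N_zero R.\<Theta>_int in \<open>auto simp: aggregate_def\<close>)
  have FN: "FN = R.filt_N"
    by (rule ext) (simp add: FN_def enlarged_filtration_def sets_generated_sigma_real_of_nat)
  have FS: "F = R.filt_S" by (simp add: F_def S_def)
  have mean: "0 \<le> R.mean_X" using R.mean_X_pos by simp
  \<comment> \<open>By (a2), the integral of \<open>X 1\<close> over an event of \<Theta> is its
    probability times the mean, as for the constant \<open>mean_X\<close>. The comparison of fibre
    integrals then gives equality for almost every parameter.\<close>
  have AE_mean: "AE \<theta> in D.law. 0 < \<theta> \<longrightarrow> integral\<^sup>L (P \<theta>) (X 1) = R.mean_X"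
  proof -
    have X1: "X 1 \<in> borel_measurable (R.sigma_X {1..})" by (rule measurable_generated_sigma) auto
    have [measurable]: "X 1 \<in> borel_measurable M" by (rule R.X_meas) simp
    have X1_nonneg: "AE \<omega> in M. 0 \<le> X 1 \<omega>" using R.X_pos[of 1] by (intro AE_I2 less_imp_le) auto
    have total: "(\<integral>\<^sup>+\<omega>. X 1 \<omega> \<partial>M) = ennreal R.mean_X"
      by (rule nn_integral_eq_integral[OF R.X1_int X1_nonneg])
    have "AE \<theta> in D.law. (\<integral>\<^sup>+\<omega>. X 1 \<omega> \<partial>D.kernel \<theta>) = (\<integral>\<^sup>+\<omega>. ennreal R.mean_X \<partial>D.kernel \<theta>)"
    proof (rule D.AE_kernel_eqI)
      fix B :: "real set" assume B: "B \<in> sets borel"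
      have b: "\<Theta> -` B \<inter> space M \<in> sets R.sigma_\<Theta>" using B by (rule in_vimage_algebra)
      have [measurable]: "\<Theta> -` B \<inter> space M \<in> sets M" using B by measurable
      have ind: "(\<integral>\<^sup>+\<omega>. f \<omega> * indicator B (\<Theta> \<omega>) \<partial>M) = (\<integral>\<^sup>+\<omega>\<in>\<Theta> -` B \<inter> space M. f \<omega> \<partial>M)" for f :: "'a \<Rightarrow> ennreal"
        by (intro nn_integral_cong) (auto simp: indicator_def)
      have "(\<integral>\<^sup>+\<omega>\<in>\<Theta> -` B \<inter> space M. X 1 \<omega> \<partial>M) = emeasure M (\<Theta> -` B \<inter> space M) * (\<integral>\<^sup>+\<omega>. X 1 \<omega> \<partial>M)"
        using X1 by (intro D.nn_integral_indep_set[OF R.subalgebra_X D.indep_set_commute[OF R.\<Theta>_indep] b]) auto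
      also have "\<dots> = (\<integral>\<^sup>+\<omega>\<in>\<Theta> -` B \<inter> space M. ennreal R.mean_X \<partial>M)"
        unfolding total by (simp add: nn_integral_cmult_indicator mult.commute)
      finally show "(\<integral>\<^sup>+\<omega>. ennreal (X 1 \<omega>) * indicator B (\<Theta> \<omega>) \<partial>M) = (\<integral>\<^sup>+\<omega>. ennreal R.mean_X * indicator B (\<Theta> \<omega>) \<partial>M)"
        by (simp only: ind)
    qed measurable
    then show ?thesis
    proof (eventually_elim, intro impI)
      fix \<theta> :: real assume eq: "(\<integral>\<^sup>+\<omega>. X 1 \<omega> \<partial>D.kernel \<theta>) = (\<integral>\<^sup>+\<omega>. ennreal R.mean_X \<partial>D.kernel \<theta>)" and pos: "0 < \<theta>"
      interpret K: prob_space "D.kernel \<theta>" by (rule D.kernel_prob)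
      have "X 1 \<in> borel_measurable (D.kernel \<theta>)" by measurable
      then have "integral\<^sup>L (D.kernel \<theta>) (X 1) = enn2real (\<integral>\<^sup>+\<omega>. X 1 \<omega> \<partial>D.kernel \<theta>)"
        using R.X_pos[of 1] by (intro integral_eq_nn_integral AE_I2 less_imp_le) auto
      also have "\<dots> = R.mean_X" unfolding eq using mean K.emeasure_space_1 by simp
      finally show "integral\<^sup>L (P \<theta>) (X 1) = R.mean_X" using D.kernel_pos[OF pos] by simp
    qed
  qed
  have i: "compound_mixed_poisson_process M N X S \<Theta> (distr M borel (X 1)) \<longleftrightarrow>
      compensated_by M R.filt_N (\<lambda>t \<omega>. real (N t \<omega>)) \<Theta> 1"
    using R.risk R.mixed_poisson_iff_compensated by (simp add: compound_mixed_poisson_process_def S_def)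
  have ii: "martingale_L1 M F (\<lambda>t \<omega>. S t \<omega> - t * \<Theta> \<omega> * R.mean_X) \<longleftrightarrow>
      compensated_by M R.filt_N (\<lambda>t \<omega>. real (N t \<omega>)) \<Theta> 1"
    using IS.martingale_iff_compensated[OF mean] R.compensated_aggregate_iff by (simp add: FS S_def)
  \<comment> \<open>The two families differ only at parameters where the fibre mean is not
    \<open>mean_X\<close>, a null set.\<close>
  have "(AE \<theta> in D.law. 0 < \<theta> \<longrightarrow> martingale_L1 (P \<theta>) F (\<lambda>t \<omega>. S t \<omega> - t * \<theta> * integral\<^sup>L (P \<theta>) (X 1))) \<longleftrightarrow>
      (AE \<theta> in D.law. 0 < \<theta> \<longrightarrow> martingale_L1 (P \<theta>) F (\<lambda>t \<omega>. S t \<omega> - t * \<theta> * R.mean_X))"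
  proof
    assume "AE \<theta> in D.law. 0 < \<theta> \<longrightarrow> martingale_L1 (P \<theta>) F (\<lambda>t \<omega>. S t \<omega> - t * \<theta> * integral\<^sup>L (P \<theta>) (X 1))"
    then show "AE \<theta> in D.law. 0 < \<theta> \<longrightarrow> martingale_L1 (P \<theta>) F (\<lambda>t \<omega>. S t \<omega> - t * \<theta> * R.mean_X)"
      using AE_mean by eventually_elim simp
  next
    assume "AE \<theta> in D.law. 0 < \<theta> \<longrightarrow> martingale_L1 (P \<theta>) F (\<lambda>t \<omega>. S t \<omega> - t * \<theta> * R.mean_X)"
    then show "AE \<theta> in D.law. 0 < \<theta> \<longrightarrow> martingale_L1 (P \<theta>) F (\<lambda>t \<omega>. S t \<omega> - t * \<theta> * integral\<^sup>L (P \<theta>) (X 1))"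
      using AE_mean by eventually_elim simp
  qed
  also have "\<dots> \<longleftrightarrow> compensated_by M R.filt_N (\<lambda>t \<omega>. real (N t \<omega>)) \<Theta> 1"
    using IS.martingale_disintegration[OF mean] R.compensated_aggregate_iff by (simp add: FS S_def)
  finally have iii: "(AE \<theta> in D.law. 0 < \<theta> \<longrightarrow> martingale_L1 (P \<theta>) F (\<lambda>t \<omega>. S t \<omega> - t * \<theta> * integral\<^sup>L (P \<theta>) (X 1))) \<longleftrightarrow>
      compensated_by M R.filt_N (\<lambda>t \<omega>. real (N t \<omega>)) \<Theta> 1" .
  have iv: "martingale_L1 M FN (\<lambda>t \<omega>. real (N t \<omega>) - t * \<Theta> \<omega>) \<longleftrightarrow>
      compensated_by M R.filt_N (\<lambda>t \<omega>. real (N t \<omega>)) \<Theta> 1"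
    using R.counting_martingale_iff by (simp add: FN)
  have v: "(AE \<theta> in D.law. 0 < \<theta> \<longrightarrow> martingale_L1 (P \<theta>) FN (\<lambda>t \<omega>. real (N t \<omega>) - t * \<theta>)) \<longleftrightarrow>
      compensated_by M R.filt_N (\<lambda>t \<omega>. real (N t \<omega>)) \<Theta> 1"
    using IN.martingale_disintegration[of 1] by (simp add: FN)
  show ?thesis unfolding i ii iii iv v by simp
qed

end
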